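(* Let $\mathcal{A}$ be a nonzero unital pre-$C^*$-algebra with completion $\overline{\mathcal{A}}$, and let $\mathcal{B}$ be a dense subalgebra of $\mathcal{A}$. (i) If $\mathcal{B}$ is (left) algebraically amenable, then $\overline{\mathcal{A}}$ is a Følner $C^*$-algebra. In particular, $\mathcal{A}$ is a Følner pre-$C^*$-algebra. (ii) If $\mathcal{B}$ is (left) properly algebraically amenable, then $\overline{\mathcal{A}}$ is a properly Følner $C^*$-algebra. In particular, $\mathcal{A}$ is a properly Følner pre-$C^*$-algebra.
   Context: A unital pre-$C^*$-algebra is a unital complex $*$-algebra with a norm satisfying all properties of a $C^*$-norm except possibly completeness; its positive cone is $\mathcal{A}_+=\mathcal{A}\cap\overline{\mathcal{A}}_+$. The dense subalgebra $\mathcal{B}$ is not assumed closed under $*$. All representations are unital $*$-representations on Hilbert spaces (not necessarily separable); a representation $\pi$ is positive if $\pi(\mathcal{A}_+)\subset\mathcal{L}(\mathcal{H})_+$, and cyclic with cyclic vector $\Omega$ if $\pi(\mathcal{A})\Omega$ is dense in $\mathcal{H}$. Algebraic amenability: for a complex algebra $\mathcal{B}$, finite $\mathcal{F}\subset\mathcal{B}$ and $\varepsilon\ge 0$, a (left) $(\mathcal{F},\varepsilon)$-Følner subspace is a nonzero finite-dimensional linear subspace $W\subset\mathcal{B}$ with $\dim(aW+W)\le(1+\varepsilon)\dim W$ for all $a\in\mathcal{F}$. $\mathcal{B}$ is (left) algebraically amenable if for all $\varepsilon>0$ and finite $\mathcal{F}\subset\mathcal{B}$ there is such a $W$; it is (left)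 properly algebraically amenable if moreover $W$ can always be chosen with $\mathcal{F}\subset W$. Følner: a unital pre-$C^*$-algebra (or $C^*$-algebra) $\mathcal{A}$ is Følner if there is a net of unital completely positive maps $\varphi_i\colon\mathcal{A}\to M_{k(i)}(\mathbb{C})$ ($k(i)\ge1$) with $\lim_i\|\varphi_i(AB)-\varphi_i(A)\varphi_i(B)\|_{2,\mathrm{tr}}=0$ for all $A,B\in\mathcal{A}$, where $\|F\|_{2,\mathrm{tr}}=\sqrt{\mathrm{tr}(F^*F)}$ with $\mathrm{tr}$ the normalized trace. Complete positivity means that each entrywise map on $M_m(\mathcal{A})$ sends $M_m(\mathcal{A})_+=\{(\sum_{l=1}^rX_{l,i}^*A_lX_{l,j})_{i,j}: r\in\mathbb{N},A_l\in\mathcal{A}_+,X_{l,i}\in\mathcal{A}\}$ to positive matrices. Properly Følner: a unital pre-$C^*$-algebra (or $C^*$-algebra) $\mathcal{A}$ is properly Følner if for any finite $\mathcal{F}\subset\mathcal{A}$ and $\varepsilon>0$ there exist a positive cyclic representation $\pi\colon\mathcal{A}\to\mathcal{L}(\mathcal{H})$ with cyclic vector $\Omega$ and a nonzero finite rank orthogonal projection $P\in\mathcal{L}(\mathcal{H})$ with $\|\pi(T)P-P\pi(T)\|_2\le\varepsilon\|P\|_2$ for all $T\in\mathcal{F}$ ($\|\cdot\|_2$ the Hilbert–Schmidt norm), such that the linear map $\mathrm{span}\,\mathcal{F}\to\mathcal{H}$, $A\mapsto P\pi(A)\Omega$, is injective. *)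

theory Defs
  imports
    "HOL-Analysis.Infinite_Sum"
    "HOL-Analysis.Elementary_Normed_Spaces"
    "HOL-Library.Function_Algebras"
    "Jordan_Normal_Form.Schur_Decomposition"
begin

section \<open>Complex vector spaces and algebras\<close>

class complex_vector = ab_group_add +
  fixes scaleC :: "complex \<Rightarrow> 'a \<Rightarrow> 'a"  (infixr \<open>*\<^sub>C\<close> 75)
  assumes scaleC_add_right: "c *\<^sub>C (x + y) = c *\<^sub>C x + c *\<^sub>C y"
    and scaleC_add_left: "(c + d) *\<^sub>C x = c *\<^sub>C x + d *\<^sub>C x"
    and scaleC_scaleC: "c *\<^sub>C d *\<^sub>C x = (c * d) *\<^sub>C x"
    and scaleC_one: "1 *\<^sub>C x = x"

global_interpretation complex_vector: vector_space "scaleC :: complex \<Rightarrow> 'a \<Rightarrow> 'a::complex_vector"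
  defines csubspace = complex_vector.subspace
    and cspan = complex_vector.span
    and cdim = complex_vector.dim
  by unfold_locales
    (simp_all add: scaleC_add_right scaleC_add_left scaleC_scaleC scaleC_one)

instantiation complex :: complex_vector
begin

definition scaleC_complex :: "complex \<Rightarrow> complex \<Rightarrow> complex"
  where "scaleC_complex c x = c * x"

instance
  by standard (simp_all add: scaleC_complex_def algebra_simps)

end

instantiation "fun" :: (type, complex_vector) complex_vector
begin

definition scaleC_fun :: "complex \<Rightarrow> ('a \<Rightarrow> 'b) \<Rightarrow> 'a \<Rightarrow> 'b"
  where "scaleC_fun c f = (\<lambda>x. c *\<^sub>C f x)"

instance
  by standard
    (simp_all add: scaleC_fun_def fun_eq_iff scaleC_add_right scaleC_add_left scaleC_scaleC scaleC_one)

end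

definition finite_dimensional :: "'a::complex_vector set \<Rightarrow> bool"
  where "finite_dimensional W \<longleftrightarrow> (\<exists>S. finite S \<and> W \<subseteq> cspan S)"

text \<open>Nonzero unital pre-C*-algebras. Submultiplicativity, the triangle inequality, definiteness and
  \<open>1 \<noteq> 0\<close> come from \<open>real_normed_algebra_1\<close>; its axiom \<open>norm 1 = 1\<close> is a consequence of the
  C*-identity and \<open>1 \<noteq> 0\<close>.\<close>

class pre_cstar_algebra = complex_vector + real_normed_algebra_1 +
  fixes star :: "'a \<Rightarrow> 'a"
  assumes scaleR_scaleC: "r *\<^sub>R x = complex_of_real r *\<^sub>C x"
    and scaleC_mult_left: "(c *\<^sub>C x) * y = c *\<^sub>C (x * y)"
    and scaleC_mult_right: "x * (c *\<^sub>C y) = c *\<^sub>C (x * y)"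
    and norm_scaleC: "norm (c *\<^sub>C x) = cmod c * norm x"
    and star_star: "star (star x) = x"
    and star_add: "star (x + y) = star x + star y"
    and star_scaleC: "star (c *\<^sub>C x) = cnj c *\<^sub>C star x"
    and star_mult: "star (x * y) = star y * star x"
    and cstar_identity: "norm (star x * x) = (norm x)\<^sup>2"

class cstar_algebra = pre_cstar_algebra + complete_space

definition complex_linear :: "('a::complex_vector \<Rightarrow> 'b::complex_vector) \<Rightarrow> bool"
  where "complex_linear f \<longleftrightarrow>
    (\<forall>x y. f (x + y) = f x + f y) \<and> (\<forall>c x. f (c *\<^sub>C x) = c *\<^sub>C f x)"

definition completion_map :: "('a::pre_cstar_algebra \<Rightarrow> 'b::cstar_algebra) \<Rightarrow> bool"
  where "completion_map \<iota> \<longleftrightarrow>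
    complex_linear \<iota> \<and> (\<forall>x y. \<iota> (x * y) = \<iota> x * \<iota> y) \<and> \<iota> 1 = 1 \<and>
    (\<forall>x. \<iota> (star x) = star (\<iota> x)) \<and> (\<forall>x. norm (\<iota> x) = norm x) \<and>
    closure (range \<iota>) = UNIV"

definition cstar_positive :: "'a::cstar_algebra set"
  where "cstar_positive = {star x * x | x. True}"

text \<open>No unit is required.\<close>

definition subalgebra :: "'a::pre_cstar_algebra set \<Rightarrow> bool"
  where "subalgebra B \<longleftrightarrow> csubspace B \<and> (\<forall>x\<in>B. \<forall>y\<in>B. x * y \<in> B)"


section \<open>Algebraic amenability\<close>

definition foelner_subspace ::
    "'a::pre_cstar_algebra set \<Rightarrow> 'a set \<Rightarrow> real \<Rightarrow> 'a set \<Rightarrow> bool"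
  where "foelner_subspace B F \<epsilon> W \<longleftrightarrow>
    csubspace W \<and> W \<subseteq> B \<and> W \<noteq> {0} \<and> finite_dimensional W \<and>
    (\<forall>a\<in>F. real (cdim {a * v + w | v w. v \<in> W \<and> w \<in> W}) \<le> (1 + \<epsilon>) * real (cdim W))"

definition algebraically_amenable :: "'a::pre_cstar_algebra set \<Rightarrow> bool"
  where "algebraically_amenable B \<longleftrightarrow>
    (\<forall>\<epsilon>>0. \<forall>F. finite F \<and> F \<subseteq> B \<longrightarrow> (\<exists>W. foelner_subspace B F \<epsilon> W))"

definition properly_algebraically_amenable :: "'a::pre_cstar_algebra set \<Rightarrow> bool"
  where "properly_algebraically_amenable B \<longleftrightarrow>
    (\<forall>\<epsilon>>0. \<forall>F. finite F \<and> F \<subseteq> B \<longrightarrow> (\<exists>W. foelner_subspace B F \<epsilon> W \<and> F \<subseteq> W))"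


section \<open>Foelner algebras\<close>

definition psd_mat :: "nat \<Rightarrow> complex mat \<Rightarrow> bool"
  where "psd_mat n M \<longleftrightarrow> M \<in> carrier_mat n n \<and> (\<forall>v\<in>carrier_vec n. 0 \<le> (M *\<^sub>v v) \<bullet>c v)"

text \<open>In this section and the next, \<open>P\<close> is the positive cone of the algebra: \<open>cstar_positive\<close> for a
  C*-algebra and \<open>\<iota> -` cstar_positive\<close> for a pre-C*-algebra with completion \<open>\<iota>\<close>.\<close>

definition matrix_cone :: "'a::pre_cstar_algebra set \<Rightarrow> nat \<Rightarrow> 'a mat set"
  where "matrix_cone P m =
    {mat m m (\<lambda>(i, j). \<Sum>l<r. star (X l i) * A l * X l j) | (r::nat) A X. \<forall>l<r. A l \<in> P}"

text \<open>The entrywise extension of a map into the \<open>k \<times> k\<close> matrices; a matrix of matrices is read as a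
  block matrix.\<close>

definition entrywise :: "nat \<Rightarrow> ('a \<Rightarrow> complex mat) \<Rightarrow> nat \<Rightarrow> 'a mat \<Rightarrow> complex mat"
  where "entrywise k \<phi> m M =
    mat (m * k) (m * k) (\<lambda>(p, q). \<phi> (M $$ (p div k, q div k)) $$ (p mod k, q mod k))"

definition completely_positive ::
    "'a::pre_cstar_algebra set \<Rightarrow> nat \<Rightarrow> ('a \<Rightarrow> complex mat) \<Rightarrow> bool"
  where "completely_positive P k \<phi> \<longleftrightarrow>
    (\<forall>m. \<forall>M\<in>matrix_cone P m. psd_mat (m * k) (entrywise k \<phi> m M))"

definition ucp_map :: "'a::pre_cstar_algebra set \<Rightarrow> nat \<Rightarrow> ('a \<Rightarrow> complex mat) \<Rightarrow> bool"
  where "ucp_map P k \<phi> \<longleftrightarrow>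
    (\<forall>x. \<phi> x \<in> carrier_mat k k) \<and>
    (\<forall>x y. \<phi> (x + y) = \<phi> x + \<phi> y) \<and> (\<forall>c x. \<phi> (c *\<^sub>C x) = c \<cdot>\<^sub>m \<phi> x) \<and>
    \<phi> 1 = 1\<^sub>m k \<and> completely_positive P k \<phi>"

definition normalized_trace :: "complex mat \<Rightarrow> complex"
  where "normalized_trace M = (\<Sum>i<dim_row M. M $$ (i, i)) / of_nat (dim_row M)"

definition norm_2_tr :: "complex mat \<Rightarrow> real"
  where "norm_2_tr M = sqrt (Re (normalized_trace (mat_adjoint M * M)))"

definition directed_set :: "'i set \<Rightarrow> ('i \<Rightarrow> 'i \<Rightarrow> bool) \<Rightarrow> bool"
  where "directed_set I leq \<longleftrightarrow>
    I \<noteq> {} \<and> (\<forall>i\<in>I. leq i i) \<and>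
    (\<forall>i\<in>I. \<forall>j\<in>I. \<forall>k\<in>I. leq i j \<longrightarrow> leq j k \<longrightarrow> leq i k) \<and>
    (\<forall>i\<in>I. \<forall>j\<in>I. \<exists>k\<in>I. leq i k \<and> leq j k)"

definition net_tendsto :: "'i set \<Rightarrow> ('i \<Rightarrow> 'i \<Rightarrow> bool) \<Rightarrow> ('i \<Rightarrow> real) \<Rightarrow> real \<Rightarrow> bool"
  where "net_tendsto I leq x a \<longleftrightarrow> (\<forall>e>0. \<exists>i0\<in>I. \<forall>i\<in>I. leq i0 i \<longrightarrow> \<bar>x i - a\<bar> < e)"

text \<open>The index type \<open>'a set \<times> nat\<close> is no restriction: from a net with an arbitrary index set, choose
  for each finite \<open>F\<close> and each \<open>n\<close> a member whose defect is below \<open>1 / (n + 1)\<close> on \<open>F\<close>; this is a net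
  indexed by the pairs \<open>(F, n)\<close>.\<close>

definition foelner :: "'a::pre_cstar_algebra set \<Rightarrow> bool"
  where "foelner P \<longleftrightarrow>
    (\<exists>(I :: ('a set \<times> nat) set) leq k \<phi>.
      directed_set I leq \<and> (\<forall>i\<in>I. 1 \<le> k i \<and> ucp_map P (k i) (\<phi> i)) \<and>
      (\<forall>A B. net_tendsto I leq (\<lambda>i. norm_2_tr (\<phi> i (A * B) - \<phi> i A * \<phi> i B)) 0))"


section \<open>Hilbert spaces and representations\<close>

text \<open>A Hilbert space is a linear subspace \<open>H\<close> of an ambient complex vector space (without topology)
  together with an inner product \<open>ip\<close> on \<open>H\<close>, linear in the second argument. Operators are functions
  on the ambient type of which only the values on \<open>H\<close> matter.\<close>

definition hnorm :: "('h \<Rightarrow> 'h \<Rightarrow> complex) \<Rightarrow> 'h \<Rightarrow> real"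
  where "hnorm ip x = sqrt (Re (ip x x))"

definition hilbert_space :: "'h::complex_vector set \<Rightarrow> ('h \<Rightarrow> 'h \<Rightarrow> complex) \<Rightarrow> bool"
  where "hilbert_space H ip \<longleftrightarrow>
    csubspace H \<and>
    (\<forall>x\<in>H. \<forall>y\<in>H. \<forall>z\<in>H. ip x (y + z) = ip x y + ip x z) \<and>
    (\<forall>x\<in>H. \<forall>y\<in>H. \<forall>c. ip x (c *\<^sub>C y) = c * ip x y) \<and>
    (\<forall>x\<in>H. \<forall>y\<in>H. ip y x = cnj (ip x y)) \<and>
    (\<forall>x\<in>H. 0 \<le> ip x x) \<and> (\<forall>x\<in>H. ip x x = 0 \<longrightarrow> x = 0) \<and>
    (\<forall>X::nat \<Rightarrow> 'h. (\<forall>n. X n \<in> H) \<and>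
        (\<forall>e>0. \<exists>N. \<forall>m\<ge>N. \<forall>n\<ge>N. hnorm ip (X m - X n) < e) \<longrightarrow>
      (\<exists>x\<in>H. (\<lambda>n. hnorm ip (X n - x)) \<longlonglongrightarrow> 0))"

definition hdense :: "'h::complex_vector set \<Rightarrow> ('h \<Rightarrow> 'h \<Rightarrow> complex) \<Rightarrow> 'h set \<Rightarrow> bool"
  where "hdense H ip D \<longleftrightarrow> D \<subseteq> H \<and> (\<forall>x\<in>H. \<forall>e>0. \<exists>y\<in>D. hnorm ip (x - y) < e)"

definition bounded_operator ::
    "'h::complex_vector set \<Rightarrow> ('h \<Rightarrow> 'h \<Rightarrow> complex) \<Rightarrow> ('h \<Rightarrow> 'h) \<Rightarrow> bool"
  where "bounded_operator H ip T \<longleftrightarrow>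
    (\<forall>x\<in>H. T x \<in> H) \<and>
    (\<forall>x\<in>H. \<forall>y\<in>H. T (x + y) = T x + T y) \<and> (\<forall>c. \<forall>x\<in>H. T (c *\<^sub>C x) = c *\<^sub>C T x) \<and>
    (\<exists>K. \<forall>x\<in>H. hnorm ip (T x) \<le> K * hnorm ip x)"

definition positive_operator ::
    "'h::complex_vector set \<Rightarrow> ('h \<Rightarrow> 'h \<Rightarrow> complex) \<Rightarrow> ('h \<Rightarrow> 'h) \<Rightarrow> bool"
  where "positive_operator H ip T \<longleftrightarrow> bounded_operator H ip T \<and> (\<forall>x\<in>H. 0 \<le> ip x (T x))"

definition orthogonal_projection ::
    "'h::complex_vector set \<Rightarrow> ('h \<Rightarrow> 'h \<Rightarrow> complex) \<Rightarrow> ('h \<Rightarrow> 'h) \<Rightarrow> bool"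
  where "orthogonal_projection H ip Q \<longleftrightarrow>
    bounded_operator H ip Q \<and> (\<forall>x\<in>H. Q (Q x) = Q x) \<and>
    (\<forall>x\<in>H. \<forall>y\<in>H. ip (Q x) y = ip x (Q y))"

definition orthonormal_basis ::
    "'h::complex_vector set \<Rightarrow> ('h \<Rightarrow> 'h \<Rightarrow> complex) \<Rightarrow> 'h set \<Rightarrow> bool"
  where "orthonormal_basis H ip E \<longleftrightarrow>
    E \<subseteq> H \<and> (\<forall>e\<in>E. \<forall>f\<in>E. ip e f = (if e = f then 1 else 0)) \<and> hdense H ip (cspan E)"

text \<open>The Hilbert--Schmidt norm does not depend on the orthonormal basis. It is used below for
  finite-rank operators only, for which the sum converges.\<close>

definition hs_norm ::
    "'h::complex_vector set \<Rightarrow> ('h \<Rightarrow> 'h \<Rightarrow> complex) \<Rightarrow> ('h \<Rightarrow> 'h) \<Rightarrow> real"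
  where "hs_norm H ip T =
    sqrt (\<Sum>\<^sub>\<infinity>e\<in>(SOME E. orthonormal_basis H ip E). (hnorm ip (T e))\<^sup>2)"

definition representation ::
    "'h::complex_vector set \<Rightarrow> ('h \<Rightarrow> 'h \<Rightarrow> complex) \<Rightarrow> ('a::pre_cstar_algebra \<Rightarrow> 'h \<Rightarrow> 'h) \<Rightarrow> bool"
  where "representation H ip \<pi> \<longleftrightarrow>
    (\<forall>a. bounded_operator H ip (\<pi> a)) \<and>
    (\<forall>a b. \<forall>x\<in>H. \<pi> (a + b) x = \<pi> a x + \<pi> b x) \<and>
    (\<forall>c a. \<forall>x\<in>H. \<pi> (c *\<^sub>C a) x = c *\<^sub>C \<pi> a x) \<and>
    (\<forall>a b. \<forall>x\<in>H. \<pi> (a * b) x = \<pi> a (\<pi> b x)) \<and>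
    (\<forall>x\<in>H. \<pi> 1 x = x) \<and>
    (\<forall>a. \<forall>x\<in>H. \<forall>y\<in>H. ip (\<pi> (star a) x) y = ip x (\<pi> a y))"

definition positive_cyclic_representation ::
    "'a::pre_cstar_algebra set \<Rightarrow> 'h::complex_vector set \<Rightarrow> ('h \<Rightarrow> 'h \<Rightarrow> complex) \<Rightarrow>
      ('a \<Rightarrow> 'h \<Rightarrow> 'h) \<Rightarrow> 'h \<Rightarrow> bool"
  where "positive_cyclic_representation P H ip \<pi> \<Omega> \<longleftrightarrow>
    representation H ip \<pi> \<and> (\<forall>a\<in>P. positive_operator H ip (\<pi> a)) \<and>
    \<Omega> \<in> H \<and> hdense H ip (range (\<lambda>a. \<pi> a \<Omega>))"

text \<open>Taking \<open>'a \<Rightarrow> complex\<close> as the ambient vector space is no restriction: for a representation on any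
  Hilbert space with cyclic vector \<open>\<Omega>\<close>, the map sending \<open>x\<close> to \<open>\<lambda>a. ip (\<pi> a \<Omega>) x\<close> is linear and, by
  cyclicity, injective, so it carries all the data over to a linear subspace of \<open>'a \<Rightarrow> complex\<close>.\<close>

definition properly_foelner :: "'a::pre_cstar_algebra set \<Rightarrow> bool"
  where "properly_foelner P \<longleftrightarrow>
    (\<forall>F. \<forall>\<epsilon>>0. finite F \<longrightarrow>
      (\<exists>(H :: ('a \<Rightarrow> complex) set) ip \<pi> \<Omega> Q.
        hilbert_space H ip \<and> positive_cyclic_representation P H ip \<pi> \<Omega> \<and>
        orthogonal_projection H ip Q \<and> finite_dimensional (Q ` H) \<and> (\<exists>x\<in>H. Q x \<noteq> 0) \<and>
        (\<forall>T\<in>F. hs_norm H ip (\<lambda>x. \<pi> T (Q x) - Q (\<pi> T x)) \<le> \<epsilon> * hs_norm H ip Q) \<and>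
        inj_on (\<lambda>A. Q (\<pi> A \<Omega>)) (cspan F)))"

end

theory Submission
  imports Defs "HOL-Analysis.Generalised_Binomial_Theorem"
begin

text \<open>Let \<open>W\<close> be a Foelner subspace and \<open>\<phi>\<close> a state with \<open>\<phi> (z\<^sup>* z) > 0\<close> for all nonzero \<open>z\<close> in a
  finite-dimensional space containing \<open>W + a W\<close> for the relevant \<open>a\<close>. In the GNS representation \<open>\<pi>\<close> of \<open>\<phi>\<close>
  let \<open>Q\<close> be the projection onto \<open>\<pi> W \<Omega>\<close>, of rank \<open>dim W\<close>. Then \<open>(1 - Q) \<pi> a Q\<close> has rank at most
  \<open>\<epsilon> dim W\<close>, so its Hilbert--Schmidt norm is at most \<open>\<parallel>a\<parallel> (\<epsilon> dim W)\<^sup>1\<^sup>/\<^sup>2\<close>; by density such an estimate holds for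
  all elements \<open>T\<close>, and also for \<open>T\<^sup>*\<close>, which controls the commutator of \<open>\<pi> T\<close> and \<open>Q\<close>. The compressions
  \<open>T \<mapsto> Q \<pi> T Q\<close> are unital completely positive and asymptotically multiplicative.

  States with this faithfulness are averages of states separating single elements. These come from
  the Hahn--Banach theorem once \<open>x\<^sup>* x\<close> is known to lie in the positive cone defined by norms.\<close>

section \<open>Involutions\<close>

text \<open>A large algebra need not have a faithful state, so faithfulness is only asked on
  finite-dimensional spaces. It is what carries the count dim (W + a W) - dim W over to Hilbert
  space, where null vectors of the state in W + a W could make dimensions collapse. The
  multiplicativity defect is Q A B Q - Q A Q B Q = Q A (1 - Q) B Q, so part (i) needs no adjoints.
  The commutator in part (ii) does; as the subalgebra need not be closed under \<open>star\<close>,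
  the adjoint of an approximant of T is no help, and \<open>star T\<close> receives an approximant
  of its own. The order of choices is forced: the approximants, because the Hilbert--Schmidt
  estimate involves their norms; the tolerance; W; and last the state, faithful on a space that
  depends on W. Both implications are proved for any cone \<open>P\<close> with
  \<open>separating_states P\<close>. The completion and the algebra itself are two instances, and
  states of the second come from the first by restriction.\<close>

lemma star_0 [simp]: "star (0::'a::pre_cstar_algebra) = 0"
  using star_add[of 0 0] by simp

lemma star_minus [simp]: "star (- x :: 'a::pre_cstar_algebra) = - star x"
  using star_add[of x "- x"] by (simp add: eq_neg_iff_add_eq_0 add.commute)

lemma star_diff: "star (x - y :: 'a::pre_cstar_algebra) = star x - star y"
  using star_add[of x "- y"] by simp

lemma star_1 [simp]: "star (1::'a::pre_cstar_algebra) = 1"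
  by (metis mult.left_neutral mult.right_neutral star_mult star_star)

lemma star_scaleR [simp]: "star (r *\<^sub>R x :: 'a::pre_cstar_algebra) = r *\<^sub>R star x"
  by (simp add: scaleR_scaleC star_scaleC)

lemma star_sum: "star (\<Sum>i\<in>I. f i :: 'a::pre_cstar_algebra) = (\<Sum>i\<in>I. star (f i))"
  by (induction I rule: infinite_finite_induct) (simp_all add: star_add)

lemma norm_star [simp]: "norm (star x :: 'a::pre_cstar_algebra) = norm x"
proof -
  have *: "norm y \<le> norm (star y)" for y :: 'a
  proof (cases "y = 0")
    case False
    have "norm y * norm y \<le> norm (star y) * norm y"
      using norm_mult_ineq[of "star y" y] by (simp add: cstar_identity power2_eq_square)
    with False show ?thesis by simp
  qed simp
  from *[of x] *[of "star x"] show ?thesis by (simp add: star_star)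
qed

lemma norm_mult_self:
  assumes "star (x::'a::pre_cstar_algebra) = x"
  shows "norm (x * x) = (norm x)\<^sup>2"
  using cstar_identity[of x] assms by simp

lemma star_power: "star (x ^ n :: 'a::pre_cstar_algebra) = star x ^ n"
  by (induction n) (simp_all add: star_mult power_commutes)

lemma bounded_linear_star: "bounded_linear (star :: 'a::pre_cstar_algebra \<Rightarrow> 'a)"
  by (rule bounded_linear_intro[where K = 1]) (simp_all add: star_add)


section \<open>Binomial series in a C*-algebra\<close>

instance cstar_algebra \<subseteq> banach ..

text \<open>This is (1 + g)^r for \<open>g\<close> of norm below 1. Real exponents yield square
  roots, fourth roots and inverses from a single series.\<close>

definition binpow :: "real \<Rightarrow> 'a::cstar_algebra \<Rightarrow> 'a"
  where "binpow r g = (\<Sum>n. (r gchoose n) *\<^sub>R g ^ n)"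

lemma summable_binpow:
  assumes "norm (g::'a::cstar_algebra) < 1"
  shows "summable (\<lambda>n. norm ((r gchoose n) *\<^sub>R g ^ n))"
proof (rule summable_comparison_test')
  have "ereal (norm (norm g)) < conv_radius (\<lambda>n. r gchoose n)"
    using assms conv_radius_gchoose[of r] by (simp split: if_splits)
  from abs_summable_in_conv_radius[OF this]
  show "summable (\<lambda>n. norm ((r gchoose n) * norm g ^ n))" .
  show "norm (norm ((r gchoose n) *\<^sub>R g ^ n)) \<le> norm ((r gchoose n) * norm g ^ n)" for n
    by (simp add: abs_mult mult_left_mono norm_power_ineq)
qed

text \<open>Vandermonde's convolution of generalised binomial coefficients is the exponent law read
  off coefficientwise from the Cauchy product.\<close>

lemma binpow_mult:
  assumes "norm (g::'a::cstar_algebra) < 1"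
  shows "binpow r g * binpow s g = binpow (r + s) g"
proof -
  have "(\<Sum>i\<le>k. (r gchoose i) *\<^sub>R g ^ i * (s gchoose (k - i)) *\<^sub>R g ^ (k - i))
      = (r + s gchoose k) *\<^sub>R g ^ k" for k
  proof -
    have "(\<Sum>i\<le>k. (r gchoose i) *\<^sub>R g ^ i * (s gchoose (k - i)) *\<^sub>R g ^ (k - i))
        = (\<Sum>i\<le>k. ((r gchoose i) * (s gchoose (k - i))) *\<^sub>R g ^ k)"
      by (intro sum.cong) (simp_all add: mult.commute flip: power_add)
    also have "\<dots> = (r + s gchoose k) *\<^sub>R g ^ k"
      using gbinomial_Vandermonde[of r s k]
      by (simp add: atMost_atLeast0 flip: scaleR_left.sum)
    finally show ?thesis .
  qed
  with Cauchy_product_sums[OF summable_binpow[OF assms, of r] summable_binpow[OF assms, of s]]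
  show ?thesis by (simp add: binpow_def sums_iff)
qed

lemma binpow_0 [simp]: "binpow 0 (g::'a::cstar_algebra) = 1"
proof -
  have "binpow 0 g = (\<Sum>n\<in>{0}. (0 gchoose n :: real) *\<^sub>R g ^ n)"
    unfolding binpow_def by (rule suminf_finite) (simp_all add: gbinomial_0_left)
  then show ?thesis by simp
qed

lemma binpow_1 [simp]: "binpow 1 (g::'a::cstar_algebra) = 1 + g"
proof -
  have "(1 gchoose n :: real) = 0" if "n \<notin> {0, 1}" for n
    using that binomial_gbinomial[of 1 n, where 'a = real] by (simp add: binomial_eq_0)
  then have "binpow 1 g = (\<Sum>n\<in>{0,1}. (1 gchoose n :: real) *\<^sub>R g ^ n)"
    unfolding binpow_def by (intro suminf_finite) simp_all
  then show ?thesis by simp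
qed

lemma star_binpow:
  assumes "norm (g::'a::cstar_algebra) < 1" "star g = g"
  shows "star (binpow r g) = binpow r g"
proof -
  have "star (binpow r g) = (\<Sum>n. star ((r gchoose n) *\<^sub>R g ^ n))"
    unfolding binpow_def
    using bounded_linear.suminf[OF bounded_linear_star summable_norm_cancel[OF summable_binpow[OF assms(1)]]] .
  then show ?thesis by (simp add: star_power assms binpow_def)
qed

lemma binpow_commute:
  assumes "norm (g::'a::cstar_algebra) < 1" "x * g = g * x"
  shows "x * binpow r g = binpow r g * x"
proof -
  note s = summable_norm_cancel[OF summable_binpow[OF assms(1), of r]]
  have "x * g ^ n = g ^ n * x" for n
    using power_commuting_commutes[of g x n] assms(2) by simp
  then show ?thesis
    unfolding binpow_def using suminf_mult[OF s, of x] suminf_mult2[OF s, of x] by simp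
qed


section \<open>The positive cone of a C*-algebra\<close>

text \<open>Positivity expressed by norms, so that the set of positive elements is a closed convex
  cone by the triangle inequality.\<close>

definition pos :: "'a::cstar_algebra \<Rightarrow> bool"
  where "pos a \<longleftrightarrow> star a = a \<and> (\<forall>e>0. \<exists>t. norm (t *\<^sub>R 1 - a) < t + e)"

lemma pos_star: "pos a \<Longrightarrow> star a = a"
  by (simp add: pos_def)

lemma posI: "star a = a \<Longrightarrow> norm (t *\<^sub>R 1 - a) \<le> t \<Longrightarrow> pos a"
  unfolding pos_def by (metis add.commute add_0 add_le_less_mono order.strict_trans1 less_add_same_cancel1)

lemma pos_add: "pos a \<Longrightarrow> pos b \<Longrightarrow> pos (a + b)"
  unfolding pos_def
proof safe
  fix e :: real
  assume "e > 0" and "\<forall>e>0. \<exists>t. norm (t *\<^sub>R 1 - a) < t + e" "\<forall>e>0. \<exists>t. norm (t *\<^sub>R 1 - b) < t + e"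
  then obtain s t where "norm (s *\<^sub>R 1 - a) < s + e/2" "norm (t *\<^sub>R 1 - b) < t + e/2"
    by (meson half_gt_zero)
  then show "\<exists>t. norm (t *\<^sub>R 1 - (a + b)) < t + e"
    using norm_triangle_ineq[of "s *\<^sub>R 1 - a" "t *\<^sub>R 1 - b"]
    by (intro exI[of _ "s + t"]) (simp add: algebra_simps)
qed (simp add: star_add)

lemma pos_scaleR: assumes "pos a" "0 \<le> r" shows "pos (r *\<^sub>R a)"
proof (cases "r = 0")
  case True
  then show ?thesis using posI[of "0::'a" 0] by simp
next
  case False
  with assms(2) have r: "r > 0" by simp
  have "\<exists>t. norm (t *\<^sub>R 1 - r *\<^sub>R a) < t + e" if "e > 0" for e
  proof -
    obtain t where t: "norm (t *\<^sub>R 1 - a) < t + e / r"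
      using assms(1) \<open>e > 0\<close> r unfolding pos_def by (meson divide_pos_pos)
    have "norm ((r * t) *\<^sub>R 1 - r *\<^sub>R a) = r * norm (t *\<^sub>R 1 - a)"
      using r by (simp flip: scaleR_scaleR scaleR_diff_right)
    also have "\<dots> < r * t + e" using t r by (simp add: field_simps)
    finally show ?thesis by blast
  qed
  then show ?thesis using assms(1) by (simp add: pos_def)
qed

lemma pos_real: "0 \<le> t \<Longrightarrow> pos (t *\<^sub>R 1)"
  by (rule posI[where t = t]) simp_all

lemma pos_norm_diff: "star a = a \<Longrightarrow> norm a \<le> t \<Longrightarrow> pos (t *\<^sub>R 1 - a)"
  by (rule posI[where t = t]) (simp_all add: star_diff)

text \<open>The slack \<open>e\<close> in \<open>pos\<close> is made for this: half of it absorbs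
  the distance from \<open>a\<close> to \<open>b\<close>, and the witness \<open>t\<close> of
  \<open>b\<close> then serves for \<open>a\<close>.\<close>

lemma pos_closed:
  assumes "star a = a" "\<And>e. e > 0 \<Longrightarrow> \<exists>b. pos b \<and> norm (a - b) < e"
  shows "pos a"
  unfolding pos_def
proof (intro conjI allI impI)
  fix e :: real assume "e > 0"
  then obtain b where b: "pos b" "norm (a - b) < e/2" using assms(2)[of "e/2"] by auto
  then obtain t where "norm (t *\<^sub>R 1 - b) < t + e/2"
    using \<open>e > 0\<close> unfolding pos_def by (meson half_gt_zero)
  then have "norm (t *\<^sub>R 1 - a) < t + e"
    using b(2) norm_triangle_ineq4[of "t *\<^sub>R 1 - b" "a - b"] by simp
  then show "\<exists>t. norm (t *\<^sub>R 1 - a) < t + e" ..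
qed (fact assms)

lemma pos_real_iff: "pos (t *\<^sub>R (1::'a::cstar_algebra)) \<longleftrightarrow> 0 \<le> t"
proof
  assume *: "pos (t *\<^sub>R (1::'a))"
  show "0 \<le> t"
  proof (rule ccontr)
    assume "\<not> 0 \<le> t"
    then obtain s where "norm (s *\<^sub>R (1::'a) - t *\<^sub>R 1) < s + - t / 2"
      using * unfolding pos_def by (metis divide_pos_pos neg_0_less_iff_less not_le zero_less_numeral)
    then show False using \<open>\<not> 0 \<le> t\<close> by (simp flip: scaleR_diff_left)
  qed
qed (rule pos_real)

text \<open>For commuting selfadjoint \<open>b\<close>, \<open>c\<close> the element \<open>u = b + \<i> c\<close> is normal
  with real part \<open>b\<close> and \<open>u\<^sup>* u = b\<^sup>2 + c\<^sup>2\<close>.\<close>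

lemma norm_le_sum_squares:
  fixes b c :: "'a::pre_cstar_algebra"
  assumes "star b = b" "star c = c" "b * c = c * b"
  shows "(norm b)\<^sup>2 \<le> norm (b * b + c * c)"
proof -
  define u where "u = b + \<i> *\<^sub>C c"
  have su: "star u = b - \<i> *\<^sub>C c"
    by (simp add: u_def star_add star_scaleC assms)
  have "star u * u = b * b + c * c"
    unfolding su
    by (simp add: u_def algebra_simps scaleC_mult_left scaleC_mult_right scaleC_scaleC assms(3))
  then have u: "(norm u)\<^sup>2 = norm (b * b + c * c)" by (metis cstar_identity)
  have "2 *\<^sub>R b = u + star u" unfolding su by (simp add: u_def scaleR_2)
  then have "2 * norm b \<le> norm u + norm (star u)"
    by (metis norm_scaleR norm_triangle_ineq abs_numeral)
  then have "norm b \<le> norm u" by simp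
  then show ?thesis using u by (metis norm_ge_zero power_mono)
qed

text \<open>A substitute for functional calculus: the powers a^r as a one-parameter group of
  selfadjoint elements. The commutation clause stands in for membership in the closed subalgebra
  generated by \<open>a\<close>.\<close>

definition real_powers :: "'a::pre_cstar_algebra \<Rightarrow> (real \<Rightarrow> 'a) \<Rightarrow> bool"
  where "real_powers a f \<longleftrightarrow> (\<forall>r s. f r * f s = f (r + s)) \<and> f 0 = 1 \<and> f 1 = a \<and>
    (\<forall>r. star (f r) = f r) \<and> (\<forall>r x. x * a = a * x \<longrightarrow> x * f r = f r * x)"

text \<open>Here a = t (1 + g) with \<open>g\<close> of norm below 1, so a^r is t^r (1 +
  g)^r.\<close>

lemma strict_pos_powers:
  fixes a :: "'a::cstar_algebra"
  assumes "star a = a" "norm (t *\<^sub>R 1 - a) < t"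
  shows "\<exists>f. real_powers a f"
proof -
  have t: "t > 0" using assms(2) by (meson norm_ge_zero order.strict_trans1)
  define g where "g = (1/t) *\<^sub>R a - 1"
  have a: "a = t *\<^sub>R (1 + g)" using t by (simp add: g_def)
  have "norm g = norm ((1/t) *\<^sub>R (t *\<^sub>R 1 - a))"
    using t by (simp add: g_def algebra_simps norm_minus_commute del: norm_scaleR)
  also have "\<dots> < 1" using t assms(2) by simp
  finally have g: "norm g < 1" .
  have sg: "star g = g" by (simp add: g_def star_diff assms)
  have "x * binpow r g = binpow r g * x" if "x * a = a * x" for r x
    by (rule binpow_commute[OF g]) (use that in \<open>simp add: g_def right_diff_distrib left_diff_distrib\<close>)
  then have "real_powers a (\<lambda>r. (t powr r) *\<^sub>R binpow r g)"
    unfolding real_powers_def using t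
    by (simp add: a[symmetric] binpow_mult[OF g] star_binpow[OF g sg] powr_add mult.commute)
  then show ?thesis by blast
qed

text \<open>The shift by \<open>e\<close> turns the slack in \<open>pos\<close> into the strict
  inequality required by the series, with centre \<open>t + e\<close>.\<close>

lemma pos_powers:
  fixes a :: "'a::cstar_algebra"
  assumes "pos a" "e > 0"
  shows "\<exists>f. real_powers (a + e *\<^sub>R 1) f"
proof -
  obtain t where "norm (t *\<^sub>R 1 - a) < t + e" using assms unfolding pos_def by blast
  then have "norm ((t + e) *\<^sub>R 1 - (a + e *\<^sub>R 1)) < t + e" by (simp add: algebra_simps)
  moreover have "star (a + e *\<^sub>R 1) = a + e *\<^sub>R 1" using assms by (simp add: star_add pos_star)
  ultimately show ?thesis by (intro strict_pos_powers)
qed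

text \<open>After scaling \<open>h\<close> to \<open>g\<close> of norm below 1, the root
  \<open>y\<close> of \<open>1 - g * g\<close> satisfies \<open>y * y + g * g = 1\<close>. Hence
  \<open>1 - g * g = y * y\<close> has norm at most 1 by \<open>norm_le_sum_squares\<close>, which
  is the witness \<open>t = 1\<close> for \<open>g * g\<close>.\<close>

lemma pos_square:
  assumes "star (h::'a::cstar_algebra) = h"
  shows "pos (h * h)"
proof -
  define r where "r = norm h + 1"
  have r: "r > 0" by (simp add: r_def add_nonneg_pos)
  define g where "g = (1/r) *\<^sub>R h"
  have sg: "star g = g" using assms by (simp add: g_def)
  have "norm g < 1" using r by (simp add: g_def) (simp add: r_def)
  then have g2: "norm (1 *\<^sub>R 1 - (1 - g * g)) < 1"
    using norm_mult_self[OF sg] by (simp add: power_less_one_iff)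
  have "star (1 - g * g) = 1 - g * g" by (simp add: star_diff star_mult sg)
  then obtain f where f: "real_powers (1 - g * g) f" using strict_pos_powers[OF _ g2] by blast
  define y where "y = f (1/2)"
  have "f (1/2) * f (1/2) = f (1/2 + 1/2)" using f unfolding real_powers_def by blast
  then have y: "y * y = 1 - g * g" "star y = y" using f by (simp_all add: y_def real_powers_def)
  have "g * (1 - g * g) = (1 - g * g) * g" by (simp add: algebra_simps)
  then have "g * y = y * g" using f unfolding y_def real_powers_def by blast
  then have "(norm y)\<^sup>2 \<le> norm (y * y + g * g)" by (intro norm_le_sum_squares) (simp_all add: y sg)
  then have "norm (1 *\<^sub>R 1 - g * g) \<le> 1" using y norm_mult_self[of y] by simp
  then have "pos (g * g)" by (intro posI[where t = 1]) (simp_all add: star_mult sg)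
  then have "pos ((r * r) *\<^sub>R (g * g))" by (rule pos_scaleR) (use r in simp)
  then show ?thesis using r by (simp add: g_def)
qed

text \<open>The root is \<open>f (1/2)\<close>, positive as the square of the selfadjoint
  \<open>f (1/4)\<close>. Only the shifted element gets a root; the limit \<open>e\<close> to 0 is
  taken later, in the conclusions drawn from it.\<close>

lemma pos_root:
  fixes a :: "'a::cstar_algebra"
  assumes "pos a" "e > 0"
  obtains b where "pos b" "b * b = a + e *\<^sub>R 1" "\<forall>x. x * a = a * x \<longrightarrow> x * b = b * x"
proof -
  obtain f where f: "real_powers (a + e *\<^sub>R 1) f" using pos_powers[OF assms] by blast
  then have "f (1/4) * f (1/4) = f (1/4 + 1/4)" "f (1/2) * f (1/2) = f (1/2 + 1/2)"
    unfolding real_powers_def by blast+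
  with f have "pos (f (1/2))" "f (1/2) * f (1/2) = a + e *\<^sub>R 1"
    using pos_square[of "f (1/4)"] by (simp_all add: real_powers_def)
  moreover have "x * f (1/2) = f (1/2) * x" if "x * a = a * x" for x
  proof -
    have "x * (a + e *\<^sub>R 1) = (a + e *\<^sub>R 1) * x" using that by (simp add: distrib_left distrib_right)
    then show ?thesis using f unfolding real_powers_def by blast
  qed
  ultimately show thesis by (intro that[of "f (1/2)"]) blast+
qed

lemma pos_invertible:
  fixes a :: "'a::cstar_algebra"
  assumes "pos a" "e > 0"
  obtains c where "(a + e *\<^sub>R 1) * c = 1" "c * (a + e *\<^sub>R 1) = 1"
proof -
  obtain f where f: "real_powers (a + e *\<^sub>R 1) f" using pos_powers[OF assms] by blast
  then have "f 1 * f (- 1) = f (1 + - 1)" "f (- 1) * f 1 = f (- 1 + 1)"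
    unfolding real_powers_def by blast+
  with f show thesis by (intro that[of "f (- 1)"]) (simp_all add: real_powers_def)
qed

text \<open>The shifted elements a + e/3 and t - a + e/3 have commuting roots \<open>b\<close> and
  \<open>c\<close>, whose squares add up to the scalar t + 2e/3; so
  \<open>norm_le_sum_squares\<close> bounds the norm of \<open>b * b\<close>.\<close>

lemma norm_le_of_pos:
  assumes "pos a" "pos (t *\<^sub>R 1 - a)"
  shows "norm a \<le> t"
proof -
  have "pos (t *\<^sub>R (1::'a))" using pos_add[OF assms] by simp
  then have t: "t \<ge> 0" by (simp add: pos_real_iff)
  have "norm a \<le> t + e" if "e > 0" for e
  proof -
    have e: "e/3 > 0" using that by simp
    obtain b where b: "pos b" "b * b = a + (e/3) *\<^sub>R 1" "\<forall>x. x * a = a * x \<longrightarrow> x * b = b * x"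
      using pos_root[OF assms(1) e] by blast
    obtain c where c: "pos c" "c * c = t *\<^sub>R 1 - a + (e/3) *\<^sub>R 1"
      "\<forall>x. x * (t *\<^sub>R 1 - a) = (t *\<^sub>R 1 - a) * x \<longrightarrow> x * c = c * x"
      using pos_root[OF assms(2) e] by blast
    have "a * b = b * a" by (rule b(3)[rule_format]) simp
    then have "b * c = c * b" by (intro c(3)[rule_format]) (simp add: algebra_simps)
    then have "(norm b)\<^sup>2 \<le> norm (b * b + c * c)" by (intro norm_le_sum_squares) (simp_all add: b c pos_star)
    also have "b * b + c * c = (t + 2 * e / 3) *\<^sub>R 1" by (simp add: b c algebra_simps flip: scaleR_add_left)
    finally have "norm (a + (e/3) *\<^sub>R 1) \<le> t + 2 * e / 3"
      using t that norm_mult_self[OF pos_star[OF b(1)]] b(2) by simp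
    then show ?thesis using norm_triangle_ineq4[of "a + (e/3) *\<^sub>R 1" "(e/3) *\<^sub>R 1"] that by simp
  qed
  then show ?thesis by (rule field_le_epsilon)
qed

text \<open>With commuting roots \<open>b\<close>, \<open>g\<close> of a + d and c + d, the product
  (a + d)(c + d) is the square of the selfadjoint \<open>b * g\<close>; then d tends to 0.\<close>

lemma pos_mult_commute:
  assumes "pos a" "pos c" "a * c = c * a"
  shows "pos (a * c)"
proof (rule pos_closed)
  show "star (a * c) = a * c" using assms by (simp add: star_mult pos_star)
  fix e :: real assume "e > 0"
  \<comment> \<open>The error is d (a + c + d). The cap \<open>d \<le> 1\<close> bounds its last
    factor by \<open>norm a + norm c + 1\<close>, and the second entry makes the product at most
    e/2.\<close>
  define d where "d = min 1 (e / (2 * (norm a + norm c + 1)))"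
  have n: "norm a + norm c + 1 > 0" by (simp add: add_nonneg_pos)
  have d: "0 < d" "d \<le> 1" using \<open>e > 0\<close> n by (simp_all add: d_def)
  have "d \<le> e / (2 * (norm a + norm c + 1))" by (simp add: d_def)
  then have de: "d * (norm a + norm c + 1) < e" using \<open>e > 0\<close> n by (simp add: field_simps)
  obtain b where b: "pos b" "b * b = a + d *\<^sub>R 1" "\<forall>x. x * a = a * x \<longrightarrow> x * b = b * x"
    using pos_root[OF assms(1) d(1)] by blast
  obtain g where g: "pos g" "g * g = c + d *\<^sub>R 1" "\<forall>x. x * c = c * x \<longrightarrow> x * g = g * x"
    using pos_root[OF assms(2) d(1)] by blast
  have "c * b = b * c" by (rule b(3)[rule_format]) (simp add: assms)
  then have bg: "b * g = g * b" by (intro g(3)[rule_format]) simp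
  have "pos (b * g * (b * g))" by (rule pos_square) (simp add: star_mult b g pos_star bg)
  also have "b * g * (b * g) = b * b * (g * g)" by (metis bg mult.assoc)
  finally have p: "pos ((a + d *\<^sub>R 1) * (c + d *\<^sub>R 1))" by (simp add: b g)
  have "a * c - (a + d *\<^sub>R 1) * (c + d *\<^sub>R 1) = - (d *\<^sub>R (a + c + d *\<^sub>R 1))"
    by (simp add: algebra_simps)
  then have "norm (a * c - (a + d *\<^sub>R 1) * (c + d *\<^sub>R 1)) = d * norm (a + c + d *\<^sub>R 1)"
    using d by simp
  also have "\<dots> \<le> d * (norm a + norm c + 1)"
    using d norm_triangle_ineq[of "a + c" "d *\<^sub>R 1"] norm_triangle_ineq[of a c] by (intro mult_left_mono) simp_all
  finally show "\<exists>b. pos b \<and> norm (a * c - b) < e" using p de by (meson order.strict_trans1)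
qed

text \<open>If the inverse \<open>c\<close> lies below the scalar \<open>m\<close>, multiplying
  \<open>m - c\<close> by the commuting positive \<open>a\<close> gives \<open>m a - 1\<close>
  positive, so \<open>a\<close> stays above 1/m. The inverse is selfadjoint because
  \<open>star c\<close> is a left inverse too.\<close>

lemma pos_invertible_gap:
  assumes "pos a" "a * c = 1" "c * a = 1"
  obtains \<eta> where "\<eta> > 0" "pos (a - \<eta> *\<^sub>R 1)"
proof -
  define m where "m = norm c + 1"
  have m: "m > 0" by (simp add: m_def add_nonneg_pos)
  have "star c * a = 1" using assms by (metis pos_star star_1 star_mult)
  then have "star c = c" using assms by (metis mult.assoc mult.left_neutral mult.right_neutral)
  then have "pos (m *\<^sub>R 1 - c)" by (rule pos_norm_diff) (simp add: m_def)
  with assms have "pos (a * (m *\<^sub>R 1 - c))" by (intro pos_mult_commute) (simp_all add: algebra_simps)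
  then have "pos ((1/m) *\<^sub>R (a * (m *\<^sub>R 1 - c)))" by (rule pos_scaleR) (use m in simp)
  also have "(1/m) *\<^sub>R (a * (m *\<^sub>R 1 - c)) = a - (1/m) *\<^sub>R 1"
    using assms m by (simp add: algebra_simps)
  finally show thesis using m by (intro that[of "1/m"]) simp_all
qed

text \<open>The half-line of \<open>s \<ge> 0\<close> with \<open>a + s\<close> positive is closed, and by the preceding lemma it is
  open below wherever \<open>a + s\<close> is invertible; hence it reaches down to \<open>0\<close>.\<close>

lemma pos_if_invertible:
  fixes a :: "'a::cstar_algebra"
  assumes "star a = a" "\<And>e. e > 0 \<Longrightarrow> \<exists>c. (a + e *\<^sub>R 1) * c = 1 \<and> c * (a + e *\<^sub>R 1) = 1"
  shows "pos a"
proof -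
  define S where "S = {s. s \<ge> 0 \<and> pos (a + s *\<^sub>R 1)}"
  have "pos (norm a *\<^sub>R 1 - (- a))" by (rule pos_norm_diff) (simp_all add: assms)
  then have S: "norm a \<in> S" unfolding S_def by (simp only: mem_Collect_eq diff_minus_eq_add norm_ge_zero add.commute)
  have bdd: "bdd_below S" by (auto simp: S_def bdd_below_def)
  define s where "s = Inf S"
  have s0: "s \<ge> 0" unfolding s_def by (rule cInf_greatest) (use S in blast, simp add: S_def)
  have ps: "pos (a + s *\<^sub>R 1)"
  proof (rule pos_closed)
    fix e :: real assume "e > 0"
    then obtain r where r: "r \<in> S" "r < s + e" using cInf_lessD[of S "s + e"] S by (auto simp: s_def)
    have "s \<le> r" unfolding s_def using r bdd by (intro cInf_lower)
    then have "norm (a + s *\<^sub>R 1 - (a + r *\<^sub>R 1)) < e" using r by (simp flip: scaleR_diff_left)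
    then show "\<exists>b. pos b \<and> norm (a + s *\<^sub>R 1 - b) < e" using r by (auto simp: S_def)
  qed (simp add: star_add assms)
  have "s = 0"
  proof (rule ccontr)
    assume "s \<noteq> 0"
    with s0 have "s > 0" by simp
    then obtain c where "(a + s *\<^sub>R 1) * c = 1" "c * (a + s *\<^sub>R 1) = 1" using assms(2) by blast
    then obtain \<eta> where \<eta>: "\<eta> > 0" "pos (a + s *\<^sub>R 1 - \<eta> *\<^sub>R 1)" using pos_invertible_gap[OF ps] by blast
    \<comment> \<open>The cap by \<open>s\<close> keeps \<open>s - k\<close> nonnegative, hence in
      \<open>S\<close>, where it contradicts the infimum.\<close>
    define k where "k = min \<eta> s"
    have k: "0 < k" "k \<le> s" "k \<le> \<eta>" using \<eta> \<open>s > 0\<close> by (simp_all add: k_def)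
    have "pos (a + s *\<^sub>R 1 - \<eta> *\<^sub>R 1 + (\<eta> - k) *\<^sub>R 1)" using \<eta> k by (intro pos_add pos_real) simp_all
    then have "s - k \<in> S" using k by (simp add: S_def algebra_simps)
    then have "s \<le> s - k" unfolding s_def using bdd by (intro cInf_lower)
    with k show False by simp
  qed
  with ps show ?thesis by simp
qed

lemma pos_diff_mult_star:
  assumes "pos (\<delta> *\<^sub>R 1 - star y * y)" "\<delta> \<ge> 0"
  shows "pos (\<delta> *\<^sub>R 1 - y * star y)"
proof (rule pos_if_invertible)
  show "star (\<delta> *\<^sub>R 1 - y * star y) = \<delta> *\<^sub>R 1 - y * star y"
    by (simp add: star_diff star_mult star_star)
  fix e :: real assume "e > 0"
  then obtain c where c: "(\<delta> *\<^sub>R 1 - star y * y + e *\<^sub>R 1) * c = 1" "c * (\<delta> *\<^sub>R 1 - star y * y + e *\<^sub>R 1) = 1"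
    using pos_invertible[OF assms(1)] by blast
  define d where "d = \<delta> + e"
  have d: "d > 0" using \<open>e > 0\<close> assms by (simp add: d_def)
  have c1: "star y * y * c = d *\<^sub>R c - 1" using c(1) by (simp add: d_def algebra_simps)
  have c2: "c * (star y * y) = d *\<^sub>R c - 1" using c(2) by (simp add: d_def algebra_simps)
  have "y * star y * (y * c * star y) = y * (star y * y * c) * star y" by (simp add: mult.assoc)
  also have "\<dots> = d *\<^sub>R (y * c * star y) - y * star y" unfolding c1 by (simp add: algebra_simps)
  finally have 1: "y * star y * (y * c * star y) = d *\<^sub>R (y * c * star y) - y * star y" .
  have "y * c * star y * (y * star y) = y * (c * (star y * y)) * star y" by (simp add: mult.assoc)
  also have "\<dots> = d *\<^sub>R (y * c * star y) - y * star y" unfolding c2 by (simp add: algebra_simps)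
  finally have 2: "y * c * star y * (y * star y) = d *\<^sub>R (y * c * star y) - y * star y" .
  define z where "z = y * c * star y"
  have "(d *\<^sub>R 1 - y * star y) * ((1/d) *\<^sub>R (1 + z)) = 1" "((1/d) *\<^sub>R (1 + z)) * (d *\<^sub>R 1 - y * star y) = 1"
    using d by (simp_all add: algebra_simps 1[folded z_def, unfolded mult.assoc] 2[folded z_def, unfolded mult.assoc])
  moreover have "\<delta> *\<^sub>R 1 - y * star y + e *\<^sub>R 1 = d *\<^sub>R 1 - y * star y" by (simp add: d_def algebra_simps)
  ultimately show "\<exists>c. (\<delta> *\<^sub>R 1 - y * star y + e *\<^sub>R 1) * c = 1 \<and> c * (\<delta> *\<^sub>R 1 - y * star y + e *\<^sub>R 1) = 1"
    by metis
qed

lemma left_right_inverse: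
  fixes x :: "'a::monoid_mult"
  assumes "x * u = 1" "v * x = 1"
  shows "\<exists>c. x * c = 1 \<and> c * x = 1"
proof -
  have "v = v * (x * u)" using assms by simp
  also have "\<dots> = u" using assms(2) by (simp flip: mult.assoc)
  finally show ?thesis using assms by blast
qed

text \<open>\<open>k\<close> plays the role of a smoothed absolute value of \<open>h\<close>. The
  factorisation (k - h + s)(k + h + s) = 2 s k + \<epsilon>^2 + s^2 has an invertible right side for
  s > 0, so the first factor is invertible and \<open>pos_if_invertible\<close> applies.\<close>

lemma pos_diff_of_squares:
  fixes h k :: "'a::cstar_algebra"
  assumes "pos k" "star h = h" "h * k = k * h" "k * k = h * h + (\<epsilon>\<^sup>2) *\<^sub>R 1" "\<epsilon> > 0"
  shows "pos (k - h)"
proof (rule pos_if_invertible)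
  fix s :: real assume "s > 0"
  have "pos ((2 * s) *\<^sub>R k)" using \<open>s > 0\<close> assms by (intro pos_scaleR) simp_all
  moreover have "\<epsilon>\<^sup>2 + s\<^sup>2 > 0" using assms by (simp add: add_pos_nonneg)
  ultimately obtain c where c: "((2 * s) *\<^sub>R k + (\<epsilon>\<^sup>2 + s\<^sup>2) *\<^sub>R 1) * c = 1" "c * ((2 * s) *\<^sub>R k + (\<epsilon>\<^sup>2 + s\<^sup>2) *\<^sub>R 1) = 1"
    by (rule pos_invertible)
  let ?X = "k - h + s *\<^sub>R 1" and ?Y = "k + h + s *\<^sub>R 1"
  have sk: "(s * 2) *\<^sub>R k = s *\<^sub>R k + s *\<^sub>R k" by (simp flip: scaleR_add_left)
  have XY: "?X * ?Y = (2 * s) *\<^sub>R k + (\<epsilon>\<^sup>2 + s\<^sup>2) *\<^sub>R 1" "?Y * ?X = (2 * s) *\<^sub>R k + (\<epsilon>\<^sup>2 + s\<^sup>2) *\<^sub>R 1"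
    by (simp_all add: algebra_simps assms power2_eq_square sk)
  have "?X * (?Y * c) = 1" using c(1) unfolding XY(1)[symmetric] mult.assoc .
  moreover have "(c * ?Y) * ?X = 1" using c(2) unfolding XY(2)[symmetric] mult.assoc .
  ultimately show "\<exists>c. ?X * c = 1 \<and> c * ?X = 1" by (rule left_right_inverse)
qed (use assms in \<open>simp add: star_diff pos_star\<close>)

text \<open>Kaplansky's argument, with the negative part of \<open>h = x\<^sup>* x\<close> replaced by
  \<open>q = k - h\<close>, \<open>k = (h\<^sup>2 + \<epsilon>\<^sup>2)\<^sup>1\<^sup>/\<^sup>2\<close>: for \<open>y = x q\<close> the element \<open>y\<^sup>* y = (\<epsilon>\<^sup>2 q - q\<^sup>3) / 2\<close> is almost negative,
  hence so is \<open>y y\<^sup>*\<close>, whereas their sum is positive. This forces \<open>q\<close> to be small.\<close>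

theorem pos_star_mult_self: "pos (star x * x :: 'a::cstar_algebra)"
proof -
  define h where "h = star x * x"
  have sh: "star h = h" by (simp add: h_def star_mult star_star)
  have "\<exists>k. pos k \<and> norm (h - k) < e" if "e > 0" for e
  proof -
    \<comment> \<open>The argument ends with norm q at most 2 \<epsilon>, which has to be below
      \<open>e\<close>.\<close>
    define \<epsilon> where "\<epsilon> = e / 3"
    have \<epsilon>: "\<epsilon> > 0" using that by (simp add: \<epsilon>_def)
    obtain k where k: "pos k" "k * k = h * h + (\<epsilon>\<^sup>2) *\<^sub>R 1" "\<forall>z. z * (h * h) = h * h * z \<longrightarrow> z * k = k * z"
      using pos_root[OF pos_square[OF sh] zero_less_power[OF \<epsilon>, of 2]] by blast
    have hk: "h * k = k * h" by (rule k(3)[rule_format]) (simp add: mult.assoc)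
    define q where "q = k - h"
    have q: "pos q" unfolding q_def by (rule pos_diff_of_squares[OF k(1) sh hk k(2) \<epsilon>])
    note sq = pos_star[OF q]
    have "pos (q * q)" using pos_square[OF sq] .
    then have q3: "pos (q * q * q)" by (intro pos_mult_commute q) (simp_all add: mult.assoc)
    \<comment> \<open>Heuristically q = \<epsilon>^2 / (k + h): tiny where \<open>h\<close> is
      positive and about twice the absolute value of \<open>h\<close> where it is negative.\<close>
    have kh: "(k + h) * q = (\<epsilon>\<^sup>2) *\<^sub>R 1" by (simp add: q_def algebra_simps hk k(2))
    have "q * ((k + h) * q) = (\<epsilon>\<^sup>2) *\<^sub>R q" by (simp add: kh)
    moreover have "2 *\<^sub>R h = (k + h) - q" by (simp add: q_def scaleR_2)
    then have "2 *\<^sub>R (q * h * q) = q * ((k + h) - q) * q"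
      by (metis mult_scaleR_left mult_scaleR_right)
    ultimately have qhq2: "2 *\<^sub>R (q * h * q) = (\<epsilon>\<^sup>2) *\<^sub>R q - q * q * q"
      by (simp add: algebra_simps)
    have qhq: "q * h * q = (1/2) *\<^sub>R ((\<epsilon>\<^sup>2) *\<^sub>R q - q * q * q)" unfolding qhq2[symmetric] by simp
    \<comment> \<open>Dropping the cube, \<open>star y * y\<close> is at most \<epsilon>^2 q / 2,
      and \<open>q\<close> is at most its norm.\<close>
    define \<delta> where "\<delta> = \<epsilon>\<^sup>2 * norm q / 2"
    have \<delta>: "\<delta> \<ge> 0" by (simp add: \<delta>_def)
    define y where "y = x * q"
    have yy: "star y * y = q * h * q" by (simp add: y_def star_mult sq h_def mult.assoc)
    have "pos ((\<epsilon>\<^sup>2 / 2) *\<^sub>R (norm q *\<^sub>R 1 - q) + (1/2) *\<^sub>R (q * q * q))"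
      by (intro pos_add pos_scaleR pos_norm_diff sq q3) simp_all
    also have "(\<epsilon>\<^sup>2 / 2) *\<^sub>R (norm q *\<^sub>R 1 - q) + (1/2) *\<^sub>R (q * q * q) = \<delta> *\<^sub>R 1 - star y * y"
      unfolding yy qhq by (simp add: \<delta>_def algebra_simps)
    finally have 1: "pos (\<delta> *\<^sub>R 1 - y * star y)" using \<delta> by (rule pos_diff_mult_star)
    \<comment> \<open>Up to sign, twice the real and imaginary parts of \<open>y\<close>; half the
      sum of their squares is \<open>star y * y + y * star y\<close>.\<close>
    define A B where "A = y + star y" and "B = \<i> *\<^sub>C (y - star y)"
    have "pos (A * A)" "pos (B * B)"
      by (auto intro!: pos_square simp: A_def B_def star_add star_scaleC star_diff star_star
          complex_vector.scale_right_diff_distrib)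
    then have "pos ((1/2) *\<^sub>R (A * A + B * B))" by (intro pos_scaleR pos_add) simp_all
    moreover have "B * B = - ((y - star y) * (y - star y))"
      by (simp add: B_def scaleC_mult_left scaleC_mult_right scaleC_scaleC)
    then have "A * A + B * B = 2 *\<^sub>R (star y * y + y * star y)"
      by (simp add: A_def scaleR_2 algebra_simps)
    then have "(1/2) *\<^sub>R (A * A + B * B) = star y * y + y * star y" by simp
    ultimately have "pos (star y * y + y * star y)" by simp
    \<comment> \<open>Adding \<delta> - y y^* eliminates \<open>y * star y\<close>. What is left
      says q^3 is at most 2 \<delta> + \<epsilon>^2 q, hence at most 2 \<epsilon>^2 norm q; this
      bound beats the fourth power of the norm below.\<close>
    from pos_add[OF this 1] have "pos (2 *\<^sub>R (star y * y + \<delta> *\<^sub>R 1))" by (intro pos_scaleR) simp_all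
    also have "2 *\<^sub>R (star y * y + \<delta> *\<^sub>R 1) = (2 * \<delta>) *\<^sub>R 1 + (\<epsilon>\<^sup>2) *\<^sub>R q - q * q * q"
      unfolding yy scaleR_add_right qhq2 by simp
    finally have "pos ((2 * \<delta>) *\<^sub>R 1 + (\<epsilon>\<^sup>2) *\<^sub>R q - q * q * q)" .
    moreover have "pos ((\<epsilon>\<^sup>2) *\<^sub>R (norm q *\<^sub>R 1 - q))" by (intro pos_scaleR pos_norm_diff sq) simp_all
    ultimately have "pos ((2 * \<delta>) *\<^sub>R 1 + (\<epsilon>\<^sup>2) *\<^sub>R q - q * q * q + (\<epsilon>\<^sup>2) *\<^sub>R (norm q *\<^sub>R 1 - q))"
      by (rule pos_add)
    also have "(2 * \<delta>) *\<^sub>R 1 + (\<epsilon>\<^sup>2) *\<^sub>R q - q * q * q + (\<epsilon>\<^sup>2) *\<^sub>R (norm q *\<^sub>R 1 - q) = (2 * \<epsilon>\<^sup>2 * norm q) *\<^sub>R 1 - q * q * q"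
      by (simp add: \<delta>_def algebra_simps flip: scaleR_add_left)
    finally have n3: "norm (q * q * q) \<le> 2 * \<epsilon>\<^sup>2 * norm q" using norm_le_of_pos[OF q3] by blast
    have "norm ((q * q) * (q * q)) = (norm (q * q))\<^sup>2" by (rule norm_mult_self) (simp add: star_mult sq)
    then have "(norm q) ^ 4 = norm (q * q * q * q)" by (simp add: norm_mult_self[OF sq] mult.assoc)
    also have "\<dots> \<le> 2 * \<epsilon>\<^sup>2 * norm q * norm q"
      using norm_mult_ineq[of "q * q * q" q] n3 mult_right_mono[OF n3, of "norm q"] by simp
    finally have "(norm q)\<^sup>2 * (norm q)\<^sup>2 \<le> (2 * \<epsilon>\<^sup>2) * (norm q)\<^sup>2"
      by (simp add: power2_eq_square power4_eq_xxxx mult.assoc)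
    then have "(norm q)\<^sup>2 \<le> 2 * \<epsilon>\<^sup>2"
      by (cases "q = 0") (simp, rule mult_right_le_imp_le, assumption, simp)
    also have "\<dots> \<le> (2 * \<epsilon>)\<^sup>2" by (simp add: power2_eq_square)
    finally have "norm q \<le> 2 * \<epsilon>" by (rule power2_le_imp_le) (use \<epsilon> in simp)
    then have "norm (h - k) < e" using \<epsilon> by (simp add: q_def norm_minus_commute \<epsilon>_def)
    with k(1) show ?thesis by blast
  qed
  with sh show ?thesis unfolding h_def[symmetric] by (rule pos_closed)
qed

text \<open>With \<open>b\<close> a root of a + d, the element x^* (a + d) x equals (b x)^* (b x),
  which is positive; then d tends to 0.\<close>

lemma pos_conjugate:
  assumes "pos a"
  shows "pos (star x * a * x)"
proof (rule pos_closed)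
  show "star (star x * a * x) = star x * a * x" using assms by (simp add: star_mult star_star pos_star mult.assoc)
  fix e :: real assume "e > 0"
  define d where "d = e / (2 * ((norm x)\<^sup>2 + 1))"
  have n: "(norm x)\<^sup>2 + 1 > 0" by (simp add: add_nonneg_pos)
  have d: "d > 0" using \<open>e > 0\<close> n by (simp add: d_def)
  obtain b where b: "pos b" "b * b = a + d *\<^sub>R 1" using pos_root[OF assms d] by blast
  have "pos (star (b * x) * (b * x))" by (rule pos_star_mult_self)
  also have "star (b * x) * (b * x) = star x * (b * b) * x" using b(1) by (simp add: star_mult pos_star mult.assoc)
  also have "\<dots> = star x * a * x + d *\<^sub>R (star x * x)" by (simp add: b algebra_simps)
  finally have p: "pos (star x * a * x + d *\<^sub>R (star x * x))" .
  have "norm (star x * a * x - (star x * a * x + d *\<^sub>R (star x * x))) = d * (norm x)\<^sup>2"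
    using d by (simp add: cstar_identity)
  also have "\<dots> < d * (2 * ((norm x)\<^sup>2 + 1))" using d by (intro mult_strict_left_mono) (simp_all add: add_nonneg_pos)
  also have "\<dots> = e" using n by (simp add: d_def)
  finally show "\<exists>b. pos b \<and> norm (star x * a * x - b) < e" using p by blast
qed



section \<open>States\<close>

definition sublinear :: "('a::real_vector \<Rightarrow> real) \<Rightarrow> bool"
  where "sublinear p \<longleftrightarrow> (\<forall>x y. p (x + y) \<le> p x + p y) \<and> (\<forall>r>0. \<forall>x. p (r *\<^sub>R x) = r * p x)"

lemma sublinear_0: "sublinear p \<Longrightarrow> p 0 = 0"
  unfolding sublinear_def by (drule conjunct2, drule spec[of _ 2]) (auto dest: spec[of _ 0])

lemma sublinear_minus: "sublinear p \<Longrightarrow> - p (- x) \<le> p x"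
proof -
  assume s: "sublinear p"
  then have "p (x + (- x)) \<le> p x + p (- x)" unfolding sublinear_def by blast
  with sublinear_0[OF s] show ?thesis by simp
qed

lemma sublinearI:
  assumes "\<And>x y. p (x + y) \<le> p x + p y" "\<And>r x. r > 0 \<Longrightarrow> r * p x \<le> p (r *\<^sub>R x)"
  shows "sublinear p"
proof -
  have "p (r *\<^sub>R x) = r * p x" if "r > 0" for r x
  proof (rule antisym)
    have "inverse r * p (r *\<^sub>R x) \<le> p (inverse r *\<^sub>R (r *\<^sub>R x))" by (rule assms(2)) (use that in simp)
    then show "p (r *\<^sub>R x) \<le> r * p x" using that by (simp add: field_simps)
  qed (rule assms(2)[OF that])
  with assms(1) show ?thesis by (simp add: sublinear_def)
qed

text \<open>The largest sublinear functional below \<open>p\<close> taking a value at most \<open>- p a\<close> at \<open>- a\<close>.\<close>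

lemma sublinear_shift:
  assumes "sublinear p"
  obtains q where "sublinear q" "\<And>x. q x \<le> p x" "q (- a) \<le> - p a"
proof -
  have sub: "p (x + y) \<le> p x + p y" and hom: "r > 0 \<Longrightarrow> p (r *\<^sub>R x) = r * p x" for x y r
    using assms by (auto simp: sublinear_def)
  have hom0: "p (t *\<^sub>R a) = t * p a" if "t \<ge> 0" for t
    using hom[of t a] sublinear_0[OF assms] that by (cases "t = 0") auto
  \<comment> \<open>The formula is forced: a sublinear \<open>q\<close> below \<open>p\<close> with
    \<open>q (- a) \<le> - p a\<close> satisfies q x <= q (x + t a) + t q (-a) <= g x t for every
    nonnegative t.\<close>
  define g where "g x t = p (x + t *\<^sub>R a) - t * p a" for x t
  define q where "q x = (INF t\<in>{0..}. g x t)" for x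
  have "- p (- x) \<le> g x t" if "t \<ge> 0" for x t
    using sub[of "x + t *\<^sub>R a" "- x"] hom0[OF that] by (simp add: g_def)
  then have bdd: "bdd_below (g x ` {0..})" for x by (intro bdd_belowI[of _ "- p (- x)"]) auto
  have le: "q x \<le> g x t" if "t \<ge> 0" for x t
    unfolding q_def using bdd that by (intro cINF_lower) auto
  show thesis
  proof (rule that[of q])
    show "q x \<le> p x" for x using le[of 0 x] by (simp add: g_def)
    show "q (- a) \<le> - p a" using le[of 1 "- a"] sublinear_0[OF assms] by (simp add: g_def)
    show "sublinear q"
    proof (rule sublinearI)
      fix x y
      have "q (x + y) - g x s \<le> g y t" if "s \<ge> 0" "t \<ge> 0" for s t
        using le[of "s + t" "x + y"] that sub[of "x + s *\<^sub>R a" "y + t *\<^sub>R a"]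
        by (simp add: g_def algebra_simps)
      then have "q (x + y) - g x s \<le> q y" if "s \<ge> 0" for s
        unfolding q_def[of y] using that by (intro cINF_greatest) auto
      then have "q (x + y) - q y \<le> g x s" if "s \<ge> 0" for s
        using that by (simp add: algebra_simps)
      then have "q (x + y) - q y \<le> q x"
        unfolding q_def[of x] by (intro cINF_greatest) auto
      then show "q (x + y) \<le> q x + q y" by simp
    next
      fix r :: real and x assume r: "r > 0"
      have "r * q x \<le> g (r *\<^sub>R x) t" if "t \<ge> 0" for t
      proof -
        have "r * q x \<le> r * g x (t / r)" using le[of "t / r" x] r that by simp
        also have "r * g x (t / r) = g (r *\<^sub>R x) t"
          using r hom[OF r, of "x + (t / r) *\<^sub>R a"] by (simp add: g_def algebra_simps)
        finally show ?thesis .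
      qed
      then show "r * q x \<le> q (r *\<^sub>R x)"
        unfolding q_def[of "r *\<^sub>R x"] by (intro cINF_greatest) auto
    qed
  qed
qed

text \<open>Hahn--Banach: a minimal sublinear functional is linear, because by minimality it agrees with
  all of its shifts.\<close>

lemma minimal_sublinear_exists:
  fixes p :: "'a::real_vector \<Rightarrow> real"
  assumes "sublinear p"
  obtains m where "sublinear m" "m \<le> p" "\<And>q. sublinear q \<Longrightarrow> q \<le> m \<Longrightarrow> q = m"
proof -
  define A where "A = {q. sublinear q \<and> q \<le> p}"
  have "\<exists>m\<in>A. \<forall>a\<in>A. a \<le> m \<longrightarrow> a = m"
  proof (rule predicate_Zorn)
    show "partial_order_on A (relation_of (\<lambda>a b. b \<le> a) A)"
      by (auto simp: partial_order_on_def preorder_on_def refl_on_def trans_def antisym_def relation_of_def)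
  next
    fix C assume "C \<in> Chains (relation_of (\<lambda>a b. b \<le> a) A)"
    then have C: "C \<subseteq> A" and tot: "\<And>a b. a \<in> C \<Longrightarrow> b \<in> C \<Longrightarrow> a \<le> b \<or> b \<le> a"
      by (auto simp: Chains_def relation_of_def)
    show "\<exists>u\<in>A. \<forall>a\<in>C. u \<le> a"
    proof (cases "C = {}")
      case True
      then show ?thesis using assms by (auto simp: A_def)
    next
      case False
      define u where "u x = (INF q\<in>C. q x)" for x
      have "- p (- x) \<le> q x" if "q \<in> C" for q x
      proof -
        have "sublinear q" "q (- x) \<le> p (- x)" using that C by (auto simp: A_def le_fun_def)
        then show ?thesis using sublinear_minus[of q x] by linarith
      qed
      then have bdd: "bdd_below ((\<lambda>q. q x) ` C)" for x by (intro bdd_belowI[of _ "- p (- x)"]) auto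
      have le: "u x \<le> q x" if "q \<in> C" for q x
        unfolding u_def using bdd that by (intro cINF_lower) auto
      have "sublinear u"
      proof (rule sublinearI)
        fix x y
        have "u (x + y) - q1 x \<le> q2 y" if q: "q1 \<in> C" "q2 \<in> C" for q1 q2
        proof -
          obtain q where "q \<in> C" "q \<le> q1" "q \<le> q2" using tot[OF q] q by auto
          then have "u (x + y) \<le> q (x + y)" "q (x + y) \<le> q x + q y" "q x \<le> q1 x" "q y \<le> q2 y"
            using le[of q "x + y"] C unfolding A_def sublinear_def le_fun_def by auto
          then show ?thesis by linarith
        qed
        then have "u (x + y) - q x \<le> u y" if "q \<in> C" for q
          unfolding u_def[of y] using that False by (intro cINF_greatest) auto
        then have "u (x + y) - u y \<le> q x" if "q \<in> C" for q
          using that by (simp add: algebra_simps)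
        then have "u (x + y) - u y \<le> u x" unfolding u_def[of x] using False by (intro cINF_greatest) auto
        then show "u (x + y) \<le> u x + u y" by simp
      next
        fix r :: real and x assume r: "r > 0"
        have "r * u x \<le> q (r *\<^sub>R x)" if "q \<in> C" for q
        proof -
          have "q (r *\<^sub>R x) = r * q x" using that C r by (auto simp: A_def sublinear_def)
          then show ?thesis using le[OF that, of x] r by simp
        qed
        then show "r * u x \<le> u (r *\<^sub>R x)" unfolding u_def[of "r *\<^sub>R x"] using False by (intro cINF_greatest) auto
      qed
      moreover obtain q where "q \<in> C" using False by blast
      then have "u \<le> p" using le[of q] C unfolding A_def le_fun_def by (auto intro: order_trans)
      ultimately show ?thesis using le by (auto simp: A_def le_fun_def)
    qed
  qed
  then obtain m where "m \<in> A" "\<And>a. a \<in> A \<Longrightarrow> a \<le> m \<Longrightarrow> a = m" by blast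
  then show thesis by (intro that[of m]) (auto simp: A_def intro: order_trans)
qed

text \<open>The shift at \<open>a\<close> precedes the minimisation, so every functional below
  \<open>p'\<close> is at most \<open>- p a\<close> at \<open>- a\<close>. For a linear one this
  means that the value at \<open>a\<close> reaches \<open>p a\<close>.\<close>

lemma hahn_banach_sublinear:
  fixes p :: "'a::real_vector \<Rightarrow> real"
  assumes "sublinear p"
  obtains f where "linear f" "\<And>x. f x \<le> p x" "f a = p a"
proof -
  obtain p' where p': "sublinear p'" "\<And>x. p' x \<le> p x" "p' (- a) \<le> - p a"
    using sublinear_shift[OF assms] by blast
  obtain m where m: "sublinear m" "m \<le> p'" and min: "\<And>q. sublinear q \<Longrightarrow> q \<le> m \<Longrightarrow> q = m"
    using minimal_sublinear_exists[OF p'(1)] by blast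
  have sub: "m (x + y) \<le> m x + m y" and hom: "r > 0 \<Longrightarrow> m (r *\<^sub>R x) = r * m x" for x y r
    using m(1) by (auto simp: sublinear_def)
  have minus: "m (- x) = - m x" for x
  proof -
    obtain q where q: "sublinear q" "\<And>y. q y \<le> m y" "q (- x) \<le> - m x"
      using sublinear_shift[OF m(1)] by blast
    then have "q = m" by (intro min) (simp_all add: le_fun_def)
    with q(3) sublinear_minus[OF m(1), of x] show ?thesis by simp
  qed
  have "linear m"
  proof (rule linearI)
    show "m (x + y) = m x + m y" for x y
      using sub[of x y] sub[of "x + y" "- y"] minus[of y] by simp
    show "m (r *\<^sub>R x) = r *\<^sub>R m x" for r x
      using hom[of r x] hom[of "- r" "- x"] minus[of x] sublinear_0[OF m(1)]
      by (cases "r > 0"; cases "r = 0") auto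
  qed
  moreover have le: "m x \<le> p x" for x using m(2) p'(2)[of x] by (simp add: le_fun_def) (meson order_trans)
  moreover have "m (- a) \<le> - p a" using m(2) p'(3) by (simp add: le_fun_def) (meson order_trans)
  then have "m a = p a" using minus[of a] le[of a] by simp
  ultimately show thesis by (rule that)
qed

text \<open>The inequality with \<open>norm a\<close> will bound left multiplication in the
  representation, and the last clause will make the cone act by positive operators. As clauses they
  simply restrict from the completion to the incomplete algebra.\<close>

definition state_on :: "'a::pre_cstar_algebra set \<Rightarrow> ('a \<Rightarrow> complex) \<Rightarrow> bool"
  where "state_on P \<phi> \<longleftrightarrow>
    (\<forall>x y. \<phi> (x + y) = \<phi> x + \<phi> y) \<and> (\<forall>c x. \<phi> (c *\<^sub>C x) = c * \<phi> x) \<and> \<phi> 1 = 1 \<and>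
    (\<forall>x. \<phi> (star x) = cnj (\<phi> x)) \<and> (\<forall>x. 0 \<le> \<phi> (star x * x)) \<and>
    (\<forall>a x. Re (\<phi> (star (a * x) * (a * x))) \<le> (norm a)\<^sup>2 * Re (\<phi> (star x * x))) \<and>
    (\<forall>p\<in>P. \<forall>x. 0 \<le> \<phi> (star x * p * x))"

text \<open>All that the two main implications require of the cone \<open>P\<close>.\<close>

definition separating_states :: "'a::pre_cstar_algebra set \<Rightarrow> bool"
  where "separating_states P \<longleftrightarrow> (\<forall>x. x \<noteq> 0 \<longrightarrow> (\<exists>\<phi>. state_on P \<phi> \<and> \<phi> (star x * x) \<noteq> 0))"

text \<open>From 1 + a <= norm (1 + a) follows a <= norm (1 + a) - 1, and
  \<open>norm_le_of_pos\<close> turns this into a norm bound.\<close>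

lemma norm_one_plus_pos:
  assumes "pos (a::'a::cstar_algebra)"
  shows "norm (1 + a) = 1 + norm a"
proof (rule antisym)
  show "norm (1 + a) \<le> 1 + norm a" using norm_triangle_ineq[of 1 a] by simp
  have "pos (norm (1 + a) *\<^sub>R 1 - (1 + a))" using assms by (intro pos_norm_diff) (simp_all add: star_add pos_star)
  then have "pos ((norm (1 + a) - 1) *\<^sub>R 1 - a)" by (simp add: algebra_simps)
  from norm_le_of_pos[OF assms this] show "1 + norm a \<le> norm (1 + a)" by simp
qed

text \<open>A real functional below the norm that attains it at 1 + a attains it at 1 and at
  \<open>a\<close> separately, as the norms add up. The value 1 at the unit gives positivity, the
  value at \<open>a = star z * z\<close> gives separation.\<close>

theorem separating_states_cstar: "separating_states (cstar_positive :: 'a::cstar_algebra set)"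
  unfolding separating_states_def
proof (intro allI impI)
  fix z :: 'a assume "z \<noteq> 0"
  define a where "a = star z * z"
  have a: "pos a" unfolding a_def by (rule pos_star_mult_self)
  have na: "norm a \<noteq> 0" using \<open>z \<noteq> 0\<close> by (simp add: a_def cstar_identity)
  have "sublinear (norm :: 'a \<Rightarrow> real)" by (simp add: sublinear_def norm_triangle_ineq)
  then obtain f where f: "linear f" "\<And>x. f x \<le> norm x" "f (1 + a) = norm (1 + a)"
    using hahn_banach_sublinear[where a = "1 + a"] by blast
  interpret f: linear f by (rule f(1))
  have "f 1 + f a = 1 + norm a" using f(3) norm_one_plus_pos[OF a] by (simp add: f.add)
  with f(2)[of 1] f(2)[of a] have f1: "f 1 = 1" and fa: "f a = norm a" by simp_all
  have fpos: "0 \<le> f b" if "pos b" for b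
  proof (rule field_le_epsilon)
    fix e :: real assume "e > 0"
    with that obtain t where t: "norm (t *\<^sub>R 1 - b) < t + e" unfolding pos_def by blast
    have "t - f b = f (t *\<^sub>R 1 - b)" by (simp add: f.diff f.scale f1)
    with t f(2)[of "t *\<^sub>R 1 - b"] show "0 \<le> f b + e" by simp
  qed
  \<comment> \<open>\<open>D x\<close> is twice the imaginary part of \<open>x\<close>. So \<phi> is
    the complex-linear extension of \<open>f\<close> from the selfadjoint elements, which makes it
    hermitian.\<close>
  define D where "D x = (- \<i>) *\<^sub>C (x - star x)" for x :: 'a
  define \<phi> where "\<phi> x = Complex (f (x + star x) / 2) (f (D x) / 2)" for x
  have add: "\<phi> (x + y) = \<phi> x + \<phi> y" for x y
  proof -
    have "x + y + star (x + y) = (x + star x) + (y + star y)" "D (x + y) = D x + D y"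
      unfolding D_def scaleC_add_right[symmetric] star_add by (simp_all add: algebra_simps)
    then show ?thesis by (simp add: \<phi>_def f.add complex_eq_iff add_divide_distrib)
  qed
  have scR: "\<phi> (r *\<^sub>R x) = r * \<phi> x" for r x
  proof -
    have "D (r *\<^sub>R x) = (- \<i>) *\<^sub>C (r *\<^sub>R (x - star x))" by (simp add: D_def scaleR_diff_right)
    also have "\<dots> = r *\<^sub>R D x" by (simp add: D_def scaleR_scaleC scaleC_scaleC mult.commute)
    finally have "D (r *\<^sub>R x) = r *\<^sub>R D x" .
    moreover have "r *\<^sub>R x + star (r *\<^sub>R x) = r *\<^sub>R (x + star x)" by (simp add: scaleR_add_right)
    ultimately show ?thesis by (simp add: \<phi>_def f.scale complex_eq_iff)
  qed
  have sci: "\<phi> (\<i> *\<^sub>C x) = \<i> * \<phi> x" for x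
  proof -
    have "\<i> *\<^sub>C x + star (\<i> *\<^sub>C x) = - D x" "D (\<i> *\<^sub>C x) = x + star x"
      by (simp_all add: D_def star_scaleC complex_vector.scale_right_diff_distrib scaleC_add_right scaleC_scaleC)
    then show ?thesis by (simp add: \<phi>_def f.neg complex_eq_iff)
  qed
  have sc: "\<phi> (c *\<^sub>C x) = c * \<phi> x" for c x
  proof -
    have c: "c = complex_of_real (Re c) + complex_of_real (Im c) * \<i>" by (simp add: complex_eq_iff)
    then have "c *\<^sub>C x = Re c *\<^sub>R x + Im c *\<^sub>R (\<i> *\<^sub>C x)"
      by (metis scaleC_add_left scaleC_scaleC scaleR_scaleC)
    then have "\<phi> (c *\<^sub>C x) = (complex_of_real (Re c) + complex_of_real (Im c) * \<i>) * \<phi> x"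
      by (simp add: add scR sci algebra_simps)
    with c show ?thesis by simp
  qed
  have st: "\<phi> (star x) = cnj (\<phi> x)" for x
  proof -
    have "D (star x) = - D x"
      by (simp add: D_def star_star complex_vector.scale_right_diff_distrib)
    then show ?thesis by (simp add: \<phi>_def star_star f.neg complex_eq_iff add.commute)
  qed
  have sa: "\<phi> x = f x" if "star x = x" for x
    using that f.add[of x x] by (simp add: \<phi>_def D_def f.zero complex_eq_iff)
  have pp: "0 \<le> \<phi> b" if "pos b" for b
    using fpos[OF that] by (simp add: sa pos_star[OF that] less_eq_complex_def)
  have bd: "Re (\<phi> (star (b * x) * (b * x))) \<le> (norm b)\<^sup>2 * Re (\<phi> (star x * x))" for b x
  proof -
    have "pos ((norm b)\<^sup>2 *\<^sub>R 1 - star b * b)"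
      by (rule pos_norm_diff) (simp_all add: star_mult star_star cstar_identity)
    from pos_conjugate[OF this, of x] have "0 \<le> f (star x * ((norm b)\<^sup>2 *\<^sub>R 1 - star b * b) * x)" by (rule fpos)
    also have "star x * ((norm b)\<^sup>2 *\<^sub>R 1 - star b * b) * x = (norm b)\<^sup>2 *\<^sub>R (star x * x) - star (b * x) * (b * x)"
      by (simp add: star_mult algebra_simps)
    finally show ?thesis by (simp add: sa star_mult star_star f.diff f.scale)
  qed
  have "state_on cstar_positive \<phi>"
    unfolding state_on_def
  proof (intro conjI allI ballI)
    show "\<phi> 1 = 1" by (simp add: sa f1)
    show "0 \<le> \<phi> (star x * x)" for x by (intro pp pos_star_mult_self)
    fix p x :: 'a assume "p \<in> cstar_positive"
    then obtain y where "p = star y * y" by (auto simp: cstar_positive_def)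
    then have "star x * p * x = star (y * x) * (y * x)" by (simp add: star_mult mult.assoc)
    then show "0 \<le> \<phi> (star x * p * x)" by (simp add: pp pos_star_mult_self)
  qed (fact add sc st bd)+
  moreover have "\<phi> a \<noteq> 0" using fa na sa[OF pos_star[OF a]] by simp
  ultimately show "\<exists>\<phi>. state_on cstar_positive \<phi> \<and> \<phi> (star z * z) \<noteq> 0" unfolding a_def by blast
qed


section \<open>Semi-inner products\<close>

text \<open>Without definiteness, so that it covers both the algebra under the form of a state,
  which may have null vectors, and the completed Hilbert space.\<close>

locale semi_inner =
  fixes H :: "'h::complex_vector set" and ip :: "'h \<Rightarrow> 'h \<Rightarrow> complex"
  assumes subspace: "csubspace H"
    and ip_add: "\<And>x y z. x \<in> H \<Longrightarrow> y \<in> H \<Longrightarrow> z \<in> H \<Longrightarrow> ip x (y + z) = ip x y + ip x z"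
    and ip_scale: "\<And>x y c. x \<in> H \<Longrightarrow> y \<in> H \<Longrightarrow> ip x (c *\<^sub>C y) = c * ip x y"
    and ip_cnj: "\<And>x y. x \<in> H \<Longrightarrow> y \<in> H \<Longrightarrow> ip y x = cnj (ip x y)"
    and ip_nonneg: "\<And>x. x \<in> H \<Longrightarrow> 0 \<le> ip x x"
begin

abbreviation nrm :: "'h \<Rightarrow> real" where "nrm \<equiv> hnorm ip"

lemma H_zero [simp]: "0 \<in> H"
  using subspace by (rule complex_vector.subspace_0)

lemma H_add [simp]: "x \<in> H \<Longrightarrow> y \<in> H \<Longrightarrow> x + y \<in> H"
  using subspace by (rule complex_vector.subspace_add)

lemma H_diff [simp]: "x \<in> H \<Longrightarrow> y \<in> H \<Longrightarrow> x - y \<in> H"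
  using subspace by (rule complex_vector.subspace_diff)

lemma H_scale [simp]: "x \<in> H \<Longrightarrow> c *\<^sub>C x \<in> H"
  using subspace by (rule complex_vector.subspace_scale)

lemma H_sum [simp]: "(\<And>i. i \<in> I \<Longrightarrow> f i \<in> H) \<Longrightarrow> (\<Sum>i\<in>I. f i) \<in> H"
  using subspace by (rule complex_vector.subspace_sum)

lemma H_span: "S \<subseteq> H \<Longrightarrow> cspan S \<subseteq> H"
  using subspace by (rule complex_vector.span_minimal[rotated])

lemma ip_zero [simp]: "x \<in> H \<Longrightarrow> ip x 0 = 0"
  using ip_scale[of x 0 0] by simp

lemma ip_diff: "x \<in> H \<Longrightarrow> y \<in> H \<Longrightarrow> z \<in> H \<Longrightarrow> ip x (y - z) = ip x y - ip x z"
  using ip_add[of x "y - z" z] by simp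

lemma ip_sum: "x \<in> H \<Longrightarrow> (\<And>i. i \<in> I \<Longrightarrow> f i \<in> H) \<Longrightarrow> ip x (\<Sum>i\<in>I. f i) = (\<Sum>i\<in>I. ip x (f i))"
  by (induction I rule: infinite_finite_induct) (simp_all add: ip_add)

lemma ip_zero_left [simp]: "x \<in> H \<Longrightarrow> ip 0 x = 0"
  using ip_cnj[of x 0] by simp

lemma ip_add_left: "x \<in> H \<Longrightarrow> y \<in> H \<Longrightarrow> z \<in> H \<Longrightarrow> ip (y + z) x = ip y x + ip z x"
  using ip_cnj[of x "y + z"] ip_cnj[of x y] ip_cnj[of x z] by (simp add: ip_add)

lemma ip_diff_left: "x \<in> H \<Longrightarrow> y \<in> H \<Longrightarrow> z \<in> H \<Longrightarrow> ip (y - z) x = ip y x - ip z x"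
  using ip_cnj[of x "y - z"] ip_cnj[of x y] ip_cnj[of x z] by (simp add: ip_diff)

lemma ip_scale_left: "x \<in> H \<Longrightarrow> y \<in> H \<Longrightarrow> ip (c *\<^sub>C y) x = cnj c * ip y x"
  using ip_cnj[of x "c *\<^sub>C y"] ip_cnj[of x y] by (simp add: ip_scale)

lemma ip_sum_left: "x \<in> H \<Longrightarrow> (\<And>i. i \<in> I \<Longrightarrow> f i \<in> H) \<Longrightarrow> ip (\<Sum>i\<in>I. f i) x = (\<Sum>i\<in>I. ip (f i) x)"
  by (induction I rule: infinite_finite_induct) (simp_all add: ip_add_left)

lemma nrm_nonneg [simp]: "x \<in> H \<Longrightarrow> 0 \<le> nrm x"
  using ip_nonneg[of x] by (simp add: hnorm_def less_eq_complex_def)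

lemma nrm_sq: "x \<in> H \<Longrightarrow> (nrm x)\<^sup>2 = Re (ip x x)"
  using ip_nonneg[of x] by (simp add: hnorm_def less_eq_complex_def)

lemma ip_self: "x \<in> H \<Longrightarrow> ip x x = complex_of_real ((nrm x)\<^sup>2)"
  using ip_nonneg[of x] by (simp add: nrm_sq complex_eq_iff less_eq_complex_def)

lemma nrm_eq_0_iff: "x \<in> H \<Longrightarrow> nrm x = 0 \<longleftrightarrow> ip x x = 0"
  using ip_self[of x] by simp

lemma nrm_scale: "x \<in> H \<Longrightarrow> nrm (c *\<^sub>C x) = cmod c * nrm x"
proof -
  assume x: "x \<in> H"
  have "ip (c *\<^sub>C x) (c *\<^sub>C x) = complex_of_real ((cmod c * nrm x)\<^sup>2)"
    using x complex_norm_square[of c] by (simp add: ip_scale ip_scale_left ip_self[OF x] power_mult_distrib mult_ac)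
  then show ?thesis using x by (simp add: hnorm_def[of ip "c *\<^sub>C x"])
qed

lemma nrm_minus: "x \<in> H \<Longrightarrow> y \<in> H \<Longrightarrow> nrm (x - y) = nrm (y - x)"
  using nrm_scale[of "y - x" "- 1"] by simp

lemma nrm_sq_diff:
  assumes "x \<in> H" "y \<in> H"
  shows "(nrm (x - y))\<^sup>2 = (nrm x)\<^sup>2 - 2 * Re (ip x y) + (nrm y)\<^sup>2"
  using assms ip_cnj[OF assms] by (simp add: nrm_sq ip_diff ip_diff_left)

lemma nrm_sq_add:
  assumes "x \<in> H" "y \<in> H"
  shows "(nrm (x + y))\<^sup>2 = (nrm x)\<^sup>2 + 2 * Re (ip x y) + (nrm y)\<^sup>2"
  using assms ip_cnj[OF assms] by (simp add: nrm_sq ip_add ip_add_left)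

text \<open>The squared seminorm of x - c y is a quadratic in the real parameter \<open>r\<close>,
  the phase of \<open>c\<close> being chosen to make the inner product real; r = 1 / (nrm y)^2
  minimises it.\<close>

lemma cauchy_schwarz:
  assumes "x \<in> H" "y \<in> H"
  shows "cmod (ip x y) \<le> nrm x * nrm y"
proof -
  let ?k = "cmod (ip x y)"
  have ineq: "0 \<le> (nrm x)\<^sup>2 - 2 * r * ?k\<^sup>2 + r\<^sup>2 * ?k\<^sup>2 * (nrm y)\<^sup>2" for r
  proof -
    define c where "c = complex_of_real r * cnj (ip x y)"
    have "ip x (c *\<^sub>C y) = complex_of_real (r * ?k\<^sup>2)"
      using assms complex_norm_square[of "ip x y"] by (simp add: ip_scale c_def mult.commute mult.left_commute)
    moreover have "nrm (c *\<^sub>C y) = \<bar>r\<bar> * ?k * nrm y" using assms by (simp add: nrm_scale c_def norm_mult)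
    ultimately have "(nrm (x - c *\<^sub>C y))\<^sup>2 = (nrm x)\<^sup>2 - 2 * r * ?k\<^sup>2 + r\<^sup>2 * ?k\<^sup>2 * (nrm y)\<^sup>2"
      using assms by (simp add: nrm_sq_diff power_mult_distrib)
    then show ?thesis by (metis zero_le_power2)
  qed
  have "?k\<^sup>2 \<le> (nrm x * nrm y)\<^sup>2"
  proof (cases "nrm y = 0")
    case True
    have "?k = 0"
    proof (rule ccontr)
      assume "?k \<noteq> 0"
      then have k: "?k\<^sup>2 > 0" by simp
      \<comment> \<open>A null vector \<open>y\<close> need not be 0. The quadratic is then linear
        in \<open>r\<close>, and this \<open>r\<close> makes it negative.\<close>
      define r where "r = ((nrm x)\<^sup>2 + 1) / ?k\<^sup>2"
      have r: "r * ?k\<^sup>2 = (nrm x)\<^sup>2 + 1" using k by (simp add: r_def)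
      have "0 \<le> (nrm x)\<^sup>2 - 2 * (r * ?k\<^sup>2)" using ineq[of r] by (simp add: True)
      then have "(nrm x)\<^sup>2 + 2 \<le> 0" unfolding r by (simp add: algebra_simps)
      moreover have "0 \<le> (nrm x)\<^sup>2" by simp
      ultimately show False by linarith
    qed
    then show ?thesis by simp
  next
    case False
    have "(1 / (nrm y)\<^sup>2)\<^sup>2 * ?k\<^sup>2 * (nrm y)\<^sup>2 = ?k\<^sup>2 / (nrm y)\<^sup>2"
      using False by (simp add: power2_eq_square)
    with ineq[of "1 / (nrm y)\<^sup>2"] have "?k\<^sup>2 / (nrm y)\<^sup>2 \<le> (nrm x)\<^sup>2" by simp
    then show ?thesis using False by (simp add: field_simps power_mult_distrib)
  qed
  then show ?thesis by (rule power2_le_imp_le) (simp add: assms)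
qed

lemma nrm_triangle:
  assumes "x \<in> H" "y \<in> H"
  shows "nrm (x + y) \<le> nrm x + nrm y"
proof (rule power2_le_imp_le)
  have "Re (ip x y) \<le> nrm x * nrm y" using cauchy_schwarz[OF assms] complex_Re_le_cmod order_trans by blast
  then show "(nrm (x + y))\<^sup>2 \<le> (nrm x + nrm y)\<^sup>2" by (simp add: nrm_sq_add assms power2_sum)
qed (simp add: assms)

lemma nrm_triangle_diff:
  assumes "x \<in> H" "y \<in> H" "z \<in> H"
  shows "nrm (x - z) \<le> nrm (x - y) + nrm (y - z)"
  using nrm_triangle[of "x - y" "y - z"] assms by simp

lemma nrm_sq_add_le:
  assumes "x \<in> H" "y \<in> H"
  shows "(nrm (x + y))\<^sup>2 \<le> 2 * (nrm x)\<^sup>2 + 2 * (nrm y)\<^sup>2"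
  using nrm_sq_add[OF assms] nrm_sq_diff[OF assms] zero_le_power2[of "nrm (x - y)"] by linarith

lemma nrm_sq_diff_le:
  assumes "x \<in> H" "y \<in> H"
  shows "(nrm (x - y))\<^sup>2 \<le> 2 * (nrm x)\<^sup>2 + 2 * (nrm y)\<^sup>2"
  using nrm_sq_add[OF assms] nrm_sq_diff[OF assms] zero_le_power2[of "nrm (x + y)"] by linarith

section \<open>Finite orthonormal sets and their projections\<close>

definition orthonormal :: "'h set \<Rightarrow> bool"
  where "orthonormal E \<longleftrightarrow> E \<subseteq> H \<and> (\<forall>e\<in>E. \<forall>f\<in>E. ip e f = (if e = f then 1 else 0))"

definition proj :: "'h set \<Rightarrow> 'h \<Rightarrow> 'h"
  where "proj E x = (\<Sum>e\<in>E. ip e x *\<^sub>C e)"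

definition resid :: "'h set \<Rightarrow> 'h \<Rightarrow> 'h"
  where "resid E x = x - proj E x"

lemma orthonormalD: "orthonormal E \<Longrightarrow> e \<in> E \<Longrightarrow> f \<in> E \<Longrightarrow> ip e f = (if e = f then 1 else 0)"
  by (simp add: orthonormal_def)

lemma orthonormal_H: "orthonormal E \<Longrightarrow> e \<in> E \<Longrightarrow> e \<in> H"
  by (auto simp: orthonormal_def)

lemma orthonormal_subset: "orthonormal E \<Longrightarrow> F \<subseteq> E \<Longrightarrow> orthonormal F"
  unfolding orthonormal_def by blast

lemma orthonormal_nrm: "orthonormal E \<Longrightarrow> e \<in> E \<Longrightarrow> nrm e = 1"
  by (simp add: hnorm_def orthonormalD)

lemma proj_H [simp]: "orthonormal E \<Longrightarrow> proj E x \<in> H"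
  unfolding proj_def by (intro H_sum H_scale) (rule orthonormal_H)

lemma resid_H [simp]: "orthonormal E \<Longrightarrow> x \<in> H \<Longrightarrow> resid E x \<in> H"
  by (simp add: resid_def)

lemma proj_add: "orthonormal E \<Longrightarrow> x \<in> H \<Longrightarrow> y \<in> H \<Longrightarrow> proj E (x + y) = proj E x + proj E y"
  by (simp add: proj_def ip_add orthonormal_H scaleC_add_left sum.distrib)

lemma proj_diff: "orthonormal E \<Longrightarrow> x \<in> H \<Longrightarrow> y \<in> H \<Longrightarrow> proj E (x - y) = proj E x - proj E y"
  by (simp add: proj_def ip_diff orthonormal_H complex_vector.scale_left_diff_distrib sum_subtractf)

lemma proj_scale: "orthonormal E \<Longrightarrow> x \<in> H \<Longrightarrow> proj E (c *\<^sub>C x) = c *\<^sub>C proj E x"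
  by (simp add: proj_def ip_scale orthonormal_H complex_vector.scale_sum_right scaleC_scaleC)

lemma proj_span: "proj E x \<in> cspan E"
  unfolding proj_def by (intro complex_vector.span_sum complex_vector.span_scale complex_vector.span_base)

lemma ip_lin_comb:
  assumes "orthonormal E" "finite E" "e \<in> E"
  shows "ip e (\<Sum>f\<in>E. c f *\<^sub>C f) = c e"
proof -
  have "ip e (\<Sum>f\<in>E. c f *\<^sub>C f) = (\<Sum>f\<in>E. c f * ip e f)"
    using assms by (simp add: ip_sum ip_scale orthonormal_H)
  also have "\<dots> = (\<Sum>f\<in>E. if f = e then c e else 0)"
    using assms by (intro sum.cong) (auto simp: orthonormalD)
  finally show ?thesis using assms by simp
qed

lemma nrm_sq_lin_comb:
  assumes "orthonormal E" "finite E"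
  shows "(nrm (\<Sum>f\<in>E. c f *\<^sub>C f))\<^sup>2 = (\<Sum>f\<in>E. (cmod (c f))\<^sup>2)"
proof -
  let ?x = "\<Sum>f\<in>E. c f *\<^sub>C f"
  have H: "?x \<in> H" using assms by (simp add: orthonormal_H)
  have "ip ?x ?x = (\<Sum>f\<in>E. cnj (c f) * ip f ?x)"
    using assms H by (subst ip_sum_left) (simp_all add: ip_scale_left orthonormal_H)
  also have "\<dots> = (\<Sum>f\<in>E. complex_of_real ((cmod (c f))\<^sup>2))"
    using assms by (intro sum.cong) (simp_all only: ip_lin_comb complex_norm_square mult.commute)
  finally show ?thesis using H by (simp add: nrm_sq)
qed

lemma ip_proj:
  assumes "orthonormal E" "finite E" "e \<in> E"
  shows "ip e (proj E x) = ip e x"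
  unfolding proj_def by (rule ip_lin_comb[OF assms])

lemma ip_resid:
  assumes "orthonormal E" "finite E" "x \<in> H" "e \<in> cspan E"
  shows "ip e (resid E x) = 0"
proof -
  have EH: "E \<subseteq> H" using assms by (simp add: orthonormal_def)
  have "csubspace {y \<in> H. ip y (resid E x) = 0}"
    using assms by (simp add: complex_vector.subspace_def ip_add_left ip_scale_left)
  then have "cspan E \<subseteq> {y \<in> H. ip y (resid E x) = 0}"
    using assms EH by (intro complex_vector.span_minimal) (auto simp: resid_def ip_diff ip_proj)
  with assms show ?thesis by blast
qed

lemma proj_eq:
  assumes "orthonormal E" "finite E" "x \<in> cspan E"
  shows "proj E x = x"
proof -
  have EH: "E \<subseteq> H" using assms by (simp add: orthonormal_def)
  have "csubspace {y \<in> H. proj E y = y}"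
    using assms by (simp add: complex_vector.subspace_def proj_add proj_scale) (simp add: proj_def orthonormal_H)
  moreover have "proj E e = e" if "e \<in> E" for e
  proof -
    have "proj E e = (\<Sum>f\<in>E. if f = e then e else 0)"
      unfolding proj_def using assms that by (intro sum.cong) (auto simp: orthonormalD)
    then show ?thesis using assms that by simp
  qed
  ultimately have "cspan E \<subseteq> {y \<in> H. proj E y = y}"
    using EH by (intro complex_vector.span_minimal) auto
  with assms show ?thesis by blast
qed

lemma pythagoras:
  assumes "orthonormal E" "finite E" "x \<in> H"
  shows "(nrm (resid E x))\<^sup>2 + (\<Sum>e\<in>E. (cmod (ip e x))\<^sup>2) = (nrm x)\<^sup>2"
proof -
  have "ip (proj E x) (resid E x) = 0" using assms by (intro ip_resid) (simp_all add: proj_span)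
  then have "(nrm (proj E x + resid E x))\<^sup>2 = (nrm (proj E x))\<^sup>2 + (nrm (resid E x))\<^sup>2"
    using assms by (simp add: nrm_sq_add)
  moreover have "(nrm (proj E x))\<^sup>2 = (\<Sum>e\<in>E. (cmod (ip e x))\<^sup>2)"
    unfolding proj_def by (rule nrm_sq_lin_comb[OF assms(1,2)])
  ultimately show ?thesis by (simp add: resid_def)
qed

lemma bessel:
  assumes "orthonormal E" "finite E" "x \<in> H"
  shows "(\<Sum>e\<in>E. (cmod (ip e x))\<^sup>2) \<le> (nrm x)\<^sup>2"
  using pythagoras[OF assms] zero_le_power2[of "nrm (resid E x)"] by linarith

lemma nrm_resid_le:
  assumes "orthonormal E" "finite E" "x \<in> H"
  shows "nrm (resid E x) \<le> nrm x"
  by (rule power2_le_imp_le)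
    (use pythagoras[OF assms] assms in \<open>simp_all add: sum_nonneg flip: pythagoras[OF assms]\<close>)

lemma nrm_proj_le:
  assumes "orthonormal E" "finite E" "x \<in> H"
  shows "nrm (proj E x) \<le> nrm x"
proof (rule power2_le_imp_le)
  show "(nrm (proj E x))\<^sup>2 \<le> (nrm x)\<^sup>2"
    using bessel[OF assms] unfolding proj_def by (simp only: nrm_sq_lin_comb[OF assms(1,2)])
qed (simp add: assms)

lemma nrm_resid_approx:
  assumes "orthonormal E" "finite E" "x \<in> H" "y \<in> cspan E"
  shows "nrm (resid E x) \<le> nrm (x - y)"
proof -
  have y: "y \<in> H" using assms H_span[of E] by (auto simp: orthonormal_def)
  have "resid E (x - y) = resid E x" using assms y by (simp add: resid_def proj_diff proj_eq)
  with nrm_resid_le[of E "x - y"] assms y show ?thesis by simp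
qed

lemma orthonormal_independent:
  assumes "orthonormal E" "finite E"
  shows "complex_vector.independent E"
proof (rule complex_vector.independent_if_scalars_zero[OF assms(2)])
  fix c e assume "(\<Sum>x\<in>E. c x *\<^sub>C x) = 0" "e \<in> E"
  with ip_lin_comb[OF assms, of e c] orthonormal_H[OF assms(1)] show "c e = 0" by simp
qed

lemma orthonormal_insert:
  assumes "orthonormal E" "x \<in> H" "\<And>e. e \<in> E \<Longrightarrow> ip e x = 0" "nrm x \<noteq> 0"
  shows "orthonormal (insert ((1 / complex_of_real (nrm x)) *\<^sub>C x) E)"
proof -
  let ?v = "(1 / complex_of_real (nrm x)) *\<^sub>C x"
  have v: "?v \<in> H" using assms by simp
  have "ip e ?v = 0" "ip ?v e = 0" if "e \<in> E" for e
    using assms that orthonormal_H[OF assms(1) that] ip_cnj[of e x] by (simp_all add: ip_scale ip_scale_left)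
  moreover have "ip ?v ?v = 1"
    using assms v by (simp add: ip_self nrm_scale norm_divide)
  ultimately show ?thesis using assms v unfolding orthonormal_def by auto
qed

text \<open>In place of Gram--Schmidt: an orthonormal set of largest size between \<open>U\<close>
  and \<open>Y\<close> must span \<open>Y\<close>, since a nonzero residual could be normalised and
  added. Definiteness on \<open>Y\<close> alone ensures that the residual has nonzero
  seminorm.\<close>

lemma orthonormal_extend:
  assumes U: "orthonormal U" "finite U" "U \<subseteq> Y"
    and Y: "csubspace Y" "Y \<subseteq> H" "finite_dimensional Y" "\<And>y. y \<in> Y \<Longrightarrow> ip y y = 0 \<Longrightarrow> y = 0"
  obtains V where "U \<subseteq> V" "orthonormal V" "finite V" "cspan V = Y" "card V = cdim Y"
proof -
  obtain S where S: "finite S" "Y \<subseteq> cspan S" using Y by (auto simp: finite_dimensional_def)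
  let ?P = "\<lambda>V. U \<subseteq> V \<and> V \<subseteq> Y \<and> finite V \<and> orthonormal V"
  have bd: "card V \<le> card S" if "?P V" for V
    using that S complex_vector.independent_span_bound[OF S(1) orthonormal_independent] by (meson order_trans)
  have "?P U" using U by simp
  \<comment> \<open>Independent subsets of the span of \<open>S\<close> have at most
    \<open>card S\<close> elements; the strict bound \<open>card S + 1\<close> is the form in which
    a maximum is extracted.\<close>
  then obtain V where V: "?P V" and max: "\<And>W. ?P W \<Longrightarrow> card W \<le> card V"
    using ex_has_greatest_nat[of ?P U card "card S + 1"] bd by (metis Suc_eq_plus1 less_Suc_eq_le)
  have "cspan V = Y"
  proof
    show le: "cspan V \<subseteq> Y" using V Y by (intro complex_vector.span_minimal) auto
    show "Y \<subseteq> cspan V"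
    proof
      fix y assume y: "y \<in> Y"
      let ?w = "resid V y"
      have w: "?w \<in> Y" "?w \<in> H" using y Y le proj_span[of V y]
        unfolding resid_def by (auto intro: complex_vector.subspace_diff)
      show "y \<in> cspan V"
      proof (cases "?w = 0")
        case True
        then show ?thesis using proj_span[of V y] by (simp add: resid_def)
      next
        case False
        then have n: "nrm ?w \<noteq> 0" using Y w by (auto simp: nrm_eq_0_iff)
        let ?v = "(1 / complex_of_real (nrm ?w)) *\<^sub>C ?w"
        have perp: "ip e ?w = 0" if "e \<in> V" for e
          using V y Y that by (intro ip_resid) (auto intro: complex_vector.span_base)
        then have "orthonormal (insert ?v V)" using V w n by (intro orthonormal_insert) auto
        moreover have "?v \<in> Y" using Y w by (auto intro: complex_vector.subspace_scale)
        moreover have "?v \<notin> V"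
        proof
          assume "?v \<in> V"
          then have "ip ?v ?w = 0" by (rule perp)
          then show False using w n by (simp add: ip_scale_left ip_self)
        qed
        ultimately have False using max[of "insert ?v V"] V by auto
        then show ?thesis ..
      qed
    qed
  qed
  moreover have "cdim Y = card V"
    using V calculation orthonormal_independent[of V] complex_vector.dim_eq_card[of V Y] complex_vector.span_span by metis
  ultimately show thesis using V by (intro that[of V]) auto
qed

end


section \<open>Compression by a Foelner subspace\<close>

definition sip :: "('a::pre_cstar_algebra \<Rightarrow> complex) \<Rightarrow> 'a \<Rightarrow> 'a \<Rightarrow> complex"
  where "sip \<phi> x y = \<phi> (star x * y)"

locale state =
  fixes P :: "'a::pre_cstar_algebra set" and \<phi> :: "'a \<Rightarrow> complex"
  assumes state: "state_on P \<phi>"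
begin

lemma add: "\<phi> (x + y) = \<phi> x + \<phi> y" and scale: "\<phi> (c *\<^sub>C x) = c * \<phi> x" and one: "\<phi> 1 = 1"
  and star: "\<phi> (star x) = cnj (\<phi> x)" and nonneg: "0 \<le> \<phi> (star x * x)"
  and bound: "Re (\<phi> (star (a * x) * (a * x))) \<le> (norm a)\<^sup>2 * Re (\<phi> (star x * x))"
  and cone_nonneg: "p \<in> P \<Longrightarrow> 0 \<le> \<phi> (star x * p * x)"
  using state by (auto simp: state_on_def)

lemma zero [simp]: "\<phi> 0 = 0"
  using add[of 0 0] by simp

lemma sum: "\<phi> (\<Sum>i\<in>I. f i) = (\<Sum>i\<in>I. \<phi> (f i))"
  by (induction I rule: infinite_finite_induct) (simp_all add: add)

sublocale semi_inner UNIV "sip \<phi>"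
proof
  show "csubspace (UNIV :: 'a set)" by simp
  show "sip \<phi> y x = cnj (sip \<phi> x y)" for x y
    using star[of "star x * y"] by (simp add: sip_def star_mult star_star)
qed (simp_all add: sip_def distrib_left add scaleC_mult_right scale nonneg)

lemma nrm_mult: "nrm (a * x) \<le> norm a * nrm x"
  by (rule power2_le_imp_le) (use bound[of a x] in \<open>simp_all add: nrm_sq power_mult_distrib sip_def\<close>)

lemma nrm_le: "nrm x \<le> norm x"
  using nrm_mult[of x 1] by (simp add: hnorm_def[of _ 1] sip_def one)

lemma sip_star_mult: "sip \<phi> (star a * x) y = sip \<phi> x (a * y)"
  by (simp add: sip_def star_mult star_star mult.assoc)

text \<open>Let \<open>V\<close> extend \<open>U\<close> to an orthonormal basis of
  \<open>Y\<close>. The residual of b u has coordinates only along \<open>V - U\<close>. Summed over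
  u first, with b moved across as \<open>star b\<close>, they form a Bessel sum for each v, at most
  the squared norm of b; and \<open>V - U\<close> has dim Y - dim W elements.\<close>

lemma defect_subspace:
  assumes U: "orthonormal U" "finite U" "cspan U = W" "card U = cdim W"
    and W: "csubspace W"
    and Y: "Y = {b * v + w |v w. v \<in> W \<and> w \<in> W}" "finite_dimensional Y"
    and faithful: "\<And>y. y \<in> Y \<Longrightarrow> \<phi> (star y * y) = 0 \<Longrightarrow> y = 0"
    and dim: "real (cdim Y) \<le> (1 + \<epsilon>) * real (cdim W)"
  shows "(\<Sum>u\<in>U. (nrm (resid U (b * u)))\<^sup>2) \<le> \<epsilon> * (norm b)\<^sup>2 * real (card U)"
proof -
  have Ysub: "csubspace Y"
    unfolding complex_vector.subspace_def Y
  proof (intro conjI allI ballI)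
    have "b * 0 + 0 = (0::'a)" "0 \<in> W" using W by (simp_all add: complex_vector.subspace_0)
    then show "0 \<in> {b * v + w |v w. v \<in> W \<and> w \<in> W}" by force
    fix x assume x: "x \<in> {b * v + w |v w. v \<in> W \<and> w \<in> W}"
    then obtain v w where vw: "x = b * v + w" "v \<in> W" "w \<in> W" by blast
    have "c *\<^sub>C x = b * (c *\<^sub>C v) + c *\<^sub>C w" for c
      by (simp add: vw scaleC_add_right scaleC_mult_right)
    then show "c *\<^sub>C x \<in> {b * v + w |v w. v \<in> W \<and> w \<in> W}" for c
      using vw W complex_vector.subspace_scale by blast
    fix y assume "y \<in> {b * v + w |v w. v \<in> W \<and> w \<in> W}"
    then obtain v' w' where vw': "y = b * v' + w'" "v' \<in> W" "w' \<in> W" by blast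
    have "x + y = b * (v + v') + (w + w')" by (simp add: vw vw' algebra_simps)
    then show "x + y \<in> {b * v + w |v w. v \<in> W \<and> w \<in> W}"
      using vw vw' W complex_vector.subspace_add by blast
  qed
  have UW: "U \<subseteq> W" using U complex_vector.span_superset by blast
  have bU: "b * u \<in> Y" if "u \<in> U" for u
  proof -
    have "b * u = b * u + 0" "u \<in> W" "0 \<in> W" using W UW that by (auto simp: complex_vector.subspace_0)
    then show ?thesis unfolding Y by blast
  qed
  have "W \<subseteq> Y"
  proof
    fix w assume "w \<in> W"
    moreover have "w = b * 0 + w" "0 \<in> W" using W by (simp_all add: complex_vector.subspace_0)
    ultimately show "w \<in> Y" unfolding Y by blast
  qed
  then have "U \<subseteq> Y" using UW by blast
  then obtain V where V: "U \<subseteq> V" "orthonormal V" "finite V" "cspan V = Y" "card V = cdim Y"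
    using orthonormal_extend[OF U(1,2) _ Ysub _ Y(2)] faithful by (auto simp: sip_def)
  have "(nrm (resid U (b * u)))\<^sup>2 = (\<Sum>v\<in>V - U. (cmod (sip \<phi> v (b * u)))\<^sup>2)" if "u \<in> U" for u
  proof -
    have "proj V (b * u) = b * u" using V bU[OF that] by (intro proj_eq) auto
    then have "resid U (b * u) = proj V (b * u) - proj U (b * u)" by (simp add: resid_def)
    also have "\<dots> = (\<Sum>v\<in>V - U. sip \<phi> v (b * u) *\<^sub>C v)"
      unfolding proj_def using V by (simp add: sum_diff)
    finally show ?thesis using V by (simp add: nrm_sq_lin_comb orthonormal_subset[OF V(2)])
  qed
  then have "(\<Sum>u\<in>U. (nrm (resid U (b * u)))\<^sup>2) = (\<Sum>u\<in>U. \<Sum>v\<in>V - U. (cmod (sip \<phi> v (b * u)))\<^sup>2)" by simp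
  also have "\<dots> = (\<Sum>v\<in>V - U. \<Sum>u\<in>U. (cmod (sip \<phi> u (star b * v)))\<^sup>2)"
  proof (subst sum.swap, intro sum.cong refl)
    fix v u
    have "sip \<phi> v (b * u) = cnj (sip \<phi> u (star b * v))"
      using ip_cnj[of "star b * v" u] by (simp add: sip_star_mult)
    then show "(cmod (sip \<phi> v (b * u)))\<^sup>2 = (cmod (sip \<phi> u (star b * v)))\<^sup>2" by simp
  qed
  also have "\<dots> \<le> (\<Sum>v\<in>V - U. (norm b)\<^sup>2)"
  proof (rule sum_mono)
    fix v assume "v \<in> V - U"
    then have "nrm (star b * v) \<le> norm b" using nrm_mult[of "star b" v] V by (simp add: orthonormal_nrm)
    then have sq: "(nrm (star b * v))\<^sup>2 \<le> (norm b)\<^sup>2" by (simp add: power_mono)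
    show "(\<Sum>u\<in>U. (cmod (sip \<phi> u (star b * v)))\<^sup>2) \<le> (norm b)\<^sup>2"
      by (rule order_trans[OF bessel[OF U(1,2) UNIV_I] sq])
  qed
  also have "\<dots> = (real (cdim Y) - real (cdim W)) * (norm b)\<^sup>2"
    using V U card_mono[OF V(3,1)] by (simp add: card_Diff_subset of_nat_diff)
  also have "\<dots> \<le> (\<epsilon> * real (cdim W)) * (norm b)\<^sup>2"
    using dim by (intro mult_right_mono) (simp_all add: algebra_simps)
  finally show ?thesis using U by (simp add: mult_ac)
qed

text \<open>The residual is linear in T and each u is a unit vector, so passing from T to b costs at
  most \<open>norm (T - b)\<close> per vector.\<close>

lemma defect_approx:
  assumes U: "orthonormal U" "finite U"
  shows "(\<Sum>u\<in>U. (nrm (resid U (T * u)))\<^sup>2)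
    \<le> 2 * (\<Sum>u\<in>U. (nrm (resid U (b * u)))\<^sup>2) + 2 * (norm (T - b))\<^sup>2 * real (card U)"
proof -
  have "(nrm (resid U (T * u)))\<^sup>2 \<le> 2 * (nrm (resid U (b * u)))\<^sup>2 + 2 * (norm (T - b))\<^sup>2" if "u \<in> U" for u
  proof -
    have "resid U (T * u) = resid U (b * u) + resid U ((T - b) * u)"
      using proj_add[OF U(1), of "b * u" "(T - b) * u"] by (simp add: resid_def algebra_simps)
    then have "(nrm (resid U (T * u)))\<^sup>2 \<le> 2 * (nrm (resid U (b * u)))\<^sup>2 + 2 * (nrm (resid U ((T - b) * u)))\<^sup>2"
      using nrm_sq_add_le[of "resid U (b * u)" "resid U ((T - b) * u)"] by simp
    moreover have "nrm (resid U ((T - b) * u)) \<le> norm (T - b)"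
      using nrm_resid_le[OF U, of "(T - b) * u"] nrm_mult[of "T - b" u] orthonormal_nrm[OF U(1) that] by simp
    then have "(nrm (resid U ((T - b) * u)))\<^sup>2 \<le> (norm (T - b))\<^sup>2" by (simp add: power_mono)
    ultimately show ?thesis by linarith
  qed
  then have "(\<Sum>u\<in>U. (nrm (resid U (T * u)))\<^sup>2) \<le> (\<Sum>u\<in>U. 2 * (nrm (resid U (b * u)))\<^sup>2 + 2 * (norm (T - b))\<^sup>2)"
    by (rule sum_mono)
  then show ?thesis by (simp add: sum.distrib sum_distrib_left mult_ac)
qed

end

section \<open>States faithful on finite-dimensional spaces\<close>

lemma state_average:
  assumes "state_on P \<phi>" "state_on P \<psi>"
  shows "state_on P (\<lambda>x. (\<phi> x + \<psi> x) / 2)"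
proof -
  interpret f: state P \<phi> by unfold_locales fact
  interpret g: state P \<psi> by unfold_locales fact
  show ?thesis
    unfolding state_on_def
  proof (intro conjI allI ballI)
    show "Re ((\<phi> (star (a * x) * (a * x)) + \<psi> (star (a * x) * (a * x))) / 2)
      \<le> (norm a)\<^sup>2 * Re ((\<phi> (star x * x) + \<psi> (star x * x)) / 2)" for a x
      using f.bound[of a x] g.bound[of a x] by (simp add: algebra_simps)
    show "0 \<le> (\<phi> (star x * x) + \<psi> (star x * x)) / 2" for x
      using f.nonneg[of x] g.nonneg[of x] by (simp add: less_eq_complex_def)
    show "0 \<le> (\<phi> (star x * p * x) + \<psi> (star x * p * x)) / 2" if "p \<in> P" for p x
      using f.cone_nonneg[OF that, of x] g.cone_nonneg[OF that, of x] by (simp add: less_eq_complex_def)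
  qed (simp_all add: f.add g.add f.scale g.scale f.one g.one f.star g.star add_divide_distrib distrib_left)
qed

lemma state_average_eq_0:
  assumes "state_on P \<phi>" "state_on P \<psi>" "(\<phi> (star x * x) + \<psi> (star x * x)) / 2 = 0"
  shows "\<phi> (star x * x) = 0" "\<psi> (star x * x) = 0"
proof -
  interpret f: state P \<phi> by unfold_locales fact
  interpret g: state P \<psi> by unfold_locales fact
  show "\<phi> (star x * x) = 0" "\<psi> (star x * x) = 0"
    using assms(3) f.nonneg[of x] g.nonneg[of x] by (simp_all add: less_eq_complex_def complex_eq_iff)
qed

text \<open>If \<phi> is faithful on the span of \<open>S\<close>, its null vectors in the span of
  \<open>insert s S\<close> form at most a line: subtracting a multiple of one null vector
  \<open>z\<close> from another removes \<open>s\<close>, and the difference is null in the span of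
  \<open>S\<close>. Averaging with a state that detects \<open>z\<close> removes this line.\<close>

lemma faithful_state:
  assumes "separating_states P" "finite S"
  obtains \<phi> where "state_on P \<phi>" "\<And>z. z \<in> cspan S \<Longrightarrow> \<phi> (star z * z) = 0 \<Longrightarrow> z = 0"
proof -
  from assms(2) have "\<exists>\<phi>. state_on P \<phi> \<and> (\<forall>z\<in>cspan S. \<phi> (star z * z) = 0 \<longrightarrow> z = 0)"
  proof (induction S)
    case empty
    obtain \<phi> where "state_on P \<phi>" using assms(1) one_neq_zero unfolding separating_states_def by blast
    then show ?case by auto
  next
    case (insert s S)
    then obtain \<phi> where \<phi>: "state_on P \<phi>" "\<And>z. z \<in> cspan S \<Longrightarrow> \<phi> (star z * z) = 0 \<Longrightarrow> z = 0" by blast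
    interpret f: state P \<phi> by unfold_locales fact
    have null_diff: "\<phi> (star (x - c *\<^sub>C y) * (x - c *\<^sub>C y)) = 0"
      if "\<phi> (star x * x) = 0" "\<phi> (star y * y) = 0" for c x y
    proof -
      have "f.nrm x = 0" "f.nrm y = 0" using that by (simp_all add: hnorm_def sip_def)
      then have "f.nrm (x - c *\<^sub>C y) \<le> 0"
        using f.nrm_triangle_diff[of x 0 "c *\<^sub>C y"] f.nrm_minus[of 0 "c *\<^sub>C y"] by (simp add: f.nrm_scale)
      then have "f.nrm (x - c *\<^sub>C y) = 0" by (rule antisym) simp
      then show ?thesis using f.nrm_eq_0_iff[of "x - c *\<^sub>C y"] by (simp add: sip_def)
    qed
    show ?case
    proof (cases "\<forall>z\<in>cspan (insert s S). \<phi> (star z * z) = 0 \<longrightarrow> z = 0")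
      case True
      with \<phi> show ?thesis by blast
    next
      case False
      then obtain z where z: "z \<in> cspan (insert s S)" "\<phi> (star z * z) = 0" "z \<noteq> 0" by blast
      obtain \<psi> where \<psi>: "state_on P \<psi>" "\<psi> (star z * z) \<noteq> 0"
        using assms(1) z(3) unfolding separating_states_def by blast
      interpret g: state P \<psi> by unfold_locales fact
      obtain k where k: "z - k *\<^sub>C s \<in> cspan S" using z(1) by (auto simp: complex_vector.span_insert)
      have "k \<noteq> 0" using k \<phi>(2)[of z] z by auto
      have "w = 0" if w: "w \<in> cspan (insert s S)" and w0: "(\<phi> (star w * w) + \<psi> (star w * w)) / 2 = 0" for w
      proof -
        note w0' = state_average_eq_0[OF \<phi>(1) \<psi>(1) w0]
        obtain l where l: "w - l *\<^sub>C s \<in> cspan S" using w by (auto simp: complex_vector.span_insert)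
        have "(w - l *\<^sub>C s) - (l / k) *\<^sub>C (z - k *\<^sub>C s) \<in> cspan S"
          by (rule complex_vector.span_diff[OF l complex_vector.span_scale[OF k]])
        also have "(w - l *\<^sub>C s) - (l / k) *\<^sub>C (z - k *\<^sub>C s) = w - (l / k) *\<^sub>C z"
          using \<open>k \<noteq> 0\<close> by (simp add: complex_vector.scale_right_diff_distrib scaleC_scaleC)
        finally have "w - (l / k) *\<^sub>C z = 0" using \<phi>(2) null_diff w0' z by blast
        then have weq: "w = (l / k) *\<^sub>C z" by simp
        have "\<psi> (star w * w) = cnj (l / k) * (l / k) * \<psi> (star z * z)"
          by (simp add: weq star_scaleC scaleC_mult_left scaleC_mult_right g.scale mult_ac)
        with w0' \<psi>(2) have "l / k = 0" by simp
        with weq show ?thesis by simp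
      qed
      with state_average[OF \<phi>(1) \<psi>(1)] show ?thesis by blast
    qed
  qed
  then show thesis using that by blast
qed

text \<open>A single state has to be faithful on b W + W for all b in \<open>F\<close> at
  once.\<close>

lemma foelner_subspace_span:
  assumes "foelner_subspace B F \<epsilon> W" "finite F"
  shows "\<exists>S. finite S \<and> W \<subseteq> cspan S \<and> (\<forall>b\<in>F. {b * v + w |v w. v \<in> W \<and> w \<in> W} \<subseteq> cspan S)"
proof -
  obtain S where S: "finite S" "W \<subseteq> cspan S" using assms by (auto simp: foelner_subspace_def finite_dimensional_def)
  let ?S = "S \<union> (\<Union>b\<in>F. (*) b ` S)"
  have "cspan S \<subseteq> cspan ?S" by (rule complex_vector.span_mono) simp
  then have W: "W \<subseteq> cspan ?S" using S by blast
  have mult: "b * v \<in> cspan ?S" if "b \<in> F" "v \<in> W" for b v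
  proof -
    have "csubspace {x. b * x \<in> cspan ?S}"
      unfolding complex_vector.subspace_def
      by (simp add: complex_vector.span_zero distrib_left complex_vector.span_add scaleC_mult_right complex_vector.span_scale)
    moreover have "S \<subseteq> {x. b * x \<in> cspan ?S}" using that by (auto intro!: complex_vector.span_base)
    ultimately have "cspan S \<subseteq> {x. b * x \<in> cspan ?S}" by (intro complex_vector.span_minimal)
    with S that show ?thesis by blast
  qed
  show ?thesis
  proof (intro exI[of _ ?S] conjI ballI W)
    show "finite ?S" using S assms by simp
    show "{b * v + w |v w. v \<in> W \<and> w \<in> W} \<subseteq> cspan ?S" if "b \<in> F" for b
      using mult[OF that] W by (auto intro!: complex_vector.span_add)
  qed
qed

text \<open>Half of \<omega> is the prescribed \<phi>, which may thus be fixed before W is known;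
  the other half \<psi> supplies faithfulness, because null vectors of the average are null for
  \<psi>. The bound is \<open>defect_approx\<close> applied to
  \<open>defect_subspace\<close>.\<close>

lemma foelner_subspace_state:
  fixes b :: "'a::pre_cstar_algebra \<Rightarrow> 'a"
  assumes W: "foelner_subspace B (b ` F) \<epsilon> W" and F: "finite F"
    and P: "separating_states P" and \<phi>: "state_on P \<phi>"
    and b: "\<And>T. T \<in> F \<Longrightarrow> norm (T - b T) \<le> \<eta>" "\<And>T. T \<in> F \<Longrightarrow> (norm (b T))\<^sup>2 \<le> M" and \<epsilon>: "\<epsilon> \<ge> 0"
  shows "\<exists>\<psi> \<omega> U. state_on P \<psi> \<and> state_on P \<omega> \<and> \<omega> = (\<lambda>x. (\<phi> x + \<psi> x) / 2) \<and>
    semi_inner.orthonormal UNIV (sip \<omega>) U \<and> finite U \<and> U \<noteq> {} \<and> cspan U = W \<and>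
    (\<forall>T\<in>F. (\<Sum>u\<in>U. (hnorm (sip \<omega>) (semi_inner.resid (sip \<omega>) U (T * u)))\<^sup>2)
      \<le> 2 * (\<epsilon> * M + \<eta>\<^sup>2) * real (card U))"
proof -
  obtain S where S: "finite S" "W \<subseteq> cspan S"
    "\<forall>c\<in>b ` F. {c * v + w |v w. v \<in> W \<and> w \<in> W} \<subseteq> cspan S"
    using foelner_subspace_span[OF W finite_imageI[OF F]] by blast
  obtain \<psi> where \<psi>: "state_on P \<psi>" "\<And>z. z \<in> cspan S \<Longrightarrow> \<psi> (star z * z) = 0 \<Longrightarrow> z = 0"
    using faithful_state[OF P S(1)] by blast
  define \<omega> where "\<omega> x = (\<phi> x + \<psi> x) / 2" for x
  have \<omega>: "state_on P \<omega>" unfolding \<omega>_def by (rule state_average[OF \<phi> \<psi>(1)])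
  interpret state P \<omega> by unfold_locales fact
  have faithful: "z = 0" if "z \<in> cspan S" "\<omega> (star z * z) = 0" for z
    using that \<psi>(2) state_average_eq_0(2)[OF \<phi> \<psi>(1)] by (simp add: \<omega>_def)
  have Wsub: "csubspace W" and W0: "W \<noteq> {0}" and Wfd: "finite_dimensional W"
    and dim: "\<And>T. T \<in> F \<Longrightarrow> real (cdim {b T * v + w |v w. v \<in> W \<and> w \<in> W}) \<le> (1 + \<epsilon>) * real (cdim W)"
    using W by (auto simp: foelner_subspace_def)
  have "orthonormal {}" by (simp add: orthonormal_def)
  then obtain U where U: "orthonormal U" "finite U" "cspan U = W" "card U = cdim W"
    using orthonormal_extend[of "{}" W] Wsub Wfd faithful S by (auto simp: sip_def)
  have U0: "U \<noteq> {}" using U W0 by auto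
  have est: "(\<Sum>u\<in>U. (nrm (resid U (T * u)))\<^sup>2) \<le> 2 * (\<epsilon> * M + \<eta>\<^sup>2) * real (card U)" if T: "T \<in> F" for T
  proof -
    have "(\<Sum>u\<in>U. (nrm (resid U (b T * u)))\<^sup>2) \<le> \<epsilon> * (norm (b T))\<^sup>2 * real (card U)"
    proof (rule defect_subspace[OF U Wsub refl])
      have Y: "{b T * v + w |v w. v \<in> W \<and> w \<in> W} \<subseteq> cspan S" using S(3) T by blast
      then show "finite_dimensional {b T * v + w |v w. v \<in> W \<and> w \<in> W}"
        using S(1) unfolding finite_dimensional_def by blast
      show "y = 0" if "y \<in> {b T * v + w |v w. v \<in> W \<and> w \<in> W}" "\<omega> (star y * y) = 0" for y
        using that Y faithful by blast
    qed (fact dim[OF T])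
    also have "\<dots> \<le> \<epsilon> * M * real (card U)" using b(2)[OF T] \<epsilon> by (intro mult_right_mono mult_left_mono) simp_all
    finally have 1: "(\<Sum>u\<in>U. (nrm (resid U (b T * u)))\<^sup>2) \<le> \<epsilon> * M * real (card U)" .
    have "(norm (T - b T))\<^sup>2 * real (card U) \<le> \<eta>\<^sup>2 * real (card U)"
      using b(1)[OF T] by (intro mult_right_mono power_mono) simp_all
    with 1 defect_approx[OF U(1,2), of T "b T"] show ?thesis by (simp add: algebra_simps)
  qed
  have "\<omega> = (\<lambda>x. (\<phi> x + \<psi> x) / 2)" by (simp add: fun_eq_iff \<omega>_def)
  with \<psi>(1) \<omega> U U0 est show ?thesis by blast
qed

section \<open>Compressions as unital completely positive matrix maps\<close>

lemma norm_2_tr_eq: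
  assumes "M \<in> carrier_mat k k"
  shows "norm_2_tr M = sqrt ((\<Sum>j<k. \<Sum>i<k. (cmod (M $$ (i, j)))\<^sup>2) / real k)"
proof -
  have "(mat_adjoint M * M) $$ (j, j) = complex_of_real (\<Sum>i<k. (cmod (M $$ (i, j)))\<^sup>2)" if "j < k" for j
  proof -
    have "(mat_adjoint M * M) $$ (j, j) = (\<Sum>i<k. cnj (M $$ (i, j)) * M $$ (i, j))"
      using assms that by (simp add: mat_adjoint_def scalar_prod_def mat_of_rows_def atLeast0LessThan)
    then show ?thesis by (simp add: complex_norm_square mult.commute del: of_real_power)
  qed
  then have "Re (normalized_trace (mat_adjoint M * M)) = (\<Sum>j<k. \<Sum>i<k. (cmod (M $$ (i, j)))\<^sup>2) / real k"
    using assms by (simp add: normalized_trace_def mat_adjoint_def mat_of_rows_def Re_divide_of_nat flip: of_real_sum)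
  then show ?thesis by (simp add: norm_2_tr_def)
qed

text \<open>The matrix of Q pi(A) Q in the orthonormal basis of vectors e_i \<Omega>, written with
  the state alone; part (i) needs no Hilbert space.\<close>

definition compression :: "('a::pre_cstar_algebra \<Rightarrow> complex) \<Rightarrow> nat \<Rightarrow> (nat \<Rightarrow> 'a) \<Rightarrow> 'a \<Rightarrow> complex mat"
  where "compression \<phi> k e A = mat k k (\<lambda>(i, j). \<phi> (star (e i) * A * e j))"

context state
begin

text \<open>Positivity of the block matrix with entries \<open>\<phi> (e\<^sub>\<alpha>\<^sup>* (\<Sum>\<^sub>l X\<^sub>i\<^sup>* A\<^sub>l X\<^sub>j) e\<^sub>\<beta>)\<close> at the vector \<open>w\<close>: the quadratic
  form is \<open>\<Sum>\<^sub>l \<phi> (y\<^sub>l\<^sup>* A\<^sub>l y\<^sub>l)\<close> with \<open>y\<^sub>l = \<Sum> w\<^sub>j\<^sub>\<beta> X\<^sub>j e\<^sub>\<beta>\<close>.\<close>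

lemma compression_cp: "completely_positive P k (compression \<phi> k e)"
  unfolding completely_positive_def
proof (intro allI ballI)
  fix m M assume "M \<in> matrix_cone P m"
  then obtain r :: nat and A X where M: "M = mat m m (\<lambda>(i, j). \<Sum>l<r. star (X l i) * A l * X l j)"
    and A: "\<And>l. l < r \<Longrightarrow> A l \<in> P" by (auto simp: matrix_cone_def)
  let ?N = "entrywise k (compression \<phi> k e) m M"
  have N: "?N \<in> carrier_mat (m * k) (m * k)" by (simp add: entrywise_def)
  \<comment> \<open>Flattened indices: position \<open>p\<close> of the block matrix is row
    \<open>p mod k\<close> of block row \<open>p div k\<close>.\<close>
  define x where "x l p = X l (p div k) * e (p mod k)" for l p
  have entry: "?N $$ (p, q) = (\<Sum>l<r. \<phi> (star (x l p) * A l * x l q))" if "p < m * k" "q < m * k" for p q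
  proof -
    have "k > 0" using that by (cases k) auto
    then have "p div k < m" "q div k < m" "p mod k < k" "q mod k < k"
      using that by (simp_all add: less_mult_imp_div_less)
    then show ?thesis
      using that by (simp add: entrywise_def compression_def M sum_distrib_left sum_distrib_right sum
          x_def star_mult mult.assoc)
  qed
  show "psd_mat (m * k) ?N"
    unfolding psd_mat_def
  proof (intro conjI ballI N)
    fix v :: "complex vec" assume v: "v \<in> carrier_vec (m * k)"
    let ?n = "m * k"
    define y where "y l = (\<Sum>q<?n. v $ q *\<^sub>C x l q)" for l
    have "(?N *\<^sub>v v) \<bullet>c v = (\<Sum>p<?n. (\<Sum>q<?n. ?N $$ (p, q) * v $ q) * cnj (v $ p))"
      using N v by (simp add: scalar_prod_def atLeast0LessThan)
    also have "\<dots> = (\<Sum>p<?n. \<Sum>q<?n. \<Sum>l<r. cnj (v $ p) * v $ q * \<phi> (star (x l p) * A l * x l q))"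
      by (intro sum.cong refl) (simp add: entry sum_distrib_left sum_distrib_right mult_ac)
    also have "\<dots> = (\<Sum>l<r. \<Sum>p<?n. \<Sum>q<?n. cnj (v $ p) * v $ q * \<phi> (star (x l p) * A l * x l q))"
      by (subst sum.swap[of _ "{..<r}" "{..<?n}"]) (intro sum.cong refl sum.swap)
    also have "\<dots> = (\<Sum>l<r. \<phi> (star (y l) * A l * y l))"
      by (intro sum.cong refl, subst sum.swap)
        (simp add: y_def star_sum star_scaleC sum_distrib_left sum_distrib_right sum
          scaleC_mult_left scaleC_mult_right scaleC_scaleC scale mult_ac)
    finally show "0 \<le> (?N *\<^sub>v v) \<bullet>c v" using A by (auto intro: sum_nonneg cone_nonneg)
  qed
qed

lemma compression_ucp:
  assumes "bij_betw e {..<k} U" "orthonormal U"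
  shows "ucp_map P k (compression \<phi> k e)"
  unfolding ucp_map_def
proof (intro conjI allI compression_cp)
  have "\<phi> (star (e i) * e j) = (if i = j then 1 else 0)" if "i < k" "j < k" for i j
    using assms that orthonormalD[OF assms(2), of "e i" "e j"] bij_betwE[OF assms(1)]
    by (auto simp: sip_def bij_betw_def inj_on_def)
  then show "compression \<phi> k e 1 = 1\<^sub>m k" by (auto simp: compression_def)
qed (auto simp: compression_def distrib_left distrib_right add scaleC_mult_left scaleC_mult_right scale)

text \<open>Column j of Q A (1 - Q) B Q consists of the coordinates along \<open>U\<close> of A
  applied to the residual of B e_j. By Bessel its length is at most \<open>norm A\<close> times that
  of the residual, and the normalised trace divides by \<open>k\<close>.\<close>

lemma compression_defect:
  assumes e: "bij_betw e {..<k} U" and U: "orthonormal U" "finite U"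
    and d: "(\<Sum>u\<in>U. (nrm (resid U (B * u)))\<^sup>2) \<le> \<delta> * real k" and k: "0 < k"
  shows "norm_2_tr (compression \<phi> k e (A * B) - compression \<phi> k e A * compression \<phi> k e B) \<le> norm A * sqrt \<delta>"
proof -
  let ?D = "compression \<phi> k e (A * B) - compression \<phi> k e A * compression \<phi> k e B"
  have D: "?D \<in> carrier_mat k k"
    by (auto simp: compression_def intro!: minus_carrier_mat mult_carrier_mat)
  have sumU: "(\<Sum>i<k. g (e i)) = (\<Sum>u\<in>U. g u)" for g :: "'a \<Rightarrow> 'c::comm_monoid_add"
    using e by (rule sum.reindex_bij_betw)
  have entry: "?D $$ (i, j) = sip \<phi> (e i) (A * resid U (B * e j))" if "i < k" "j < k" for i j
  proof -
    have "A * proj U (B * e j) = (\<Sum>l<k. sip \<phi> (e l) (B * e j) *\<^sub>C (A * e l))"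
      unfolding proj_def by (simp add: sumU[symmetric] sum_distrib_left scaleC_mult_right)
    then have "sip \<phi> (e i) (A * proj U (B * e j)) = (\<Sum>l<k. sip \<phi> (e l) (B * e j) * sip \<phi> (e i) (A * e l))"
      by (simp add: ip_sum ip_scale)
    then show ?thesis
      using that by (simp add: compression_def scalar_prod_def resid_def right_diff_distrib ip_diff atLeast0LessThan)
        (simp add: sip_def mult_ac)
  qed
  have "(\<Sum>j<k. \<Sum>i<k. (cmod (?D $$ (i, j)))\<^sup>2) = (\<Sum>j<k. \<Sum>u\<in>U. (cmod (sip \<phi> u (A * resid U (B * e j))))\<^sup>2)"
    by (intro sum.cong refl) (simp add: entry flip: sumU)
  also have "\<dots> \<le> (\<Sum>j<k. (norm A)\<^sup>2 * (nrm (resid U (B * e j)))\<^sup>2)"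
  proof (rule sum_mono)
    fix j
    have "(nrm (A * resid U (B * e j)))\<^sup>2 \<le> (norm A * nrm (resid U (B * e j)))\<^sup>2"
      by (intro power_mono nrm_mult) simp
    with bessel[OF U, of "A * resid U (B * e j)"]
    show "(\<Sum>u\<in>U. (cmod (sip \<phi> u (A * resid U (B * e j))))\<^sup>2) \<le> (norm A)\<^sup>2 * (nrm (resid U (B * e j)))\<^sup>2"
      by (simp add: power_mult_distrib)
  qed
  also have "\<dots> = (norm A)\<^sup>2 * (\<Sum>u\<in>U. (nrm (resid U (B * u)))\<^sup>2)"
    using sumU[of "\<lambda>u. (nrm (resid U (B * u)))\<^sup>2"] by (simp add: sum_distrib_left[symmetric])
  also have "\<dots> \<le> (norm A)\<^sup>2 * (\<delta> * real k)" using d by (intro mult_left_mono) simp_all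
  finally have "(\<Sum>j<k. \<Sum>i<k. (cmod (?D $$ (i, j)))\<^sup>2) \<le> (norm A)\<^sup>2 * \<delta> * real k" by simp
  then have "(\<Sum>j<k. \<Sum>i<k. (cmod (?D $$ (i, j)))\<^sup>2) / real k \<le> (norm A)\<^sup>2 * \<delta>" using k by (simp add: field_simps)
  then have "norm_2_tr ?D \<le> sqrt ((norm A)\<^sup>2 * \<delta>)" unfolding norm_2_tr_eq[OF D] by (rule real_sqrt_le_mono)
  then show ?thesis by (simp add: real_sqrt_mult)
qed

end

text \<open>The net runs over pairs (F, n), ordered by inclusion and size, with a map of defect
  below 1 / (n + 1) on F at each pair.\<close>

lemma foelnerI:
  fixes P :: "'a::pre_cstar_algebra set"
  assumes "\<And>F \<delta>. finite F \<Longrightarrow> \<delta> > 0 \<Longrightarrow> \<exists>k \<phi>. 1 \<le> k \<and> ucp_map P k \<phi> \<and>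
    (\<forall>A\<in>F. \<forall>B\<in>F. norm_2_tr (\<phi> (A * B) - \<phi> A * \<phi> B) < \<delta>)"
  shows "foelner P"
proof -
  define I :: "('a set \<times> nat) set" where "I = {(F, n). finite F}"
  define leq :: "'a set \<times> nat \<Rightarrow> 'a set \<times> nat \<Rightarrow> bool" where "leq i j \<longleftrightarrow> fst i \<subseteq> fst j \<and> snd i \<le> snd j" for i j
  have "\<forall>i\<in>I. \<exists>k \<phi>. 1 \<le> k \<and> ucp_map P k \<phi> \<and>
    (\<forall>A\<in>fst i. \<forall>B\<in>fst i. norm_2_tr (\<phi> (A * B) - \<phi> A * \<phi> B) < 1 / real (Suc (snd i)))"
    using assms by (auto simp: I_def)
  then obtain k \<phi> where k: "\<And>i. i \<in> I \<Longrightarrow> 1 \<le> k i \<and> ucp_map P (k i) (\<phi> i)"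
    and d: "\<And>i A B. i \<in> I \<Longrightarrow> A \<in> fst i \<Longrightarrow> B \<in> fst i \<Longrightarrow>
      norm_2_tr (\<phi> i (A * B) - \<phi> i A * \<phi> i B) < 1 / real (Suc (snd i))"
    by metis
  have "directed_set I leq"
    unfolding directed_set_def
  proof (intro conjI ballI)
    show "I \<noteq> {}" unfolding I_def by blast
    fix i j assume "i \<in> I" "j \<in> I"
    then show "\<exists>k\<in>I. leq i k \<and> leq j k"
      by (intro bexI[of _ "(fst i \<union> fst j, max (snd i) (snd j))"]) (auto simp: I_def leq_def)
  qed (auto simp: leq_def)
  moreover have "net_tendsto I leq (\<lambda>i. norm_2_tr (\<phi> i (A * B) - \<phi> i A * \<phi> i B)) 0" for A B
    unfolding net_tendsto_def
  proof (intro allI impI)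
    fix e :: real assume "e > 0"
    then obtain n where n: "1 / real (Suc n) < e" using nat_approx_posE by auto
    have "norm_2_tr (\<phi> i (A * B) - \<phi> i A * \<phi> i B) < e" if "i \<in> I" "leq ({A, B}, n) i" for i
    proof -
      have "norm_2_tr (\<phi> i (A * B) - \<phi> i A * \<phi> i B) < 1 / real (Suc (snd i))"
        using that by (intro d) (auto simp: leq_def)
      also have "\<dots> \<le> 1 / real (Suc n)" using that by (simp add: leq_def frac_le)
      finally show ?thesis using n by simp
    qed
    moreover have "0 \<le> norm_2_tr (\<phi> i (A * B) - \<phi> i A * \<phi> i B)" if "i \<in> I" for i
    proof -
      have "\<phi> i (A * B) - \<phi> i A * \<phi> i B \<in> carrier_mat (k i) (k i)"
        using k[OF that] unfolding ucp_map_def by (metis minus_carrier_mat mult_carrier_mat)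
      then show ?thesis by (simp add: norm_2_tr_eq sum_nonneg)
    qed
    ultimately have "\<forall>i\<in>I. leq ({A, B}, n) i \<longrightarrow> \<bar>norm_2_tr (\<phi> i (A * B) - \<phi> i A * \<phi> i B) - 0\<bar> < e" by simp
    moreover have "({A, B}, n) \<in> I" by (simp add: I_def)
    ultimately show "\<exists>i0\<in>I. \<forall>i\<in>I. leq i0 i \<longrightarrow> \<bar>norm_2_tr (\<phi> i (A * B) - \<phi> i A * \<phi> i B) - 0\<bar> < e" by blast
  qed
  ultimately show ?thesis unfolding foelner_def using k by blast
qed

section \<open>From algebraic amenability to the Foelner property\<close>

lemma dense_approx:
  assumes "closure B = UNIV" "\<eta> > 0"
  obtains b where "\<And>T::'a::pre_cstar_algebra. b T \<in> B \<and> norm (T - b T) < \<eta>"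
proof -
  have "\<exists>y\<in>B. norm (T - y) < \<eta>" for T
    using assms closure_approachable[of T B] by (auto simp: dist_norm norm_minus_commute)
  then show thesis using that by metis
qed

theorem foelner_if_amenable:
  fixes B P :: "'a::pre_cstar_algebra set"
  assumes "closure B = UNIV" "separating_states P" "algebraically_amenable B"
  shows "foelner P"
proof (rule foelnerI)
  fix F :: "'a set" and \<delta> :: real assume F: "finite F" and \<delta>: "\<delta> > 0"
  define K where "K = (\<Sum>A\<in>F. norm A) + 1"
  have nK: "norm A \<le> K" if "A \<in> F" for A
    using member_le_sum[of A F norm] that F by (simp add: K_def)
  have K: "K > 0" by (simp add: K_def add_nonneg_pos sum_nonneg)
  \<comment> \<open>The defect will be at most K times the root of \<theta>, that is \<delta>/2. The
    two contributions to \<theta> = 2 (\<epsilon> M + \<eta>^2) are made equal: \<eta>^2 and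
    \<epsilon> M are both \<theta>/4.\<close>
  define \<theta> where "\<theta> = (\<delta> / (2 * K))\<^sup>2"
  have \<theta>: "\<theta> > 0" using \<delta> K by (simp add: \<theta>_def)
  define \<eta> where "\<eta> = sqrt \<theta> / 2"
  have \<eta>: "\<eta> > 0" "\<eta>\<^sup>2 = \<theta> / 4" using \<theta> by (simp_all add: \<eta>_def power_divide)
  obtain b where b: "\<And>T::'a. b T \<in> B \<and> norm (T - b T) < \<eta>" using dense_approx[OF assms(1) \<eta>(1)] by blast
  \<comment> \<open>\<open>M\<close> depends on the approximants, so \<epsilon> can only be fixed
    now; the summand 1 keeps it positive for empty \<open>F\<close>.\<close>
  define M where "M = (\<Sum>T\<in>F. (norm (b T))\<^sup>2) + 1"
  have nM: "(norm (b T))\<^sup>2 \<le> M" if "T \<in> F" for T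
    using member_le_sum[of T F "\<lambda>T. (norm (b T))\<^sup>2"] that F by (simp add: M_def)
  have M: "M > 0" by (simp add: M_def add_nonneg_pos sum_nonneg)
  define \<epsilon> where "\<epsilon> = \<theta> / (4 * M)"
  have \<epsilon>: "\<epsilon> > 0" "\<epsilon> * M = \<theta> / 4" using \<theta> M by (simp_all add: \<epsilon>_def)
  have "finite (b ` F)" "b ` F \<subseteq> B" using F b by auto
  then obtain W where W: "foelner_subspace B (b ` F) \<epsilon> W"
    using assms(3) \<epsilon> unfolding algebraically_amenable_def by blast
  obtain \<phi> where "state_on P \<phi>" using faithful_state[OF assms(2), of "{}"] by auto
  from foelner_subspace_state[OF W F assms(2) this _ nM, of \<eta>]
  obtain \<omega> :: "'a \<Rightarrow> complex" and U :: "'a set" where \<omega>: "state_on P \<omega>"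
    and U: "semi_inner.orthonormal UNIV (sip \<omega>) U" "finite U" "U \<noteq> {}"
    and d: "\<forall>T\<in>F. (\<Sum>u\<in>U. (hnorm (sip \<omega>) (semi_inner.resid (sip \<omega>) U (T * u)))\<^sup>2)
      \<le> 2 * (\<epsilon> * M + \<eta>\<^sup>2) * real (card U)"
    using b \<epsilon>(1) by (auto intro: less_imp_le)
  interpret state P \<omega> by unfold_locales fact
  obtain e where e: "bij_betw e {..<card U} U" using ex_bij_betw_nat_finite[OF U(2)] by (auto simp: atLeast0LessThan)
  have "norm_2_tr (compression \<omega> (card U) e (A * C) - compression \<omega> (card U) e A * compression \<omega> (card U) e C) < \<delta>"
    if "A \<in> F" "C \<in> F" for A C
  proof -
    have "(\<Sum>u\<in>U. (nrm (resid U (C * u)))\<^sup>2) \<le> \<theta> * real (card U)" using bspec[OF d that(2)] by (simp add: \<epsilon> \<eta>)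
    then have "norm_2_tr (compression \<omega> (card U) e (A * C) - compression \<omega> (card U) e A * compression \<omega> (card U) e C)
        \<le> norm A * sqrt \<theta>" by (rule compression_defect[OF e U(1,2)]) (use U in \<open>simp add: card_gt_0_iff\<close>)
    also have "\<dots> \<le> K * sqrt \<theta>" using nK[OF that(1)] \<theta> by (intro mult_right_mono) simp_all
    also have "\<dots> < \<delta>" using K \<delta> by (simp add: \<theta>_def)
    finally show ?thesis .
  qed
  moreover have "1 \<le> card U" using U by (simp add: Suc_le_eq card_gt_0_iff)
  ultimately show "\<exists>k \<phi>. 1 \<le> k \<and> ucp_map P k \<phi> \<and> (\<forall>A\<in>F. \<forall>B\<in>F. norm_2_tr (\<phi> (A * B) - \<phi> A * \<phi> B) < \<delta>)"
    using compression_ucp[OF e U(1)] by blast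
qed


section \<open>Completion of a pre-Hilbert space\<close>

lemma complex_nonneg_LIMSEQ:
  assumes "z \<longlonglongrightarrow> (l::complex)" "\<And>n. 0 \<le> z n"
  shows "0 \<le> l"
proof -
  have "0 \<le> Re l" using tendsto_Re[OF assms(1)] assms(2) by (intro LIMSEQ_le_const) (auto simp: less_eq_complex_def)
  moreover have "(\<lambda>n. Im (z n)) \<longlonglongrightarrow> Im l" by (rule tendsto_Im[OF assms(1)])
  then have "Im l = 0" using assms(2) by (simp add: less_eq_complex_def LIMSEQ_const_iff)
  ultimately show ?thesis by (simp add: less_eq_complex_def)
qed

text \<open>The completion is realised inside \<open>'v \<Rightarrow> complex\<close>: the limit of a Cauchy sequence \<open>X\<close> is the
  antilinear functional \<open>a \<mapsto> lim \<langle>a, X\<^sub>n\<rangle>\<close>.\<close>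

locale pre_hilbert = semi_inner UNIV s for s :: "'v::complex_vector \<Rightarrow> 'v \<Rightarrow> complex"
begin

definition cauchy :: "(nat \<Rightarrow> 'v) \<Rightarrow> bool"
  where "cauchy X \<longleftrightarrow> (\<forall>e>0. \<exists>N. \<forall>m\<ge>N. \<forall>n\<ge>N. nrm (X m - X n) < e)"

definition represents :: "(nat \<Rightarrow> 'v) \<Rightarrow> ('v \<Rightarrow> complex) \<Rightarrow> bool"
  where "represents X f \<longleftrightarrow> cauchy X \<and> (\<forall>a. (\<lambda>n. s a (X n)) \<longlonglongrightarrow> f a)"

definition compl :: "('v \<Rightarrow> complex) set"
  where "compl = {f. \<exists>X. represents X f}"

text \<open>\<open>cip_LIMSEQ\<close> shows that the representing sequences chosen here do not
  matter.\<close>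

definition cip :: "('v \<Rightarrow> complex) \<Rightarrow> ('v \<Rightarrow> complex) \<Rightarrow> complex"
  where "cip f g = lim (\<lambda>n. s ((SOME X. represents X f) n) ((SOME X. represents X g) n))"

text \<open>By Cauchy--Schwarz null vectors go to the zero functional, so the quotient by the null
  space is taken implicitly.\<close>

definition embed :: "'v \<Rightarrow> 'v \<Rightarrow> complex"
  where "embed x = (\<lambda>a. s a x)"

lemma cauchyD: "cauchy X \<Longrightarrow> e > 0 \<Longrightarrow> \<exists>N. \<forall>m\<ge>N. \<forall>n\<ge>N. nrm (X m - X n) < e"
  by (simp add: cauchy_def)

lemma cauchy_const: "cauchy (\<lambda>_. x)"
  by (simp add: cauchy_def hnorm_def)

lemma cauchy_add:
  assumes "cauchy X" "cauchy Y"
  shows "cauchy (\<lambda>n. X n + Y n)"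
  unfolding cauchy_def
proof (intro allI impI)
  fix e :: real assume "e > 0"
  then have e: "e / 2 > 0" by simp
  obtain N M where N: "\<forall>m\<ge>N. \<forall>n\<ge>N. nrm (X m - X n) < e/2" and M: "\<forall>m\<ge>M. \<forall>n\<ge>M. nrm (Y m - Y n) < e/2"
    using cauchyD[OF assms(1) e] cauchyD[OF assms(2) e] by blast
  have "nrm (X m + Y m - (X n + Y n)) < e" if "m \<ge> max N M" "n \<ge> max N M" for m n
  proof -
    have "nrm (X m - X n) < e/2" "nrm (Y m - Y n) < e/2" using N M that by simp_all
    then show ?thesis using nrm_triangle[of "X m - X n" "Y m - Y n"] by (simp add: algebra_simps)
  qed
  then show "\<exists>N. \<forall>m\<ge>N. \<forall>n\<ge>N. nrm (X m + Y m - (X n + Y n)) < e" by blast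
qed

lemma cauchy_image:
  assumes "cauchy X" "\<And>x y. nrm (T x - T y) \<le> K * nrm (x - y)"
  shows "cauchy (\<lambda>n. T (X n))"
  unfolding cauchy_def
proof (intro allI impI)
  fix e :: real assume "e > 0"
  \<comment> \<open>\<open>K\<close> may be zero or negative; its absolute value plus 1 is a safe
    divisor.\<close>
  then have "e / (\<bar>K\<bar> + 1) > 0" by (simp add: add_nonneg_pos)
  then obtain N where N: "\<forall>m\<ge>N. \<forall>n\<ge>N. nrm (X m - X n) < e / (\<bar>K\<bar> + 1)" using cauchyD[OF assms(1)] by blast
  have "nrm (T (X m) - T (X n)) < e" if "m \<ge> N" "n \<ge> N" for m n
  proof -
    have "nrm (T (X m) - T (X n)) \<le> K * nrm (X m - X n)" by (rule assms(2))
    also have "\<dots> \<le> (\<bar>K\<bar> + 1) * nrm (X m - X n)" by (intro mult_right_mono) simp_all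
    also have "\<dots> < (\<bar>K\<bar> + 1) * (e / (\<bar>K\<bar> + 1))" using N that by (intro mult_strict_left_mono) (simp_all add: add_nonneg_pos)
    also have "\<dots> = e" using abs_ge_zero[of K] by (simp add: field_simps)
    finally show ?thesis .
  qed
  then show "\<exists>N. \<forall>m\<ge>N. \<forall>n\<ge>N. nrm (T (X m) - T (X n)) < e" by blast
qed

lemma cauchy_scale: "cauchy X \<Longrightarrow> cauchy (\<lambda>n. c *\<^sub>C X n)"
  by (rule cauchy_image[where K = "cmod c"]) (simp_all add: nrm_scale flip: complex_vector.scale_right_diff_distrib)

lemma cauchy_bounded:
  assumes "cauchy X"
  obtains K where "K > 0" "\<And>n. nrm (X n) \<le> K"
proof -
  obtain N where N: "\<forall>m\<ge>N. \<forall>n\<ge>N. nrm (X m - X n) < 1" using cauchyD[OF assms, of 1] by auto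
  define K where "K = 1 + nrm (X N) + (\<Sum>n<N. nrm (X n))"
  have p: "0 \<le> (\<Sum>n<N. nrm (X n))" "0 \<le> nrm (X N)" by (simp_all add: sum_nonneg)
  have "nrm (X n) \<le> K" for n
  proof (cases "n < N")
    case True
    then have "nrm (X n) \<le> (\<Sum>n<N. nrm (X n))" by (intro member_le_sum) simp_all
    then show ?thesis unfolding K_def using p by linarith
  next
    case False
    then have "nrm (X n - X N) < 1" using N by simp
    then show ?thesis unfolding K_def using nrm_triangle[of "X n - X N" "X N"] p by simp
  qed
  moreover have "K > 0" unfolding K_def using p by linarith
  ultimately show thesis by (rule that[rotated])
qed

lemma cauchy_ip_convergent:
  assumes "cauchy X" "cauchy Y"
  shows "convergent (\<lambda>n. s (X n) (Y n))"
proof -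
  obtain K where K: "K > 0" "\<And>n. nrm (X n) \<le> K" using cauchy_bounded[OF assms(1)] by blast
  obtain L where L: "L > 0" "\<And>n. nrm (Y n) \<le> L" using cauchy_bounded[OF assms(2)] by blast
  have "Cauchy (\<lambda>n. s (X n) (Y n))"
  proof (rule metric_CauchyI)
    fix e :: real assume "e > 0"
    then have "e / (2 * L) > 0" "e / (2 * K) > 0" using K L by simp_all
    then obtain N M where N: "\<forall>m\<ge>N. \<forall>n\<ge>N. nrm (X m - X n) < e / (2 * L)"
      and M: "\<forall>m\<ge>M. \<forall>n\<ge>M. nrm (Y m - Y n) < e / (2 * K)"
      using cauchyD[OF assms(1)] cauchyD[OF assms(2)] by blast
    have "dist (s (X m) (Y m)) (s (X n) (Y n)) < e" if "m \<ge> max N M" "n \<ge> max N M" for m n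
    proof -
      have XN: "nrm (X m - X n) < e / (2 * L)" and YN: "nrm (Y m - Y n) < e / (2 * K)" using N M that by simp_all
      have "s (X m) (Y m) - s (X n) (Y n) = s (X m - X n) (Y m) + s (X n) (Y m - Y n)"
        by (simp add: ip_diff ip_diff_left)
      then have "dist (s (X m) (Y m)) (s (X n) (Y n)) \<le> cmod (s (X m - X n) (Y m)) + cmod (s (X n) (Y m - Y n))"
        by (simp add: dist_norm norm_triangle_ineq)
      also have "\<dots> \<le> nrm (X m - X n) * nrm (Y m) + nrm (X n) * nrm (Y m - Y n)"
        by (intro add_mono cauchy_schwarz) simp_all
      also have "\<dots> \<le> nrm (X m - X n) * L + K * nrm (Y m - Y n)"
        using K L by (intro add_mono mult_mono) (auto intro: less_imp_le)
      also have "\<dots> < e / (2 * L) * L + K * (e / (2 * K))"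
        using XN YN K L by (intro add_strict_mono mult_strict_right_mono mult_strict_left_mono)
      also have "\<dots> = e" using K L by simp
      finally show ?thesis .
    qed
    then show "\<exists>M. \<forall>m\<ge>M. \<forall>n\<ge>M. dist (s (X m) (Y m)) (s (X n) (Y n)) < e" by blast
  qed
  then show ?thesis by (rule Cauchy_convergent)
qed

lemma cauchy_represents:
  assumes "cauchy X"
  obtains f where "represents X f"
proof (rule that)
  show "represents X (\<lambda>a. lim (\<lambda>n. s a (X n)))"
    using assms cauchy_ip_convergent[OF cauchy_const assms] by (simp add: represents_def convergent_LIMSEQ_iff)
qed

text \<open>For a Cauchy sequence \<open>X\<close> the convergence of \<open>s a (X n)\<close> to
  \<open>f a\<close> is uniform over bounded sets of \<open>a\<close>, hence holds along the
  diagonal with \<open>a = Y n\<close>, Cauchy sequences being bounded.\<close>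

lemma represents_near:
  assumes "represents X f" "cauchy Y"
  shows "(\<lambda>n. s (Y n) (X n) - f (Y n)) \<longlonglongrightarrow> 0"
proof (rule LIMSEQ_I)
  fix e :: real assume "e > 0"
  obtain K where K: "K > 0" "\<And>n. nrm (Y n) \<le> K" using cauchy_bounded[OF assms(2)] by blast
  have X: "cauchy X" "\<And>a. (\<lambda>n. s a (X n)) \<longlonglongrightarrow> f a" using assms by (auto simp: represents_def)
  have "e / (2 * K) > 0" using K \<open>e > 0\<close> by simp
  then obtain N where N: "\<forall>m\<ge>N. \<forall>n\<ge>N. nrm (X m - X n) < e / (2 * K)" using cauchyD[OF X(1)] by blast
  have "norm (s (Y n) (X n) - f (Y n) - 0) < e" if "n \<ge> N" for n
  proof -
    have "(\<lambda>m. s (Y n) (X n) - s (Y n) (X m)) \<longlonglongrightarrow> s (Y n) (X n) - f (Y n)" by (intro tendsto_intros X)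
    then have "(\<lambda>m. cmod (s (Y n) (X n) - s (Y n) (X m))) \<longlonglongrightarrow> cmod (s (Y n) (X n) - f (Y n))" by (rule tendsto_norm)
    moreover have "cmod (s (Y n) (X n) - s (Y n) (X m)) \<le> e / 2" if "m \<ge> N" for m
    proof -
      have "cmod (s (Y n) (X n) - s (Y n) (X m)) \<le> nrm (Y n) * nrm (X n - X m)"
        using cauchy_schwarz[of "Y n" "X n - X m"] by (simp add: ip_diff)
      also have "\<dots> \<le> K * (e / (2 * K))" using K N that \<open>n \<ge> N\<close> by (intro mult_mono) (auto intro: less_imp_le)
      finally show ?thesis using K by simp
    qed
    ultimately have "cmod (s (Y n) (X n) - f (Y n)) \<le> e / 2" by (intro LIMSEQ_le_const2) auto
    then show ?thesis using \<open>e > 0\<close> by simp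
  qed
  then show "\<exists>N. \<forall>n\<ge>N. norm (s (Y n) (X n) - f (Y n) - 0) < e" by blast
qed

lemma represents_swap:
  assumes "represents X f" "represents X' f" "cauchy Y"
  shows "(\<lambda>n. s (Y n) (X n) - s (Y n) (X' n)) \<longlonglongrightarrow> 0"
  using tendsto_diff[OF represents_near[OF assms(1,3)] represents_near[OF assms(2,3)]] by simp

text \<open>The chosen representatives are exchanged for \<open>X\<close> and \<open>Y\<close> one
  at a time; each exchange costs a null sequence by \<open>represents_swap\<close>.\<close>

lemma cip_LIMSEQ:
  assumes "represents X f" "represents Y g"
  shows "(\<lambda>n. s (X n) (Y n)) \<longlonglongrightarrow> cip f g"
proof -
  define X' Y' where "X' = (SOME X. represents X f)" and "Y' = (SOME X. represents X g)"
  have X': "represents X' f" and Y': "represents Y' g"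
    unfolding X'_def Y'_def using assms by (simp_all add: someI[of "\<lambda>X. represents X _"])
  have "(\<lambda>n. s (X' n) (Y' n)) \<longlonglongrightarrow> cip f g"
    unfolding cip_def X'_def[symmetric] Y'_def[symmetric]
    using X' Y' cauchy_ip_convergent by (simp add: represents_def convergent_LIMSEQ_iff)
  moreover have "(\<lambda>n. s (X' n) (Y n) - s (X' n) (Y' n)) \<longlonglongrightarrow> 0"
    using represents_swap[OF assms(2) Y'] X' by (simp add: represents_def)
  moreover have "(\<lambda>n. cnj (s (Y n) (X n) - s (Y n) (X' n))) \<longlonglongrightarrow> cnj 0"
    by (intro tendsto_cnj represents_swap[OF assms(1) X']) (use assms in \<open>simp add: represents_def\<close>)
  then have "(\<lambda>n. s (X n) (Y n) - s (X' n) (Y n)) \<longlonglongrightarrow> 0"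
    by (simp flip: ip_cnj)
  ultimately have "(\<lambda>n. (s (X n) (Y n) - s (X' n) (Y n)) + ((s (X' n) (Y n) - s (X' n) (Y' n)) + s (X' n) (Y' n)))
      \<longlonglongrightarrow> 0 + (0 + cip f g)" by (intro tendsto_add)
  then show ?thesis by simp
qed

lemma represents_add: "represents X f \<Longrightarrow> represents Y g \<Longrightarrow> represents (\<lambda>n. X n + Y n) (f + g)"
  by (auto simp: represents_def ip_add intro!: cauchy_add tendsto_add)

lemma represents_scale: "represents X f \<Longrightarrow> represents (\<lambda>n. c *\<^sub>C X n) (c *\<^sub>C f)"
  by (auto simp: represents_def ip_scale scaleC_fun_def scaleC_complex_def intro!: cauchy_scale tendsto_mult)

lemma represents_diff: "represents X f \<Longrightarrow> represents Y g \<Longrightarrow> represents (\<lambda>n. X n - Y n) (f - g)"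
  using represents_add[of X f "\<lambda>n. (- 1) *\<^sub>C Y n" "(- 1) *\<^sub>C g"] represents_scale[of Y g "- 1"] by simp

lemma represents_embed: "represents (\<lambda>_. x) (embed x)"
  by (simp add: represents_def embed_def cauchy_const)

lemma complE:
  assumes "f \<in> compl"
  obtains X where "represents X f"
  using assms by (auto simp: compl_def)

lemma complI: "represents X f \<Longrightarrow> f \<in> compl"
  by (auto simp: compl_def)

lemma embed_compl [simp]: "embed x \<in> compl"
  by (rule complI[OF represents_embed])

sublocale C: semi_inner compl cip
proof
  have "represents (\<lambda>_. 0) 0" by (simp add: represents_def cauchy_const)
  then show "csubspace compl"
    by (auto simp: complex_vector.subspace_def intro: complI dest: represents_add represents_scale elim!: complE)
  show "cip f (g + h) = cip f g + cip f h" if "f \<in> compl" "g \<in> compl" "h \<in> compl" for f g h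
  proof -
    from that obtain X Y Z where r: "represents X f" "represents Y g" "represents Z h" unfolding compl_def by blast
    have "(\<lambda>n. s (X n) (Y n + Z n)) \<longlonglongrightarrow> cip f (g + h)" by (intro cip_LIMSEQ represents_add r)
    moreover have "(\<lambda>n. s (X n) (Y n) + s (X n) (Z n)) \<longlonglongrightarrow> cip f g + cip f h" by (intro tendsto_add cip_LIMSEQ r)
    ultimately show ?thesis by (simp add: ip_add LIMSEQ_unique)
  qed
  show "cip f (c *\<^sub>C g) = c * cip f g" if "f \<in> compl" "g \<in> compl" for f g c
  proof -
    from that obtain X Y where r: "represents X f" "represents Y g" unfolding compl_def by blast
    have "(\<lambda>n. s (X n) (c *\<^sub>C Y n)) \<longlonglongrightarrow> cip f (c *\<^sub>C g)" by (intro cip_LIMSEQ represents_scale r)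
    moreover have "(\<lambda>n. c * s (X n) (Y n)) \<longlonglongrightarrow> c * cip f g" by (intro tendsto_mult tendsto_const cip_LIMSEQ r)
    ultimately show ?thesis by (simp add: ip_scale LIMSEQ_unique)
  qed
  show "cip g f = cnj (cip f g)" if "f \<in> compl" "g \<in> compl" for f g
  proof -
    from that obtain X Y where r: "represents X f" "represents Y g" unfolding compl_def by blast
    have "(\<lambda>n. s (Y n) (X n)) \<longlonglongrightarrow> cip g f" by (intro cip_LIMSEQ r)
    moreover have "(\<lambda>n. cnj (s (X n) (Y n))) \<longlonglongrightarrow> cnj (cip f g)" by (intro tendsto_cnj cip_LIMSEQ r)
    ultimately show ?thesis by (simp add: LIMSEQ_unique flip: ip_cnj)
  qed
  show "0 \<le> cip f f" if "f \<in> compl" for f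
  proof -
    from that obtain X where r: "represents X f" unfolding compl_def by blast
    show ?thesis by (rule complex_nonneg_LIMSEQ[OF cip_LIMSEQ[OF r r]]) (simp add: ip_nonneg)
  qed
qed

lemma cip_embed: "cip (embed x) (embed y) = s x y"
  using cip_LIMSEQ[OF represents_embed represents_embed] by (simp add: LIMSEQ_const_iff)

text \<open>A reproducing property: values of a functional are inner products with embedded vectors.
  Definiteness of the completion rests on it.\<close>

lemma cip_embed_left: "f \<in> compl \<Longrightarrow> cip (embed a) f = f a"
proof -
  assume "f \<in> compl"
  then obtain X where r: "represents X f" by (rule complE)
  have "(\<lambda>n. s a (X n)) \<longlonglongrightarrow> cip (embed a) f" by (rule cip_LIMSEQ[OF represents_embed r])
  moreover have "(\<lambda>n. s a (X n)) \<longlonglongrightarrow> f a" using r by (simp add: represents_def)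
  ultimately show ?thesis by (rule LIMSEQ_unique)
qed

lemma nrm_embed: "C.nrm (embed x) = nrm x"
  by (simp add: hnorm_def cip_embed)

lemma embed_add: "embed (x + y) = embed x + embed y"
  by (simp add: embed_def fun_eq_iff ip_add)

lemma embed_diff: "embed (x - y) = embed x - embed y"
  by (simp add: embed_def fun_eq_iff ip_diff)

lemma embed_scale: "embed (c *\<^sub>C x) = c *\<^sub>C embed x"
  by (simp add: embed_def fun_eq_iff ip_scale scaleC_fun_def scaleC_complex_def)

lemma embed_0: "embed 0 = 0"
  by (simp add: embed_def fun_eq_iff)

lemma embed_sum: "embed (\<Sum>i\<in>I. f i) = (\<Sum>i\<in>I. embed (f i))"
  by (induction I rule: infinite_finite_induct) (simp_all add: embed_add embed_0)

lemma nrm_LIMSEQ: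
  assumes "represents X f"
  shows "(\<lambda>n. nrm (X n)) \<longlonglongrightarrow> C.nrm f"
  unfolding hnorm_def by (intro tendsto_real_sqrt tendsto_Re cip_LIMSEQ assms)

lemma represents_LIMSEQ:
  assumes "represents X f"
  shows "(\<lambda>n. C.nrm (f - embed (X n))) \<longlonglongrightarrow> 0"
proof (rule LIMSEQ_I)
  fix e :: real assume "e > 0"
  have "cauchy X" using assms by (simp add: represents_def)
  then obtain N where N: "\<forall>m\<ge>N. \<forall>n\<ge>N. nrm (X m - X n) < e/2" using cauchyD[of X "e/2"] \<open>e > 0\<close> by auto
  have "norm (C.nrm (f - embed (X n)) - 0) < e" if "n \<ge> N" for n
  proof -
    have "(\<lambda>m. nrm (X m - X n)) \<longlonglongrightarrow> C.nrm (f - embed (X n))"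
      by (intro nrm_LIMSEQ represents_diff assms represents_embed)
    then have "C.nrm (f - embed (X n)) \<le> e/2"
      by (rule LIMSEQ_le_const2) (use N that in \<open>auto intro!: exI[of _ N] less_imp_le\<close>)
    moreover have "0 \<le> C.nrm (f - embed (X n))" by (simp add: complI[OF assms])
    ultimately show ?thesis using \<open>e > 0\<close> by simp
  qed
  then show "\<exists>N. \<forall>n\<ge>N. norm (C.nrm (f - embed (X n)) - 0) < e" by blast
qed

lemma embed_dense:
  assumes "f \<in> compl" "e > 0"
  shows "\<exists>x. C.nrm (f - embed x) < e"
proof -
  obtain X where "represents X f" using complE[OF assms(1)] .
  from LIMSEQ_D[OF represents_LIMSEQ[OF this] assms(2)]
  obtain N where "norm (C.nrm (f - embed (X N)) - 0) < e" by blast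
  then have "C.nrm (f - embed (X N)) < e" by simp
  then show ?thesis ..
qed

text \<open>For completeness, each F n is replaced by an embedded vector within 1 / (n + 1). These
  vectors form a Cauchy sequence downstairs, and the functional it represents is the limit.\<close>

lemma hilbert_space_compl: "hilbert_space compl cip"
  unfolding hilbert_space_def
proof (intro conjI ballI allI impI)
  show "csubspace compl" by (rule C.subspace)
  show "f = 0" if "f \<in> compl" "cip f f = 0" for f
  proof
    fix a
    have "cmod (f a) \<le> C.nrm (embed a) * C.nrm f"
      using C.cauchy_schwarz[of "embed a" f] that by (simp add: cip_embed_left)
    then show "f a = 0 a" using that by (simp add: hnorm_def)
  qed
  fix F :: "nat \<Rightarrow> 'v \<Rightarrow> complex"
  assume F: "(\<forall>n. F n \<in> compl) \<and> (\<forall>e>0. \<exists>N. \<forall>m\<ge>N. \<forall>n\<ge>N. C.nrm (F m - F n) < e)"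
  then have "\<exists>x. C.nrm (F n - embed x) < 1 / real (Suc n)" for n by (intro embed_dense) simp_all
  then obtain x where x: "\<And>n. C.nrm (F n - embed (x n)) < 1 / real (Suc n)" by metis
  have x': "C.nrm (embed (x n) - F n) < 1 / real (Suc n)" for n
    using x[of n] F C.nrm_minus[of "F n" "embed (x n)"] by simp
  have "cauchy x"
    unfolding cauchy_def
  proof (intro allI impI)
    fix e :: real assume "e > 0"
    then obtain N where N: "\<forall>m\<ge>N. \<forall>n\<ge>N. C.nrm (F m - F n) < e/3" using F by (meson zero_less_divide_iff zero_less_numeral)
    obtain K where K: "1 / real (Suc K) < e/3" using \<open>e > 0\<close> nat_approx_posE[of "e/3"] by auto
    have "nrm (x m - x n) < e" if "m \<ge> max N K" "n \<ge> max N K" for m n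
    proof -
      have inv: "1 / real (Suc m) \<le> 1 / real (Suc K)" "1 / real (Suc n) \<le> 1 / real (Suc K)"
        using that by (simp_all add: frac_le)
      have "nrm (x m - x n) = C.nrm (embed (x m) - embed (x n))" by (simp add: nrm_embed flip: embed_diff)
      also have "\<dots> \<le> C.nrm (embed (x m) - F m) + C.nrm (F m - embed (x n))"
        using F by (intro C.nrm_triangle_diff) simp_all
      also have "C.nrm (F m - embed (x n)) \<le> C.nrm (F m - F n) + C.nrm (F n - embed (x n))"
        using F by (intro C.nrm_triangle_diff) simp_all
      also have "C.nrm (F m - F n) < e/3" using N that by simp
      finally show ?thesis using x'[of m] x[of n] inv K by linarith
    qed
    then show "\<exists>N. \<forall>m\<ge>N. \<forall>n\<ge>N. nrm (x m - x n) < e" by blast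
  qed
  then obtain f where f: "represents x f" using cauchy_represents by blast
  have fc: "f \<in> compl" by (rule complI[OF f])
  have "(\<lambda>n. C.nrm (F n - f)) \<longlonglongrightarrow> 0"
  proof (rule tendsto_sandwich[of "\<lambda>_. 0" _ _ "\<lambda>n. 1 / real (Suc n) + C.nrm (f - embed (x n))"])
    have "C.nrm (F n - f) \<le> 1 / real (Suc n) + C.nrm (f - embed (x n))" for n
      using C.nrm_triangle_diff[of "F n" "embed (x n)" f] x[of n] C.nrm_minus[of "embed (x n)" f] F fc by simp
    then show "\<forall>\<^sub>F n in sequentially. C.nrm (F n - f) \<le> 1 / real (Suc n) + C.nrm (f - embed (x n))" by simp
    have "(\<lambda>n. 1 / real (Suc n)) \<longlonglongrightarrow> 0" using LIMSEQ_inverse_real_of_nat by (simp add: inverse_eq_divide)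
    from tendsto_add[OF this represents_LIMSEQ[OF f]]
    show "(\<lambda>n. 1 / real (Suc n) + C.nrm (f - embed (x n))) \<longlonglongrightarrow> 0" by simp
    show "\<forall>\<^sub>F n in sequentially. 0 \<le> C.nrm (F n - f)" using F fc by simp
  qed simp
  with fc show "\<exists>f\<in>compl. (\<lambda>n. C.nrm (F n - f)) \<longlonglongrightarrow> 0" by blast
qed (fact C.ip_add C.ip_scale C.ip_cnj C.ip_nonneg)+

end


section \<open>Orthonormal bases and the Hilbert--Schmidt norm\<close>

context semi_inner
begin

lemma proj_self_adjoint:
  assumes "orthonormal E" "finite E" "x \<in> H" "y \<in> H"
  shows "ip (proj E x) y = ip x (proj E y)"
proof -
  have "ip (proj E x) y = (\<Sum>e\<in>E. cnj (ip e x) * ip e y)"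
    unfolding proj_def using assms by (simp add: ip_sum_left ip_scale_left orthonormal_H)
  also have "\<dots> = (\<Sum>e\<in>E. ip x e * ip e y)"
    using assms by (intro sum.cong refl) (simp add: ip_cnj[of x] orthonormal_H)
  also have "\<dots> = ip x (proj E y)"
    unfolding proj_def using assms by (simp add: ip_sum ip_scale orthonormal_H mult.commute)
  finally show ?thesis .
qed

lemma resid_self_adjoint:
  assumes "orthonormal E" "finite E" "x \<in> H" "y \<in> H"
  shows "ip (resid E x) y = ip x (resid E y)"
  using assms by (simp add: resid_def ip_diff ip_diff_left proj_self_adjoint)

lemma orthogonal_projection_proj:
  assumes "orthonormal E" "finite E"
  shows "orthogonal_projection H ip (proj E)"
  unfolding orthogonal_projection_def bounded_operator_def
proof (intro conjI ballI allI)
  show "\<exists>K. \<forall>x\<in>H. nrm (proj E x) \<le> K * nrm x"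
    using nrm_proj_le[OF assms] by (intro exI[of _ 1]) simp
qed (use assms in \<open>simp_all add: proj_add proj_scale proj_eq proj_span proj_self_adjoint\<close>)

lemma maximal_orthonormal_exists:
  obtains M where "orthonormal M" "\<And>E. orthonormal E \<Longrightarrow> M \<subseteq> E \<Longrightarrow> E = M"
proof -
  have "\<exists>M\<in>Collect orthonormal. \<forall>E\<in>Collect orthonormal. M \<subseteq> E \<longrightarrow> E = M"
  proof (rule subset_Zorn')
    fix C assume "subset.chain (Collect orthonormal) C"
    then have C: "\<And>E. E \<in> C \<Longrightarrow> orthonormal E" "\<And>E F. E \<in> C \<Longrightarrow> F \<in> C \<Longrightarrow> E \<subseteq> F \<or> F \<subseteq> E"
      unfolding subset.chain_def by blast+
    have "ip e f = (if e = f then 1 else 0)" if "e \<in> E" "f \<in> F" "E \<in> C" "F \<in> C" for e f E F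
      using C(2)[OF that(3,4)]
    proof
      assume "E \<subseteq> F"
      then show ?thesis using that by (intro orthonormalD[OF C(1)[of F]]) auto
    next
      assume "F \<subseteq> E"
      then show ?thesis using that by (intro orthonormalD[OF C(1)[of E]]) auto
    qed
    moreover have "\<Union>C \<subseteq> H" using C(1) unfolding orthonormal_def by blast
    ultimately show "\<Union>C \<in> Collect orthonormal" unfolding orthonormal_def by blast
  qed
  then show thesis using that by blast
qed

lemma parallelogram:
  assumes "x \<in> H" "y \<in> H"
  shows "(nrm (x - y))\<^sup>2 + (nrm (x + y))\<^sup>2 = 2 * (nrm x)\<^sup>2 + 2 * (nrm y)\<^sup>2"
  using assms by (simp add: nrm_sq_add nrm_sq_diff)

end

locale hilbert = semi_inner H ip for H :: "'h::complex_vector set" and ip +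
  assumes definite: "\<And>x. x \<in> H \<Longrightarrow> ip x x = 0 \<Longrightarrow> x = 0"
    and complete: "\<And>X. (\<And>n. X n \<in> H) \<Longrightarrow> (\<And>e. e > 0 \<Longrightarrow> \<exists>N. \<forall>m\<ge>N. \<forall>n\<ge>N. nrm (X m - X n) < e)
      \<Longrightarrow> \<exists>x\<in>H. (\<lambda>n. nrm (X n - x)) \<longlonglongrightarrow> 0"
begin

text \<open>\<open>Y\<close> need not be closed, so \<open>y\<close> is found in \<open>H\<close> as
  a limit of a minimising sequence from \<open>Y\<close>, and membership in the closure is expressed
  by approximation.\<close>

lemma closest_point_exists:
  assumes Y: "csubspace Y" "Y \<subseteq> H" and x: "x \<in> H"
  obtains y where "y \<in> H" "\<And>e. e > 0 \<Longrightarrow> \<exists>z\<in>Y. nrm (y - z) < e" "\<And>z. z \<in> Y \<Longrightarrow> ip z (x - y) = 0"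
proof -
  define d where "d = (INF z\<in>Y. nrm (x - z))"
  have Y0: "0 \<in> Y" using Y by (simp add: complex_vector.subspace_0)
  have bdd: "bdd_below ((\<lambda>z. nrm (x - z)) ` Y)"
    using Y x by (intro bdd_belowI[of _ 0]) auto
  have le: "d \<le> nrm (x - z)" if "z \<in> Y" for z unfolding d_def using bdd that by (rule cINF_lower)
  have d0: "d \<ge> 0" unfolding d_def using Y0 Y x by (intro cINF_greatest) auto
  have "\<exists>z\<in>Y. nrm (x - z) < d + 1 / real (Suc n)" for n
    using cINF_less_iff[OF _ bdd, of "d + 1 / real (Suc n)"] Y0 unfolding d_def by auto
  then obtain Z where Z: "\<And>n. Z n \<in> Y" "\<And>n. nrm (x - Z n) < d + 1 / real (Suc n)" by metis
  have ZH: "Z n \<in> H" for n using Z Y by blast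
  \<comment> \<open>Bounds the excess of (d + 1/(n+1))^2 over d^2.\<close>
  define r where "r n = (2 * d + 1) / real (Suc n)" for n
  have sq: "(nrm (x - Z n))\<^sup>2 \<le> d\<^sup>2 + r n" for n
  proof -
    have "(nrm (x - Z n))\<^sup>2 \<le> (d + 1 / real (Suc n))\<^sup>2"
      using Z(2)[of n] ZH x by (intro power_mono) auto
    also have "\<dots> = d\<^sup>2 + (2 * d + 1 / real (Suc n)) / real (Suc n)"
      by (simp add: power2_eq_square distrib_left distrib_right add_divide_distrib)
    also have "\<dots> \<le> d\<^sup>2 + r n"
      unfolding r_def by (intro add_mono divide_right_mono order_refl) simp_all
    finally show ?thesis .
  qed
  have diff: "(nrm (Z m - Z n))\<^sup>2 \<le> 2 * r m + 2 * r n" for m n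
  proof -
    let ?a = "x - Z n" and ?b = "x - Z m"
    \<comment> \<open>The midpoint is again at distance at least \<open>d\<close> from
      \<open>x\<close>; with the parallelogram law this makes the sequence Cauchy.\<close>
    have "(1/2) *\<^sub>C (Z m + Z n) \<in> Y" using Z Y by (intro complex_vector.subspace_scale complex_vector.subspace_add)
    then have "d\<^sup>2 \<le> (nrm (x - (1/2) *\<^sub>C (Z m + Z n)))\<^sup>2" using le d0 by (intro power_mono) auto
    moreover have "?a + ?b = 2 *\<^sub>C (x - (1/2) *\<^sub>C (Z m + Z n))"
      using scaleC_add_left[of 1 1 x]
      by (simp add: complex_vector.scale_right_diff_distrib scaleC_scaleC scaleC_add_right scaleC_one)
    then have "nrm (?a + ?b) = 2 * nrm (x - (1/2) *\<^sub>C (Z m + Z n))" using x ZH by (simp add: nrm_scale)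
    ultimately have "4 * d\<^sup>2 \<le> (nrm (?a + ?b))\<^sup>2" by (simp add: power_mult_distrib)
    moreover have "?a - ?b = Z m - Z n" by simp
    ultimately have "(nrm (Z m - Z n))\<^sup>2 + 4 * d\<^sup>2 \<le> 2 * (nrm ?a)\<^sup>2 + 2 * (nrm ?b)\<^sup>2"
      using parallelogram[of ?a ?b] x ZH by simp
    then show ?thesis using sq[of m] sq[of n] by linarith
  qed
  have r0: "r \<longlonglongrightarrow> 0" unfolding r_def
    using tendsto_mult[OF tendsto_const[of "2 * d + 1"] LIMSEQ_inverse_real_of_nat] by (simp add: divide_inverse)
  have "\<exists>N. \<forall>m\<ge>N. \<forall>n\<ge>N. nrm (Z m - Z n) < e" if "e > 0" for e
  proof -
    have "e\<^sup>2 / 4 > 0" using that by simp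
    from order_tendstoD(2)[OF r0 this] obtain N where N: "\<And>n. n \<ge> N \<Longrightarrow> r n < e\<^sup>2 / 4"
      unfolding eventually_sequentially by blast
    have "nrm (Z m - Z n) < e" if "m \<ge> N" "n \<ge> N" for m n
    proof (rule power2_less_imp_less)
      show "(nrm (Z m - Z n))\<^sup>2 < e\<^sup>2" using diff[of m n] N[OF that(1)] N[OF that(2)] by linarith
    qed (use \<open>e > 0\<close> in simp)
    then show ?thesis by blast
  qed
  then obtain y where y: "y \<in> H" "(\<lambda>n. nrm (Z n - y)) \<longlonglongrightarrow> 0" using complete[of Z] ZH by blast
  have near: "\<exists>n\<ge>N. nrm (Z n - y) < e" if "e > 0" for e N
    using order_tendstoD(2)[OF y(2) that] unfolding eventually_sequentially by (meson nle_le order_refl)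
  have approx: "\<exists>z\<in>Y. nrm (y - z) < e" if "e > 0" for e
    using near[OF that, of 0] Z(1) ZH y(1) nrm_minus[of y] by metis
  have dist: "nrm (x - y) \<le> d"
  proof (rule field_le_epsilon)
    fix e :: real assume "e > 0"
    obtain N where N: "1 / real (Suc N) < e/2" using \<open>e > 0\<close> nat_approx_posE[of "e/2"] by auto
    obtain n where n: "n \<ge> N" "nrm (Z n - y) < e/2" using near[of "e/2" N] \<open>e > 0\<close> by auto
    have "1 / real (Suc n) \<le> 1 / real (Suc N)" using n by (simp add: frac_le)
    then show "nrm (x - y) \<le> d + e"
      using nrm_triangle_diff[of x "Z n" y] Z(2)[of n] ZH x y n N by force
  qed
  have far: "d \<le> nrm (x - y - z)" if "z \<in> Y" for z
  proof (rule field_le_epsilon)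
    fix e :: real assume "e > 0"
    obtain n where n: "nrm (Z n - y) < e" using near[OF \<open>e > 0\<close>, of 0] by auto
    have "Z n + z \<in> Y" "z \<in> H" using Z Y that by (auto intro: complex_vector.subspace_add)
    then have "d \<le> nrm (x - (Z n + z))" by (intro le)
    also have "x - (Z n + z) = (x - y - z) - (Z n - y)" by simp
    also have "nrm \<dots> \<le> nrm (x - y - z) + nrm (Z n - y)"
      using nrm_triangle_diff[of "x - y - z" 0 "Z n - y"] nrm_minus[of 0 "Z n - y"] x y ZH \<open>z \<in> H\<close> by simp
    finally show "d \<le> nrm (x - y - z) + e" using n by simp
  qed
  have "ip z (x - y) = 0" if z: "z \<in> Y" for z
  proof (rule ccontr)
    assume ne: "ip z (x - y) \<noteq> 0"
    have zH: "z \<in> H" using z Y by blast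
    have "nrm z \<noteq> 0"
    proof
      assume "nrm z = 0"
      with cauchy_schwarz[of z "x - y"] x y zH have "ip z (x - y) = 0" by simp
      with ne show False ..
    qed
    \<comment> \<open>Removing from \<open>x - y\<close> its component along \<open>z\<close> would,
      by Pythagoras, bring it below the distance \<open>d\<close>, against
      \<open>far\<close>.\<close>
    let ?v = "(1 / complex_of_real (nrm z)) *\<^sub>C z"
    have v: "orthonormal {?v}"
      using orthonormal_insert[of "{}" z] \<open>nrm z \<noteq> 0\<close> zH by (simp add: orthonormal_def[of "{}"])
    have "proj {?v} (x - y) \<in> Y" using z Y by (auto simp: proj_def intro!: complex_vector.subspace_scale)
    then have "d\<^sup>2 \<le> (nrm (resid {?v} (x - y)))\<^sup>2" unfolding resid_def using far d0 by (intro power_mono) auto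
    moreover have "(nrm (x - y))\<^sup>2 \<le> d\<^sup>2" using dist x y by (intro power_mono) simp_all
    moreover have "(nrm (resid {?v} (x - y)))\<^sup>2 + (cmod (ip ?v (x - y)))\<^sup>2 = (nrm (x - y))\<^sup>2"
      using pythagoras[OF v, of "x - y"] x y by simp
    ultimately have "(cmod (ip ?v (x - y)))\<^sup>2 \<le> 0" by linarith
    then have "ip ?v (x - y) = 0" by simp
    with ne \<open>nrm z \<noteq> 0\<close> x y zH show False by (simp add: ip_scale_left)
  qed
  with y approx show thesis by (intro that)
qed

text \<open>\<open>hs_norm\<close> evaluates at a basis picked by choice, which is meaningful only
  once a basis exists. The span of a maximal orthonormal set is dense: otherwise some normalised
  \<open>x - y\<close> orthogonal to it could be added.\<close>

lemma orthonormal_basis_exists: "\<exists>E. orthonormal_basis H ip E"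
proof -
  obtain M where M: "orthonormal M" and max: "\<And>E. orthonormal E \<Longrightarrow> M \<subseteq> E \<Longrightarrow> E = M"
    using maximal_orthonormal_exists by blast
  have MH: "M \<subseteq> H" using M by (simp add: orthonormal_def)
  have "\<exists>z\<in>cspan M. nrm (x - z) < e" if x: "x \<in> H" and "e > 0" for x e
  proof -
    obtain y where y: "y \<in> H" "\<And>e. e > 0 \<Longrightarrow> \<exists>z\<in>cspan M. nrm (y - z) < e"
      "\<And>z. z \<in> cspan M \<Longrightarrow> ip z (x - y) = 0"
      using closest_point_exists[OF _ H_span[OF MH] x] by auto
    have "x = y"
    proof (rule ccontr)
      assume "x \<noteq> y"
      then have n: "nrm (x - y) \<noteq> 0" using x y definite[of "x - y"] by (auto simp: nrm_eq_0_iff)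
      let ?v = "(1 / complex_of_real (nrm (x - y))) *\<^sub>C (x - y)"
      have "orthonormal (insert ?v M)"
        using M x y n by (intro orthonormal_insert) (auto intro: complex_vector.span_base)
      then have "?v \<in> M" using max[of "insert ?v M"] by blast
      then have "ip ?v (x - y) = 0" by (intro y complex_vector.span_base)
      then show False using x y n by (simp add: ip_scale_left ip_self)
    qed
    with y that show ?thesis by blast
  qed
  then have "hdense H ip (cspan M)" using H_span[OF MH] by (auto simp: hdense_def)
  with M show ?thesis unfolding orthonormal_basis_def orthonormal_def by blast
qed

text \<open>The partial sum over a finite \<open>Y\<close> is the inner product of \<open>x\<close>
  with the projection of \<open>y\<close>. The error is controlled by the residual of
  \<open>y\<close>, small as soon as the span of \<open>Y\<close> contains a good approximation
  \<open>z\<close>. The basis may be uncountable, hence an unordered sum.\<close>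

lemma parseval:
  assumes E: "orthonormal_basis H ip E" and x: "x \<in> H" and y: "y \<in> H"
  shows "((\<lambda>e. ip x e * ip e y) has_sum ip x y) E"
  unfolding has_sum_def tendsto_iff eventually_finite_subsets_at_top
proof (intro allI impI)
  fix e :: real assume "e > 0"
  have on: "orthonormal E" using E by (simp add: orthonormal_basis_def orthonormal_def)
  define \<delta> where "\<delta> = e / (nrm x + 1)"
  have nx: "nrm x + 1 > 0" using x by (simp add: add_nonneg_pos)
  have \<delta>: "\<delta> > 0" using \<open>e > 0\<close> nx by (simp add: \<delta>_def)
  obtain z where z: "z \<in> cspan E" "nrm (y - z) < \<delta>"
    using E y \<delta> unfolding orthonormal_basis_def hdense_def by blast
  obtain G where G: "finite G" "G \<subseteq> E" "z \<in> cspan G"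
  proof -
    from z(1) obtain t c where "finite t" "t \<subseteq> E" "z = (\<Sum>a\<in>t. c a *\<^sub>C a)"
      by (auto simp: complex_vector.span_explicit)
    then show thesis
      by (intro that[of t]) (auto intro: complex_vector.span_sum complex_vector.span_scale complex_vector.span_base)
  qed
  have "dist (\<Sum>e\<in>Y. ip x e * ip e y) (ip x y) < e" if Y: "finite Y \<and> G \<subseteq> Y \<and> Y \<subseteq> E" for Y
  proof -
    have onY: "orthonormal Y" using on Y orthonormal_subset by blast
    have "z \<in> cspan Y" using G Y complex_vector.span_mono by blast
    then have "nrm (resid Y y) < \<delta>" using nrm_resid_approx[OF onY _ y, of z] Y z by simp
    moreover have "(\<Sum>e\<in>Y. ip x e * ip e y) = ip x (proj Y y)"
      unfolding proj_def using x onY by (simp add: ip_sum ip_scale orthonormal_H mult.commute)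
    then have "dist (\<Sum>e\<in>Y. ip x e * ip e y) (ip x y) = cmod (ip x (resid Y y))"
      using x y onY by (simp add: dist_norm resid_def ip_diff norm_minus_commute)
    moreover have "cmod (ip x (resid Y y)) \<le> nrm x * nrm (resid Y y)"
      using x y onY by (intro cauchy_schwarz) simp_all
    ultimately have "dist (\<Sum>e\<in>Y. ip x e * ip e y) (ip x y) \<le> nrm x * \<delta>"
      using x mult_left_mono[of "nrm (resid Y y)" \<delta> "nrm x"] by simp
    also have "\<dots> < (nrm x + 1) * \<delta>" using \<delta> by simp
    also have "\<dots> = e" using nx by (simp add: \<delta>_def)
    finally show ?thesis .
  qed
  with G show "\<exists>X. finite X \<and> X \<subseteq> E \<and> (\<forall>Y. finite Y \<and> X \<subseteq> Y \<and> Y \<subseteq> E \<longrightarrow>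
      dist (\<Sum>e\<in>Y. ip x e * ip e y) (ip x y) < e)" by blast
qed

text \<open>The squared Hilbert--Schmidt norm of the operator sending x to the sum of <a_i, x> b_i:
  expand the square into a finite double sum and sum each term over the basis by Parseval. The value
  does not involve \<open>E\<close>.\<close>

lemma finite_rank_has_sum:
  assumes E: "orthonormal_basis H ip E" and I: "finite I"
    and ab: "\<And>i. i \<in> I \<Longrightarrow> a i \<in> H" "\<And>i. i \<in> I \<Longrightarrow> b i \<in> H"
  shows "((\<lambda>e. (nrm (\<Sum>i\<in>I. ip (a i) e *\<^sub>C b i))\<^sup>2) has_sum
    Re (\<Sum>i\<in>I. \<Sum>j\<in>I. ip (b i) (b j) * ip (a j) (a i))) E"
proof -
  have EH: "e \<in> H" if "e \<in> E" for e using E that by (auto simp: orthonormal_basis_def)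
  have hs: "((\<lambda>e. \<Sum>i\<in>J. f i e) has_sum (\<Sum>i\<in>J. S i)) E"
    if "finite J" "\<And>i. i \<in> J \<Longrightarrow> (f i has_sum S i) E" for J and f :: "'i \<Rightarrow> 'h \<Rightarrow> complex" and S
    using that by (induction J rule: finite_induct) (auto intro!: has_sum_add)
  have "((\<lambda>e. \<Sum>i\<in>I. \<Sum>j\<in>I. ip (b i) (b j) * (ip (a j) e * ip e (a i))) has_sum
      (\<Sum>i\<in>I. \<Sum>j\<in>I. ip (b i) (b j) * ip (a j) (a i))) E"
    using E ab I by (intro hs has_sum_cmult_right parseval)
  then have "((\<lambda>e. Re (\<Sum>i\<in>I. \<Sum>j\<in>I. ip (b i) (b j) * (ip (a j) e * ip e (a i)))) has_sum
      Re (\<Sum>i\<in>I. \<Sum>j\<in>I. ip (b i) (b j) * ip (a j) (a i))) E" by (rule has_sum_Re)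
  moreover have "(nrm (\<Sum>i\<in>I. ip (a i) e *\<^sub>C b i))\<^sup>2
      = Re (\<Sum>i\<in>I. \<Sum>j\<in>I. ip (b i) (b j) * (ip (a j) e * ip e (a i)))" if "e \<in> E" for e
  proof -
    have e: "e \<in> H" using EH that .
    let ?s = "\<Sum>i\<in>I. ip (a i) e *\<^sub>C b i"
    have "ip ?s ?s = (\<Sum>i\<in>I. cnj (ip (a i) e) * ip (b i) ?s)"
      using ab by (subst ip_sum_left) (simp_all add: ip_scale_left)
    also have "\<dots> = (\<Sum>i\<in>I. ip e (a i) * (\<Sum>j\<in>I. ip (a j) e * ip (b i) (b j)))"
      using ab e by (intro sum.cong refl) (simp add: ip_sum ip_scale ip_cnj[of e])
    finally show ?thesis using ab by (simp add: nrm_sq sum_distrib_left mult_ac)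
  qed
  ultimately show ?thesis by (simp only: cong: has_sum_cong)
qed

lemma hs_norm_proj:
  assumes U: "orthonormal U" "finite U"
  shows "hs_norm H ip (proj U) = sqrt (real (card U))"
proof -
  define E where "E = (SOME E. orthonormal_basis H ip E)"
  have E: "orthonormal_basis H ip E" unfolding E_def by (rule someI_ex[OF orthonormal_basis_exists])
  have "((\<lambda>e. (nrm (proj U e))\<^sup>2) has_sum Re (\<Sum>i\<in>U. \<Sum>j\<in>U. ip i j * ip j i)) E"
    unfolding proj_def using U by (intro finite_rank_has_sum E) (simp_all add: orthonormal_H)
  moreover have "(\<Sum>i\<in>U. \<Sum>j\<in>U. ip i j * ip j i) = (\<Sum>i\<in>U. \<Sum>j\<in>U. if j = i then 1 else 0)"
    using U by (intro sum.cong refl) (auto simp: orthonormalD)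
  ultimately have "((\<lambda>e. (nrm (proj U e))\<^sup>2) has_sum real (card U)) E" using U by simp
  then show ?thesis by (simp add: hs_norm_def E_def infsumI)
qed

text \<open>The commutator of \<open>T\<close> with the projection \<open>Q\<close> onto the span of \<open>U\<close> is
  \<open>(1 - Q) T Q - Q T (1 - Q)\<close>, and the second summand is the adjoint of \<open>(1 - Q) T\<^sup>* Q\<close>.\<close>

lemma hs_norm_commutator:
  assumes U: "orthonormal U" "finite U"
    and T: "bounded_operator H ip T" and T': "\<And>x. x \<in> H \<Longrightarrow> T' x \<in> H"
    and adj: "\<And>x y. x \<in> H \<Longrightarrow> y \<in> H \<Longrightarrow> ip (T' x) y = ip x (T y)"
  shows "hs_norm H ip (\<lambda>x. T (proj U x) - proj U (T x))
    \<le> sqrt (2 * (\<Sum>u\<in>U. (nrm (resid U (T u)))\<^sup>2) + 2 * (\<Sum>u\<in>U. (nrm (resid U (T' u)))\<^sup>2))"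
proof -
  define E where "E = (SOME E. orthonormal_basis H ip E)"
  have E: "orthonormal_basis H ip E" unfolding E_def by (rule someI_ex[OF orthonormal_basis_exists])
  have TH: "T x \<in> H" if "x \<in> H" for x using T that by (simp add: bounded_operator_def)
  have Tadd: "T (x + y) = T x + T y" if "x \<in> H" "y \<in> H" for x y using T that by (simp add: bounded_operator_def)
  have Tscale: "T (c *\<^sub>C x) = c *\<^sub>C T x" if "x \<in> H" for c x using T that by (simp add: bounded_operator_def)
  have Tzero: "T 0 = 0" using Tscale[of 0 0] by simp
  have Tsum: "T (\<Sum>i\<in>I. f i) = (\<Sum>i\<in>I. T (f i))" if "\<And>i. i \<in> I \<Longrightarrow> f i \<in> H" for f and I :: "'h set"
    using that by (induction I rule: infinite_finite_induct) (simp_all add: Tadd Tzero)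
  have UH: "u \<in> H" if "u \<in> U" for u using U that by (simp add: orthonormal_H)
  \<comment> \<open>\<open>p\<close> is (1 - Q) T Q and \<open>q\<close> is Q T (1 - Q), written as
    finite-rank sums. For \<open>q\<close> the residual sits in the left slot, by moving T (1 - Q)
    across the inner product.\<close>
  define p q where "p x = (\<Sum>u\<in>U. ip u x *\<^sub>C resid U (T u))" and "q x = (\<Sum>u\<in>U. ip (resid U (T' u)) x *\<^sub>C u)" for x
  have pH: "p x \<in> H" and qH: "q x \<in> H" for x
    by (auto simp: p_def q_def UH TH U)
  have split: "T (proj U x) - proj U (T x) = p x - q x" if x: "x \<in> H" for x
  proof -
    have rsum: "resid U (\<Sum>i\<in>I. c i *\<^sub>C f i) = (\<Sum>i\<in>I. c i *\<^sub>C resid U (f i))"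
      if "\<And>i. i \<in> I \<Longrightarrow> f i \<in> H" for f c and I :: "'h set"
      using that
      by (induction I rule: infinite_finite_induct)
        (simp_all add: resid_def proj_add proj_scale U complex_vector.scale_right_diff_distrib, simp_all add: proj_def UH)
    have "T (proj U x) = (\<Sum>u\<in>U. ip u x *\<^sub>C T u)" unfolding proj_def by (simp add: Tsum Tscale UH)
    then have 1: "resid U (T (proj U x)) = p x" by (simp add: rsum p_def UH TH)
    have "ip u (T (resid U x)) = ip (resid U (T' u)) x" if "u \<in> U" for u
      using U x UH[OF that] T' by (simp add: resid_self_adjoint flip: adj)
    then have 2: "proj U (T (resid U x)) = q x" by (simp add: proj_def q_def)
    have "T x = T (proj U x) + T (resid U x)"
      using Tadd[of "proj U x" "resid U x"] x U by (simp add: resid_def)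
    then have "proj U (T x) = proj U (T (proj U x)) + proj U (T (resid U x))" using U x TH by (simp add: proj_add)
    then show ?thesis using 1 2 by (simp add: resid_def algebra_simps)
  qed
  \<comment> \<open>One of the two Gram matrices is the identity, so only the diagonal
    survives.\<close>
  have "(\<Sum>i\<in>U. \<Sum>j\<in>U. ip (resid U (T i)) (resid U (T j)) * ip j i) = (\<Sum>u\<in>U. complex_of_real ((nrm (resid U (T u)))\<^sup>2))"
  proof (intro sum.cong refl)
    fix i assume i: "i \<in> U"
    then have "(\<Sum>j\<in>U. ip (resid U (T i)) (resid U (T j)) * ip j i)
        = (\<Sum>j\<in>U. if j = i then ip (resid U (T i)) (resid U (T i)) else 0)"
      using U by (intro sum.cong refl) (auto simp: orthonormalD)
    then show "(\<Sum>j\<in>U. ip (resid U (T i)) (resid U (T j)) * ip j i) = complex_of_real ((nrm (resid U (T i)))\<^sup>2)"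
      using U i TH UH by (simp add: ip_self)
  qed
  moreover have "((\<lambda>e. (nrm (p e))\<^sup>2) has_sum Re (\<Sum>i\<in>U. \<Sum>j\<in>U. ip (resid U (T i)) (resid U (T j)) * ip j i)) E"
    unfolding p_def using U UH TH by (intro finite_rank_has_sum E) simp_all
  ultimately have sp: "((\<lambda>e. (nrm (p e))\<^sup>2) has_sum (\<Sum>u\<in>U. (nrm (resid U (T u)))\<^sup>2)) E" by simp
  have "(\<Sum>i\<in>U. \<Sum>j\<in>U. ip i j * ip (resid U (T' j)) (resid U (T' i))) = (\<Sum>u\<in>U. complex_of_real ((nrm (resid U (T' u)))\<^sup>2))"
  proof (intro sum.cong refl)
    fix i assume i: "i \<in> U"
    then have "(\<Sum>j\<in>U. ip i j * ip (resid U (T' j)) (resid U (T' i)))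
        = (\<Sum>j\<in>U. if j = i then ip (resid U (T' i)) (resid U (T' i)) else 0)"
      using U by (intro sum.cong refl) (auto simp: orthonormalD)
    then show "(\<Sum>j\<in>U. ip i j * ip (resid U (T' j)) (resid U (T' i))) = complex_of_real ((nrm (resid U (T' i)))\<^sup>2)"
      using U i T' UH by (simp add: ip_self)
  qed
  moreover have "((\<lambda>e. (nrm (q e))\<^sup>2) has_sum Re (\<Sum>i\<in>U. \<Sum>j\<in>U. ip i j * ip (resid U (T' j)) (resid U (T' i)))) E"
    unfolding q_def using U UH T' by (intro finite_rank_has_sum E) simp_all
  ultimately have sq: "((\<lambda>e. (nrm (q e))\<^sup>2) has_sum (\<Sum>u\<in>U. (nrm (resid U (T' u)))\<^sup>2)) E" by simp
  let ?g = "\<lambda>e. 2 * (nrm (p e))\<^sup>2 + 2 * (nrm (q e))\<^sup>2" and ?f = "\<lambda>e. (nrm (T (proj U e) - proj U (T e)))\<^sup>2"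
  let ?S = "2 * (\<Sum>u\<in>U. (nrm (resid U (T u)))\<^sup>2) + 2 * (\<Sum>u\<in>U. (nrm (resid U (T' u)))\<^sup>2)"
  have g: "(?g has_sum ?S) E" by (intro has_sum_add has_sum_cmult_right sp sq)
  have le: "?f e \<le> ?g e" if "e \<in> E" for e
  proof -
    have "e \<in> H" using E that by (auto simp: orthonormal_basis_def)
    then show ?thesis using nrm_sq_diff_le[OF pH qH, of e e] by (simp add: split)
  qed
  have "?f summable_on E"
    by (rule summable_on_comparison_test[OF has_sum_imp_summable[OF g] le zero_le_power2])
  then have "infsum ?f E \<le> ?S" using infsum_mono[OF _ has_sum_imp_summable[OF g] le] infsumI[OF g] by simp
  then show ?thesis unfolding hs_norm_def E_def[symmetric] by (rule real_sqrt_le_mono)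
qed

end


section \<open>The representation attached to a state\<close>

context state
begin

sublocale pre_hilbert "sip \<phi>" ..

text \<open>\<open>f b\<close> is the inner product of b with f, so moving \<open>star a\<close>
  across shows this to be the extension of left multiplication by \<open>a\<close>. Since f is
  antilinear, the \<open>star\<close> also makes \<open>rep\<close> linear in
  \<open>a\<close>.\<close>

definition rep :: "'a \<Rightarrow> ('a \<Rightarrow> complex) \<Rightarrow> 'a \<Rightarrow> complex"
  where "rep a f = (\<lambda>b. f (star a * b))"

lemma represents_rep: "represents X f \<Longrightarrow> represents (\<lambda>n. a * X n) (rep a f)"
proof -
  assume r: "represents X f"
  have "cauchy (\<lambda>n. a * X n)"
    by (rule cauchy_image[where K = "norm a"])
      (use r nrm_mult in \<open>simp_all add: represents_def flip: right_diff_distrib\<close>)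
  moreover have "sip \<phi> b (a * X n) = sip \<phi> (star a * b) (X n)" for b n by (simp add: sip_star_mult)
  ultimately show ?thesis using r by (simp add: represents_def rep_def)
qed

lemma rep_compl: "f \<in> compl \<Longrightarrow> rep a f \<in> compl"
  by (auto intro: complI represents_rep elim!: complE)

lemma rep_embed: "rep a (embed x) = embed (a * x)"
  by (simp add: rep_def embed_def fun_eq_iff sip_star_mult)

lemma compl_add: "f \<in> compl \<Longrightarrow> f (x + y) = f x + f y"
  by (simp add: C.ip_add_left embed_add flip: cip_embed_left)

lemma compl_scale: "f \<in> compl \<Longrightarrow> f (c *\<^sub>C x) = cnj c * f x"
  by (simp add: C.ip_scale_left embed_scale flip: cip_embed_left)

lemma cip_rep_star:
  assumes "f \<in> compl" "g \<in> compl"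
  shows "cip (rep (star a) f) g = cip f (rep a g)"
proof -
  obtain X where X: "represents X f" using complE[OF assms(1)] .
  obtain Y where Y: "represents Y g" using complE[OF assms(2)] .
  have "(\<lambda>n. sip \<phi> (star a * X n) (Y n)) \<longlonglongrightarrow> cip (rep (star a) f) g" by (intro cip_LIMSEQ represents_rep X Y)
  moreover have "(\<lambda>n. sip \<phi> (X n) (a * Y n)) \<longlonglongrightarrow> cip f (rep a g)" by (intro cip_LIMSEQ represents_rep X Y)
  ultimately show ?thesis by (simp add: sip_star_mult LIMSEQ_unique)
qed

lemma rep_bounded: "bounded_operator compl cip (rep a)"
  unfolding bounded_operator_def
proof (intro conjI ballI allI)
  show "\<exists>K. \<forall>f\<in>compl. C.nrm (rep a f) \<le> K * C.nrm f"
  proof (intro exI ballI)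
    fix f assume "f \<in> compl"
    then obtain X where X: "represents X f" by (rule complE)
    have "(\<lambda>n. norm a * nrm (X n)) \<longlonglongrightarrow> norm a * C.nrm f" by (intro tendsto_mult tendsto_const nrm_LIMSEQ X)
    then show "C.nrm (rep a f) \<le> norm a * C.nrm f"
      by (rule LIMSEQ_le[OF nrm_LIMSEQ[OF represents_rep[OF X]]]) (simp add: nrm_mult)
  qed
qed (simp_all add: rep_compl, simp_all add: rep_def fun_eq_iff scaleC_fun_def)

lemma rep_representation: "representation compl cip rep"
  unfolding representation_def
proof (intro conjI allI ballI rep_bounded)
  show "rep (a + b) f = rep a f + rep b f" if "f \<in> compl" for a b f
    by (simp add: rep_def fun_eq_iff star_add distrib_right compl_add[OF that])
  show "rep (c *\<^sub>C a) f = c *\<^sub>C rep a f" if "f \<in> compl" for c a f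
    by (simp add: rep_def fun_eq_iff star_scaleC scaleC_mult_left compl_scale[OF that] scaleC_fun_def scaleC_complex_def)
  show "rep (a * b) f = rep a (rep b f)" for a b f
    by (simp add: rep_def fun_eq_iff star_mult mult.assoc)
  show "rep 1 f = f" for f by (simp add: rep_def)
qed (rule cip_rep_star)

lemma rep_positive_cyclic: "positive_cyclic_representation P compl cip rep (embed 1)"
  unfolding positive_cyclic_representation_def
proof (intro conjI ballI rep_representation)
  fix p assume p: "p \<in> P"
  have "0 \<le> cip f (rep p f)" if f: "f \<in> compl" for f
  proof -
    obtain X where X: "represents X f" using complE[OF f] .
    have "0 \<le> sip \<phi> (X n) (p * X n)" for n using cone_nonneg[OF p, of "X n"] by (simp add: sip_def mult.assoc)
    then show ?thesis by (rule complex_nonneg_LIMSEQ[OF cip_LIMSEQ[OF X represents_rep[OF X]]])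
  qed
  with rep_bounded show "positive_operator compl cip (rep p)" by (simp add: positive_operator_def)
next
  have "range (\<lambda>a. rep a (embed 1)) = range embed" by (simp add: rep_embed)
  then show "hdense compl cip (range (\<lambda>a. rep a (embed 1)))"
    using embed_dense by (auto simp: hdense_def)
qed simp

lemma C_hilbert: "hilbert compl cip"
proof
  show "f = 0" if "f \<in> compl" "cip f f = 0" for f
    using hilbert_space_compl that unfolding hilbert_space_def by blast
  show "\<exists>f\<in>compl. (\<lambda>n. C.nrm (F n - f)) \<longlonglongrightarrow> 0"
    if "\<And>n. F n \<in> compl" "\<And>e. e > 0 \<Longrightarrow> \<exists>N. \<forall>m\<ge>N. \<forall>n\<ge>N. C.nrm (F m - F n) < e" for F
    using hilbert_space_compl that unfolding hilbert_space_def by blast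
qed

text \<open>\<open>embed\<close> kills null vectors and is not injective in general; on
  \<open>U\<close> it is, because distinct members have inner product 0 and not 1.\<close>

lemma embed_orthonormal:
  assumes "orthonormal U"
  shows "C.orthonormal (embed ` U)" "inj_on embed U"
proof -
  have *: "x = y" if "x \<in> U" "y \<in> U" "embed x = embed y" for x y
    using that orthonormalD[OF assms that(1,1)] orthonormalD[OF assms that(1,2)] by (metis cip_embed zero_neq_one)
  then show "inj_on embed U" by (rule inj_onI)
  show "C.orthonormal (embed ` U)"
    unfolding C.orthonormal_def using * by (auto simp: cip_embed orthonormalD[OF assms])
qed

lemma embed_proj:
  assumes "orthonormal U"
  shows "C.proj (embed ` U) (embed x) = embed (proj U x)"
  using embed_orthonormal(2)[OF assms]
  by (simp add: C.proj_def proj_def sum.reindex cip_embed embed_sum embed_scale)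

lemma embed_resid:
  assumes "orthonormal U"
  shows "C.resid (embed ` U) (embed x) = embed (resid U x)"
  by (simp add: C.resid_def resid_def embed_proj[OF assms] embed_diff)

text \<open>The defects of T and \<open>star T\<close> combine to 2 (\<epsilon>^2/4 +
  \<epsilon>^2/4) = \<epsilon>^2 per element of \<open>U\<close>, and the Hilbert--Schmidt norm of Q
  is the root of \<open>card U\<close>; this explains the factor 1/4.\<close>

lemma compressed_representation:
  assumes U: "orthonormal U" "finite U" "U \<noteq> {}" and \<epsilon>: "\<epsilon> > 0"
    and def: "\<And>T. T \<in> F \<Longrightarrow> (\<Sum>u\<in>U. (nrm (resid U (T * u)))\<^sup>2) \<le> \<epsilon>\<^sup>2 / 4 * real (card U)"
      "\<And>T. T \<in> F \<Longrightarrow> (\<Sum>u\<in>U. (nrm (resid U (star T * u)))\<^sup>2) \<le> \<epsilon>\<^sup>2 / 4 * real (card U)"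
    and inj: "\<And>x. x \<in> cspan F \<Longrightarrow> nrm (proj U x) = 0 \<Longrightarrow> x = 0"
  shows "\<exists>(H :: ('a \<Rightarrow> complex) set) ip \<pi> \<Omega> Q.
        hilbert_space H ip \<and> positive_cyclic_representation P H ip \<pi> \<Omega> \<and>
        orthogonal_projection H ip Q \<and> finite_dimensional (Q ` H) \<and> (\<exists>x\<in>H. Q x \<noteq> 0) \<and>
        (\<forall>T\<in>F. hs_norm H ip (\<lambda>x. \<pi> T (Q x) - Q (\<pi> T x)) \<le> \<epsilon> * hs_norm H ip Q) \<and>
        inj_on (\<lambda>A. Q (\<pi> A \<Omega>)) (cspan F)"
proof (intro exI conjI)
  let ?V = "embed ` U"
  let ?Q = "C.proj ?V"
  have V: "C.orthonormal ?V" "finite ?V" and injU: "inj_on embed U"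
    using embed_orthonormal[OF U(1)] U by simp_all
  show "hilbert_space compl cip" by (rule hilbert_space_compl)
  show "positive_cyclic_representation P compl cip rep (embed 1)" by (rule rep_positive_cyclic)
  show "orthogonal_projection compl cip ?Q" by (rule C.orthogonal_projection_proj[OF V])
  show "finite_dimensional (?Q ` compl)"
    unfolding finite_dimensional_def using V C.proj_span by blast
  show "\<exists>x\<in>compl. ?Q x \<noteq> 0"
  proof -
    obtain u where u: "u \<in> U" using U by blast
    have "?Q (embed u) = embed u" using u V by (intro C.proj_eq) (auto intro: complex_vector.span_base)
    moreover have "embed u \<noteq> 0"
      using cip_embed[of u u] orthonormalD[OF U(1) u u] by auto
    ultimately show ?thesis by (intro bexI[of _ "embed u"]) simp_all
  qed
  show "\<forall>T\<in>F. hs_norm compl cip (\<lambda>x. rep T (?Q x) - ?Q (rep T x)) \<le> \<epsilon> * hs_norm compl cip ?Q"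
  proof
    fix T assume T: "T \<in> F"
    have s: "(\<Sum>v\<in>?V. (C.nrm (C.resid ?V (rep a v)))\<^sup>2) = (\<Sum>u\<in>U. (nrm (resid U (a * u)))\<^sup>2)" for a
      using injU by (simp add: sum.reindex rep_embed embed_resid[OF U(1)] nrm_embed)
    have "hs_norm compl cip (\<lambda>x. rep T (?Q x) - ?Q (rep T x))
      \<le> sqrt (2 * (\<Sum>v\<in>?V. (C.nrm (C.resid ?V (rep T v)))\<^sup>2) + 2 * (\<Sum>v\<in>?V. (C.nrm (C.resid ?V (rep (star T) v)))\<^sup>2))"
      by (rule hilbert.hs_norm_commutator[OF C_hilbert V rep_bounded]) (simp_all add: rep_compl cip_rep_star)
    also have "\<dots> \<le> sqrt (\<epsilon>\<^sup>2 * real (card U))"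
      unfolding s using def[OF T] by (intro real_sqrt_le_mono) (simp add: algebra_simps)
    also have "\<dots> = \<epsilon> * sqrt (real (card U))" using \<epsilon> by (simp add: real_sqrt_mult)
    also have "sqrt (real (card U)) = hs_norm compl cip ?Q"
      using hilbert.hs_norm_proj[OF C_hilbert V] injU by (simp add: card_image)
    finally show "hs_norm compl cip (\<lambda>x. rep T (?Q x) - ?Q (rep T x)) \<le> \<epsilon> * hs_norm compl cip ?Q" .
  qed
  show "inj_on (\<lambda>A. ?Q (rep A (embed 1))) (cspan F)"
  proof (rule inj_onI)
    fix x y assume xy: "x \<in> cspan F" "y \<in> cspan F" and "?Q (rep x (embed 1)) = ?Q (rep y (embed 1))"
    then have "embed (proj U x) - embed (proj U y) = 0" by (simp add: rep_embed embed_proj[OF U(1)])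
    then have "embed (proj U (x - y)) = 0" using U by (simp add: proj_diff embed_diff)
    then have "C.nrm (embed (proj U (x - y))) = 0" by (simp add: hnorm_def)
    then have "nrm (proj U (x - y)) = 0" by (simp only: nrm_embed)
    moreover have "x - y \<in> cspan F" using xy by (rule complex_vector.span_diff)
    ultimately have "x - y = 0" by (intro inj)
    then show "x = y" by simp
  qed
qed

end

text \<open>The state is the average of \<open>\<phi>\<close>, which is faithful on the span of \<open>F\<close> and does not depend on the
  Foelner subspace \<open>W\<close>, and of a state faithful on \<open>W\<close>. The first half bounds the norm of \<open>\<pi> A \<Omega>\<close> from
  below independently of how well \<open>W\<close> has to approximate \<open>F\<close>.\<close>

theorem properly_foelner_if_amenable:
  fixes B P :: "'a::pre_cstar_algebra set"
  assumes "closure B = UNIV" "separating_states P" "properly_algebraically_amenable B"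
  shows "properly_foelner P"
  unfolding properly_foelner_def
proof (intro allI impI)
  fix F :: "'a set" and \<epsilon> :: real assume \<epsilon>: "\<epsilon> > 0" and F: "finite F"
  obtain \<phi> where \<phi>: "state_on P \<phi>" "\<And>z. z \<in> cspan F \<Longrightarrow> \<phi> (star z * z) = 0 \<Longrightarrow> z = 0"
    using faithful_state[OF assms(2) F] by blast
  interpret f: state P \<phi> by unfold_locales fact
  have "f.orthonormal {}" by (simp add: f.orthonormal_def)
  moreover have "finite_dimensional (cspan F)" using F unfolding finite_dimensional_def by blast
  moreover have "y = 0" if "y \<in> cspan F" "sip \<phi> y y = 0" for y using that \<phi>(2) by (simp add: sip_def)
  ultimately obtain G where G: "f.orthonormal G" "finite G" "cspan G = cspan F"
    using f.orthonormal_extend[of "{}" "cspan F"]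
    by (metis complex_vector.subspace_span empty_subsetI finite.emptyI subset_UNIV)
  \<comment> \<open>\<open>F\<close> and its adjoints serve the commutator. \<open>G\<close>, a
    basis of the span of \<open>F\<close> orthonormal for \<phi>, serves injectivity: its
    approximants will lie in W.\<close>
  define F' where "F' = G \<union> F \<union> star ` F"
  have F': "finite F'" using G F by (simp add: F'_def)
  \<comment> \<open>The first entry gives 4 \<eta>^2 card G <= 1/4 for injectivity; the second, with
    \<theta> M = \<epsilon>^2/16, gives the commutator bound 2 (\<theta> M + \<eta>^2) <=
    \<epsilon>^2/4.\<close>
  define \<eta> where "\<eta> = sqrt (min (1 / (16 * (real (card G) + 1))) (\<epsilon>\<^sup>2 / 16))"
  have m: "min (1 / (16 * (real (card G) + 1))) (\<epsilon>\<^sup>2 / 16) > 0"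
    using \<epsilon> by (simp add: add_nonneg_pos)
  then have \<eta>: "\<eta> > 0" "\<eta>\<^sup>2 \<le> 1 / (16 * (real (card G) + 1))" "\<eta>\<^sup>2 \<le> \<epsilon>\<^sup>2 / 16"
    unfolding \<eta>_def by simp_all
  obtain b where b: "\<And>T::'a. b T \<in> B \<and> norm (T - b T) < \<eta>" using dense_approx[OF assms(1) \<eta>(1)] by blast
  define M where "M = (\<Sum>T\<in>F'. (norm (b T))\<^sup>2) + 1"
  have nM: "(norm (b T))\<^sup>2 \<le> M" if "T \<in> F'" for T
    using member_le_sum[of T F' "\<lambda>T. (norm (b T))\<^sup>2"] that F' by (simp add: M_def)
  have M: "M > 0" by (simp add: M_def add_nonneg_pos sum_nonneg)
  define \<theta> where "\<theta> = \<epsilon>\<^sup>2 / (16 * M)"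
  have \<theta>: "\<theta> > 0" "\<theta> * M = \<epsilon>\<^sup>2 / 16" using \<epsilon> M by (simp_all add: \<theta>_def)
  have "finite (b ` F')" "b ` F' \<subseteq> B" using F' b by auto
  then obtain W where W: "foelner_subspace B (b ` F') \<theta> W" "b ` F' \<subseteq> W"
    using assms(3) \<theta> unfolding properly_algebraically_amenable_def by blast
  have bn: "norm (T - b T) \<le> \<eta>" if "T \<in> F'" for T using b less_imp_le by blast
  from foelner_subspace_state[OF W(1) F' assms(2) \<phi>(1) bn nM less_imp_le[OF \<theta>(1)]]
  obtain \<psi> \<omega> :: "'a \<Rightarrow> complex" and U :: "'a set"
    where \<psi>: "state_on P \<psi>" and \<omega>: "state_on P \<omega>" "\<omega> = (\<lambda>x. (\<phi> x + \<psi> x) / 2)"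
    and U: "semi_inner.orthonormal UNIV (sip \<omega>) U" "finite U" "U \<noteq> {}" "cspan U = W"
    and d: "\<forall>T\<in>F'. (\<Sum>u\<in>U. (hnorm (sip \<omega>) (semi_inner.resid (sip \<omega>) U (T * u)))\<^sup>2)
      \<le> 2 * (\<theta> * M + \<eta>\<^sup>2) * real (card U)"
    by blast
  interpret g: state P \<psi> by unfold_locales fact
  interpret state P \<omega> by unfold_locales fact
  have d': "(\<Sum>u\<in>U. (nrm (resid U (T * u)))\<^sup>2) \<le> \<epsilon>\<^sup>2 / 4 * real (card U)" if "T \<in> F'" for T
  proof -
    have "2 * (\<theta> * M + \<eta>\<^sup>2) * real (card U) \<le> \<epsilon>\<^sup>2 / 4 * real (card U)"
      using \<theta>(2) \<eta>(3) by (intro mult_right_mono) simp_all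
    with bspec[OF d that] show ?thesis by linarith
  qed
  show "\<exists>(H :: ('a \<Rightarrow> complex) set) ip \<pi> \<Omega> Q.
        hilbert_space H ip \<and> positive_cyclic_representation P H ip \<pi> \<Omega> \<and>
        orthogonal_projection H ip Q \<and> finite_dimensional (Q ` H) \<and> (\<exists>x\<in>H. Q x \<noteq> 0) \<and>
        (\<forall>T\<in>F. hs_norm H ip (\<lambda>x. \<pi> T (Q x) - Q (\<pi> T x)) \<le> \<epsilon> * hs_norm H ip Q) \<and>
        inj_on (\<lambda>A. Q (\<pi> A \<Omega>)) (cspan F)"
  proof (rule compressed_representation[OF U(1-3) \<epsilon>])
    fix x assume x: "x \<in> cspan F" and x0: "nrm (proj U x) = 0"
    define c where "c g = sip \<phi> g x" for g
    have xc: "x = (\<Sum>g\<in>G. c g *\<^sub>C g)"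
      using f.proj_eq[OF G(1,2)] x G(3) by (simp add: f.proj_def c_def)
    \<comment> \<open>\<beta> approximates \<open>x\<close> and lies in W, so Q fixes it, while Q x
      is null. Hence \<beta> is no longer than x - \<beta>, and \<open>x\<close> at most twice as
      long.\<close>
    define \<beta> where "\<beta> = (\<Sum>g\<in>G. c g *\<^sub>C b g)"
    have "\<beta> \<in> cspan U"
      unfolding \<beta>_def U(4)[symmetric]
      using W(2) U(4) by (intro complex_vector.span_sum complex_vector.span_scale) (auto simp: F'_def)
    then have "proj U \<beta> = \<beta>" by (rule proj_eq[OF U(1,2)])
    then have "\<beta> = proj U x - proj U (x - \<beta>)" using U(1) by (simp add: proj_diff)
    then have "nrm \<beta> \<le> nrm (proj U (x - \<beta>))"
      using nrm_triangle_diff[of "proj U x" 0 "proj U (x - \<beta>)"] nrm_minus[of 0 "proj U (x - \<beta>)"] x0 by simp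
    also have "\<dots> \<le> nrm (x - \<beta>)" by (rule nrm_proj_le[OF U(1,2)]) simp
    finally have "nrm x \<le> 2 * nrm (x - \<beta>)" using nrm_triangle[of "x - \<beta>" \<beta>] by simp
    also have "\<dots> \<le> 2 * norm (x - \<beta>)" using nrm_le[of "x - \<beta>"] by simp
    also have "x - \<beta> = (\<Sum>g\<in>G. c g *\<^sub>C (g - b g))"
      by (simp add: xc \<beta>_def sum_subtractf complex_vector.scale_right_diff_distrib)
    also have "norm \<dots> \<le> (\<Sum>g\<in>G. norm (c g *\<^sub>C (g - b g)))" by (rule norm_sum)
    also have "\<dots> \<le> (\<Sum>g\<in>G. cmod (c g) * \<eta>)"
      using b by (intro sum_mono) (simp add: norm_scaleC mult_left_mono less_imp_le)
    finally have "nrm x \<le> 2 * (\<eta> * (\<Sum>g\<in>G. cmod (c g)))" by (simp add: sum_distrib_left mult.commute)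
    then have "(nrm x)\<^sup>2 \<le> (2 * (\<eta> * (\<Sum>g\<in>G. cmod (c g))))\<^sup>2" by (intro power_mono) simp_all
    also have "\<dots> = 4 * \<eta>\<^sup>2 * (\<Sum>g\<in>G. cmod (c g))\<^sup>2" by (simp add: power_mult_distrib)
    also have "\<dots> \<le> 4 * \<eta>\<^sup>2 * (real (card G) * (\<Sum>g\<in>G. (cmod (c g))\<^sup>2))"
      using Cauchy_Schwarz_ineq_sum[of "\<lambda>_. 1" "\<lambda>g. cmod (c g)" G] by (intro mult_left_mono) simp_all
    also have "\<dots> = 4 * (\<eta>\<^sup>2 * real (card G)) * (\<Sum>g\<in>G. (cmod (c g))\<^sup>2)" by simp
    also have "\<dots> \<le> 4 * (1 / 16) * (\<Sum>g\<in>G. (cmod (c g))\<^sup>2)"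
    proof -
      have "\<eta>\<^sup>2 * real (card G) \<le> 1 / (16 * (real (card G) + 1)) * real (card G)"
        using \<eta>(2) by (intro mult_right_mono) simp_all
      also have "\<dots> \<le> 1 / 16" by (simp add: field_simps)
      finally show ?thesis by (intro mult_right_mono mult_left_mono sum_nonneg) simp_all
    qed
    finally have upper: "(nrm x)\<^sup>2 \<le> 1 / 4 * (\<Sum>g\<in>G. (cmod (c g))\<^sup>2)" by simp
    have "(f.nrm x)\<^sup>2 = (\<Sum>g\<in>G. (cmod (c g))\<^sup>2)" unfolding xc by (rule f.nrm_sq_lin_comb[OF G(1,2)])
    \<comment> \<open>The \<phi>-half alone gives at least half of the coefficient sum, against the
      upper bound of a quarter; so the coefficient sum vanishes.\<close>
    moreover have "(nrm x)\<^sup>2 = ((f.nrm x)\<^sup>2 + (g.nrm x)\<^sup>2) / 2"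
      by (simp add: nrm_sq f.nrm_sq g.nrm_sq) (simp add: sip_def \<omega>(2))
    moreover have "0 \<le> (g.nrm x)\<^sup>2" by simp
    moreover have "A \<le> 0" if "N = (A + D) / 2" "0 \<le> D" "N \<le> 1 / 4 * A" for A D N :: real
      using that by (simp add: field_simps)
    ultimately have "(f.nrm x)\<^sup>2 \<le> 0" using upper by metis
    then have "f.nrm x = 0" by simp
    then have "\<phi> (star x * x) = 0" using f.nrm_eq_0_iff[of x] by (simp add: sip_def)
    then show "x = 0" by (rule \<phi>(2)[OF x])
  qed (rule d', simp add: F'_def)+
qed


section \<open>Passing to the completion\<close>

lemma linear_image_subspace:
  fixes f :: "'a::complex_vector \<Rightarrow> 'b::complex_vector"
  assumes "complex_linear f" "csubspace W"
  shows "csubspace (f ` W)"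
proof -
  have add: "f (x + y) = f x + f y" and scale: "f (c *\<^sub>C x) = c *\<^sub>C f x" for x y c
    using assms(1) unfolding complex_linear_def by blast+
  have "f 0 = 0" using add[of 0 0] by simp
  then have 0: "0 \<in> f ` W" using complex_vector.subspace_0[OF assms(2)] by (metis imageI)
  have "f x + f y \<in> f ` W" "c *\<^sub>C f x \<in> f ` W" if "x \<in> W" "y \<in> W" for x y c
    using that complex_vector.subspace_add[OF assms(2)] complex_vector.subspace_scale[OF assms(2)]
    by (auto simp flip: add scale)
  with 0 show ?thesis by (auto simp: complex_vector.subspace_def)
qed

lemma linear_image_span:
  fixes f :: "'a::complex_vector \<Rightarrow> 'b::complex_vector"
  assumes "complex_linear f"
  shows "f ` cspan S = cspan (f ` S)"
proof
  have "f (0 + 0) = f 0 + f 0" using assms unfolding complex_linear_def by blast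
  then have f0: "f 0 = 0" by simp
  have "csubspace {x. f x \<in> cspan (f ` S)}"
    using assms f0
    by (auto simp: complex_linear_def complex_vector.subspace_def intro: complex_vector.span_add complex_vector.span_scale complex_vector.span_zero)
  then have "cspan S \<subseteq> {x. f x \<in> cspan (f ` S)}"
    by (intro complex_vector.span_minimal) (auto intro: complex_vector.span_base)
  then show "f ` cspan S \<subseteq> cspan (f ` S)" by blast
  show "cspan (f ` S) \<subseteq> f ` cspan S"
    by (intro complex_vector.span_minimal linear_image_subspace assms complex_vector.subspace_span image_mono
        complex_vector.span_superset)
qed

lemma linear_image_cdim:
  fixes f :: "'a::complex_vector \<Rightarrow> 'b::complex_vector"
  assumes "complex_linear f" "inj f"
  shows "cdim (f ` W) = cdim W"
proof -
  interpret l: Vector_Spaces.linear "scaleC :: complex \<Rightarrow> 'a \<Rightarrow> 'a" "scaleC :: complex \<Rightarrow> 'b \<Rightarrow> 'b" f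
    using assms(1) by unfold_locales (simp_all add: complex_linear_def)
  obtain S where S: "S \<subseteq> W" "complex_vector.independent S" "W \<subseteq> cspan S" "card S = cdim W"
    using complex_vector.basis_exists[of W] by blast
  have "complex_vector.independent (f ` S)"
    using S(2) assms(2) by (intro l.independent_injective_image) (auto intro: inj_on_subset)
  moreover have "f ` S \<subseteq> f ` W" "f ` W \<subseteq> cspan (f ` S)"
    using S(1,3) by (auto simp flip: linear_image_span[OF assms(1)])
  ultimately have "cdim (f ` W) = card (f ` S)" by (intro complex_vector.dim_unique) auto
  also have "\<dots> = cdim W" using S(4) assms(2) by (simp add: card_image inj_on_subset)
  finally show ?thesis .
qed

lemma completion_map_inj: "completion_map \<iota> \<Longrightarrow> inj \<iota>"
proof (rule injI)
  fix x y assume *: "completion_map \<iota>" "\<iota> x = \<iota> y"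
  then have "\<iota> (x - y) + \<iota> y = \<iota> (x - y + y)" unfolding completion_map_def complex_linear_def by metis
  with * have "\<iota> (x - y) = 0" by simp
  moreover have "norm (\<iota> (x - y)) = norm (x - y)" using * unfolding completion_map_def by blast
  ultimately show "x = y" by simp
qed

text \<open>An injective homomorphism maps a W + W onto the corresponding space for the images and
  preserves both dimensions.\<close>

lemma foelner_subspace_image:
  fixes \<iota> :: "'a::pre_cstar_algebra \<Rightarrow> 'b::cstar_algebra"
  assumes \<iota>: "completion_map \<iota>" and W: "foelner_subspace B F \<epsilon> W"
  shows "foelner_subspace (\<iota> ` B) (\<iota> ` F) \<epsilon> (\<iota> ` W)"
proof -
  note inj = completion_map_inj[OF \<iota>]
  have lin: "complex_linear \<iota>" and add: "\<And>x y. \<iota> (x + y) = \<iota> x + \<iota> y" and mult: "\<And>x y. \<iota> (x * y) = \<iota> x * \<iota> y"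
    using \<iota> by (auto simp: completion_map_def complex_linear_def)
  have "\<iota> 0 = 0" using add[of 0 0] by simp
  have sub: "csubspace W" and "W \<subseteq> B" "W \<noteq> {0}" "finite_dimensional W"
    and dim: "\<And>a. a \<in> F \<Longrightarrow> real (cdim {a * v + w |v w. v \<in> W \<and> w \<in> W}) \<le> (1 + \<epsilon>) * real (cdim W)"
    using W by (auto simp: foelner_subspace_def)
  show ?thesis
    unfolding foelner_subspace_def
  proof (intro conjI ballI)
    show "csubspace (\<iota> ` W)" by (rule linear_image_subspace[OF lin sub])
    show "\<iota> ` W \<subseteq> \<iota> ` B" using \<open>W \<subseteq> B\<close> by blast
    show "\<iota> ` W \<noteq> {0}" using \<open>W \<noteq> {0}\<close> \<open>\<iota> 0 = 0\<close> inj by (metis image_empty image_insert inj_image_eq_iff)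
    obtain S where "finite S" "W \<subseteq> cspan S" using \<open>finite_dimensional W\<close> by (auto simp: finite_dimensional_def)
    then show "finite_dimensional (\<iota> ` W)"
      unfolding finite_dimensional_def
      by (intro exI[of _ "\<iota> ` S"]) (auto simp flip: linear_image_span[OF lin])
    fix a' assume "a' \<in> \<iota> ` F"
    then obtain a where a: "a \<in> F" "a' = \<iota> a" by blast
    have "{a' * v + w |v w. v \<in> \<iota> ` W \<and> w \<in> \<iota> ` W} = \<iota> ` {a * v + w |v w. v \<in> W \<and> w \<in> W}"
      by (auto simp: a add mult image_iff) (metis add mult)+
    then show "real (cdim {a' * v + w |v w. v \<in> \<iota> ` W \<and> w \<in> \<iota> ` W}) \<le> (1 + \<epsilon>) * real (cdim (\<iota> ` W))"
      using dim[OF a(1)] by (simp add: linear_image_cdim[OF lin inj])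
  qed
qed

lemma amenable_image:
  assumes \<iota>: "completion_map \<iota>" and "algebraically_amenable B"
  shows "algebraically_amenable (\<iota> ` B)"
  unfolding algebraically_amenable_def
proof (intro allI impI)
  fix \<epsilon> :: real and F assume "\<epsilon> > 0" "finite F \<and> F \<subseteq> \<iota> ` B"
  then obtain F0 where F0: "finite F0" "F0 \<subseteq> B" "F = \<iota> ` F0" using finite_subset_image by metis
  then obtain W where "foelner_subspace B F0 \<epsilon> W"
    using assms(2) \<open>\<epsilon> > 0\<close> unfolding algebraically_amenable_def by blast
  then show "\<exists>W. foelner_subspace (\<iota> ` B) F \<epsilon> W" using foelner_subspace_image[OF \<iota>] F0 by blast
qed

lemma properly_amenable_image:
  assumes \<iota>: "completion_map \<iota>" and "properly_algebraically_amenable B"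
  shows "properly_algebraically_amenable (\<iota> ` B)"
  unfolding properly_algebraically_amenable_def
proof (intro allI impI)
  fix \<epsilon> :: real and F assume "\<epsilon> > 0" "finite F \<and> F \<subseteq> \<iota> ` B"
  then obtain F0 where F0: "finite F0" "F0 \<subseteq> B" "F = \<iota> ` F0" using finite_subset_image by metis
  then obtain W where "foelner_subspace B F0 \<epsilon> W" "F0 \<subseteq> W"
    using assms(2) \<open>\<epsilon> > 0\<close> unfolding properly_algebraically_amenable_def by blast
  then show "\<exists>W. foelner_subspace (\<iota> ` B) F \<epsilon> W \<and> F \<subseteq> W" using foelner_subspace_image[OF \<iota>] F0 by blast
qed

lemma dense_image:
  fixes \<iota> :: "'a::pre_cstar_algebra \<Rightarrow> 'b::cstar_algebra"
  assumes \<iota>: "completion_map \<iota>" and "closure B = UNIV"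
  shows "closure (\<iota> ` B) = UNIV"
proof -
  have diff: "norm (\<iota> x - \<iota> y) = norm (x - y)" for x y
  proof -
    have "\<iota> (x - y) + \<iota> y = \<iota> (x - y + y)" using \<iota> unfolding completion_map_def complex_linear_def by metis
    then have "\<iota> (x - y) = \<iota> x - \<iota> y" by (simp add: eq_diff_eq)
    then show ?thesis using \<iota> unfolding completion_map_def by metis
  qed
  have "range \<iota> \<subseteq> closure (\<iota> ` B)"
  proof
    fix y assume "y \<in> range \<iota>"
    then obtain x where x: "y = \<iota> x" by blast
    have "\<exists>z\<in>B. norm (z - x) < e" if "e > 0" for e
      using assms(2) closure_approachable[of x B] that by (auto simp: dist_norm)
    then show "y \<in> closure (\<iota> ` B)" by (auto simp: closure_approachable dist_norm x diff)
  qed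
  then have "closure (range \<iota>) \<subseteq> closure (\<iota> ` B)" by (simp add: closure_minimal)
  then show ?thesis using \<iota> by (auto simp: completion_map_def)
qed

text \<open>States are composed with \<iota>: the norm clause survives because \<iota> is isometric,
  the cone clause because \<iota> maps the preimage cone into \<open>P\<close>. No theory of
  positivity is needed in the incomplete algebra.\<close>

lemma separating_states_pullback:
  fixes \<iota> :: "'a::pre_cstar_algebra \<Rightarrow> 'b::cstar_algebra"
  assumes \<iota>: "completion_map \<iota>" and P: "separating_states P"
  shows "separating_states (\<iota> -` P)"
  unfolding separating_states_def
proof (intro allI impI)
  fix x :: 'a assume "x \<noteq> 0"
  have hom: "\<And>x y. \<iota> (x + y) = \<iota> x + \<iota> y" "\<And>c x. \<iota> (c *\<^sub>C x) = c *\<^sub>C \<iota> x" "\<And>x y. \<iota> (x * y) = \<iota> x * \<iota> y"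
    "\<iota> 1 = 1" "\<And>x. \<iota> (star x) = star (\<iota> x)" and norm: "\<And>x. norm (\<iota> x) = norm x"
    using \<iota> by (auto simp: completion_map_def complex_linear_def)
  have "\<iota> x \<noteq> 0" using norm[of x] \<open>x \<noteq> 0\<close> by auto
  then obtain \<phi> where \<phi>: "state_on P \<phi>" "\<phi> (star (\<iota> x) * \<iota> x) \<noteq> 0" using P unfolding separating_states_def by blast
  interpret state P \<phi> by unfold_locales fact
  have "state_on (\<iota> -` P) (\<phi> \<circ> \<iota>)"
    unfolding state_on_def
  proof (intro conjI allI ballI)
    show "Re ((\<phi> \<circ> \<iota>) (star (a * y) * (a * y))) \<le> (norm a)\<^sup>2 * Re ((\<phi> \<circ> \<iota>) (star y * y))" for a y
      using bound[of "\<iota> a" "\<iota> y"] by (simp add: hom norm)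
  qed (simp_all add: hom add scale one star nonneg cone_nonneg)
  then show "\<exists>\<phi>. state_on (\<iota> -` P) \<phi> \<and> \<phi> (star x * x) \<noteq> 0" using \<phi>(2) by (intro exI[of _ "\<phi> \<circ> \<iota>"]) (simp add: hom)
qed

text \<open>For the completion, the general implications are applied to the image of
  \<open>B\<close>, which is dense and inherits amenability. For the algebra itself they are applied
  directly to \<open>B\<close> with the preimage cone, so neither maps nor representations have to
  be restricted.\<close>

theorem theorem3p17:
  fixes \<iota> :: "'a::pre_cstar_algebra \<Rightarrow> 'b::cstar_algebra"
    and B :: "'a set"
  assumes "completion_map \<iota>"
    and "subalgebra B"
    and "closure B = UNIV"
  shows "(algebraically_amenable B \<longrightarrow>
            foelner (cstar_positive :: 'b set) \<and> foelner (\<iota> -` cstar_positive)) \<and>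
         (properly_algebraically_amenable B \<longrightarrow>
            properly_foelner (cstar_positive :: 'b set) \<and> properly_foelner (\<iota> -` cstar_positive))"
  using foelner_if_amenable[OF dense_image separating_states_cstar amenable_image, OF assms(1,3,1)]
    foelner_if_amenable[OF assms(3) separating_states_pullback, OF assms(1) separating_states_cstar]
    properly_foelner_if_amenable[OF dense_image separating_states_cstar properly_amenable_image, OF assms(1,3,1)]
    properly_foelner_if_amenable[OF assms(3) separating_states_pullback, OF assms(1) separating_states_cstar]
  by blast

end
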